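(* Let $\mathfrak g$ be a complex simple Lie algebra with adjoint group $G$ and wonderful compactification $\overline G$. For any $(z,X)\in\tilde Z\subset Z\times\overline G$ we have $B(X)\subseteq B(z)$. In particular the subalgebra $B(X)\subset Y_V(\mathfrak g)\cong Y(\mathfrak g)$ is commutative.
   Context: **$\mathfrak g$ and the new realization.** $\mathfrak g$ is a complex simple Lie algebra of rank $n$ with Cartan subalgebra $\mathfrak h$, simple roots $\alpha_1,\dots,\alpha_n$, positive roots $\Phi^+$, fundamental weights $\omega_1,\dots,\omega_n$, Cartan matrix $a_{ij}=2(\alpha_i,\alpha_j)/(\alpha_i,\alpha_i)$; the invariant form $(\cdot,\cdot)$ is normalized so that $(\alpha,\alpha)=2$ for short roots, $d_i=(\alpha_i,\alpha_i)/2$, and $h_i\in\mathfrak h$ corresponds to $\alpha_i\in\mathfrak h^*$ under the form. $\tilde G$ is the connected simply connected group, $G=\tilde G/Z(\tilde G)$. $Y_{new}(\mathfrak g)$ is the unital associative $\mathbb C$-algebra generated by $e_i^{(r)},f_i^{(r)},h_i^{(r)}$ ($1\le i\le n$, $r\ge1$) with relations (all $i,j$, $r,s\ge 1$): $[h_i^{(r)},h_j^{(s)}]=0$; $[e_i^{(r)},f_j^{(s)}]=\delta_{ij}h_i^{(r+s-1)}$; $[h_i^{(1)},e_j^{(s)}]=(\alpha_i,\alpha_j)e_j^{(s)}$; $[h_i^{(1)},f_j^{(s)}]=-(\alpha_i,\alpha_j)f_j^{(s)}$; $[h_i^{(r+1)},e_j^{(s)}]-[h_i^{(r)},e_j^{(s+1)}]=\frac{(\alpha_i,\alpha_j)}2(h_i^{(r)}e_j^{(s)}+e_j^{(s)}h_i^{(r)})$;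 $[h_i^{(r+1)},f_j^{(s)}]-[h_i^{(r)},f_j^{(s+1)}]=-\frac{(\alpha_i,\alpha_j)}2(h_i^{(r)}f_j^{(s)}+f_j^{(s)}h_i^{(r)})$; $[e_i^{(r+1)},e_j^{(s)}]-[e_i^{(r)},e_j^{(s+1)}]=\frac{(\alpha_i,\alpha_j)}2(e_i^{(r)}e_j^{(s)}+e_j^{(s)}e_i^{(r)})$; $[f_i^{(r+1)},f_j^{(s)}]-[f_i^{(r)},f_j^{(s+1)}]=-\frac{(\alpha_i,\alpha_j)}2(f_i^{(r)}f_j^{(s)}+f_j^{(s)}f_i^{(r)})$; and for $i\ne j$, $N=1-a_{ij}$: $\mathrm{sym}[e_i^{(r_1)},[\dots,[e_i^{(r_N)},e_j^{(s)}]\dots]]=0$ and the same with $f$, where $\mathrm{sym}$ is symmetrization over $r_1,\dots,r_N$. **J-realization.** $Y(\mathfrak g)$ is generated by $x,J(x)$, $x\in\mathfrak g$, with relations: $xy-yx=[x,y]$, $J$ and $x\mapsto x$ linear, $J([x,y])=[J(x),y]$, $[J(x),[J(y),z]]-[x,[J(y),J(z)]]=\sum_{\lambda,\mu,\nu}([x,x_\lambda],[[y,x_\mu],[z,x_\nu]])\{x_\lambda,x_\mu,x_\nu\}$, and $[[J(x),J(y)],[z,J(w)]]+[[J(z),J(w)],[x,J(y)]]=\sum_{\lambda,\mu,\nu}\big(([x,x_\lambda],[[y,x_\mu],[[z,w],x_\nu]])+([z,x_\lambda],[[w,x_\mu],[[x,y],x_\nu]])\big)\{x_\lambda,x_\mu,J(x_\nu)\}$,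 where $\{x_\lambda\}$ is an orthonormal basis of $\mathfrak g$ and $\{y_1,y_2,y_3\}=\frac1{24}\sum_{\pi\in S_3}y_{\pi(1)}y_{\pi(2)}y_{\pi(3)}$. It is a Hopf algebra with $\Delta(x)=x\otimes1+1\otimes x$, $\Delta(J(x))=J(x)\otimes1+1\otimes J(x)+\frac12[x\otimes1,\Omega]$, $\Omega=\sum_a x_a\otimes x^a$ (dual bases of $\mathfrak g$). Let $x_\alpha^\pm$ ($\alpha\in\Phi^+$) be root vectors of weight $\pm\alpha$ with $(x_\alpha^+,x_\alpha^-)=1$. There is a unique algebra isomorphism $\phi:Y_{new}(\mathfrak g)\to Y(\mathfrak g)$ with $h_i^{(1)}\mapsto h_i$, $e_i^{(1)}\mapsto x_{\alpha_i}^+$, $f_i^{(1)}\mapsto x_{\alpha_i}^-$, $h_i^{(2)}\mapsto J(h_i)-\frac14\sum_{\alpha\in\Phi^+}(\alpha,\alpha_i)(x_\alpha^+x_\alpha^-+x_\alpha^-x_\alpha^+)+\frac12h_i^2$; the two algebras are identified via $\phi$. **Fundamental representations, R-matrix, $Y_V(\mathfrak g)$.** $V(\omega_i,a)$ is the finite-dimensional irreducible $Y(\mathfrak g)$-module generated by a vector $v$ with $e_j^{(r)}v=0$ for all $j,r$ on which $1+\sum_{r\ge1}h_j^{(r)}u^{-r}$ acts by the expansion at $u=\infty$ of $P_j(u+d_j)/P_j(u)$, where $P_i(u)=u-a$ and $P_j=1$ for $j\ne i$. Let $V=\bigoplus_{i=1}^nV(\omega_i,0)$, $\rho:Y(\mathfrak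 g)\to\mathrm{End}(V)$, $\rho_i:Y(\mathfrak g)\to\mathrm{End}\,V(\omega_i,0)$; via $\mathfrak g\subset Y(\mathfrak g)$ these are also representations of $\tilde G$ (again denoted $\rho,\rho_i$). $\hat R(u)\in1+u^{-1}(Y(\mathfrak g)\otimes Y(\mathfrak g))[[u^{-1}]]$ is the unique series (universal R-matrix) with $(\mathrm{id}\otimes\Delta)\hat R(u)=\hat R_{12}(u)\hat R_{13}(u)$ and $(\mathrm{id}\otimes\tau_u)\Delta^{op}(y)=\hat R(u)^{-1}\,(\mathrm{id}\otimes\tau_u)\Delta(y)\,\hat R(u)$ for all $y$, where $\tau_u(x)=x$, $\tau_u(J(x))=J(x)+ux$. Put $R(u)=(\rho\otimes\rho)\hat R(-u)$. $Y_V(\mathfrak g)$ is the algebra generated by $t_{ij}^{(r)}$ ($1\le i,j\le\dim V$, $r\ge1$), $T(u)=(t_{ij}(u))$, $t_{ij}(u)=\delta_{ij}+\sum_{r\ge1}t_{ij}^{(r)}u^{-r}$, with relations $R(u-v)T_1(u)T_2(v)=T_2(v)T_1(u)R(u-v)$ and $S^2(T(u))=T(u+\frac12c_{\mathfrak g})$, where $S$ is the antipode $T(u)\mapsto T(u)^{-1}$ and $c_{\mathfrak g}$ is the value of the Casimir element on the adjoint representation. There is an isomorphism $\psi:Y_V(\mathfrak g)\to Y(\mathfrak g)$, $T(u)\mapsto(\rho\otimes1)\hat R(-u)$. $Y_V(\mathfrak g)$ is filtered by $\deg t_{ij}^{(r)}=r$, with (finite-dimensional) filtered components $Y_V^{(r)}$.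 **Bethe subalgebras.** Let $T^i(u)$ be the diagonal block of $T(u)$ corresponding to $V(\omega_i,0)\subset V$. For $C\in\tilde G$, $B(C)\subset Y_V(\mathfrak g)$ is generated by all coefficients of $\tau_i(u,C)=\mathrm{tr}_{V(\omega_i,0)}\rho_i(C)T^i(u)$, $1\le i\le n$; it depends only on the image of $C$ in $G$. **Limit subalgebras.** $G^{reg}\subset G$ is the set of regular elements (centralizer of dimension $n$). For $C\in G^{reg}$ let $B^{(r)}(C)=Y_V^{(r)}\cap B(C)$; its dimension $d(r)$ does not depend on $C$. Let $\theta_r:G^{reg}\to\prod_{i=1}^r\mathrm{Gr}(d(i),Y_V^{(i)})$, $C\mapsto(B^{(1)}(C),\dots,B^{(r)}(C))$, let $Z_r$ be the Zariski closure of its image, and $Z=\varprojlim Z_r$ with respect to the natural projections $Z_r\to Z_{r-1}$. A point $z\in Z$ is a compatible sequence of subspaces $B^{(i)}(z)\subset Y_V^{(i)}$, and $B(z)=\bigcup_iB^{(i)}(z)$. **Wonderful compactification.** The closure of the image of $G$ in $\prod_i\mathbb P(\mathrm{End}\,V(\omega_i,0))$ is (isomorphic to) the De Concini–Procesi wonderful compactification $\overline G$. For $X=(X_1,\dots,X_n)\in\overline G$, $B(X)\subset Y_V(\mathfrak g)$ is the subalgebra generated by all coefficients of $\tau_i(u,X)=\mathrm{tr}_{V(\omega_i,0)}\hat X_iT^i(u)$, $1\le i\le n$, where $\hat X_i\in\mathrm{End}\,V(\omega_i,0)$ is any representative of $X_i$. $\tilde Z$ is the closure of $G^{reg}$ (embedded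 diagonally, via $(\theta_r)_r$ into $Z$ and via the inclusion into $\overline G$) in $Z\times\overline G$. *)

theory Defs
  imports
    "HOL-Analysis.Analysis"
    "HOL-Algebra.Coset"
    "HOL-Algebra.Generated_Groups"
    "HOL-Combinatorics.Permutations"
    "HOL-Library.Poly_Mapping"
    "HOL-Computational_Algebra.Formal_Laurent_Series"
begin

section \<open>Complex vector spaces and unital associative algebras\<close>

class complex_vec = ab_group_add +
  fixes scaleC :: "complex \<Rightarrow> 'a \<Rightarrow> 'a" (infixr "*\<^sub>C" 75)
  assumes scaleC_add_right: "c *\<^sub>C (x + y) = c *\<^sub>C x + c *\<^sub>C y"
    and scaleC_add_left: "(c + d) *\<^sub>C x = c *\<^sub>C x + d *\<^sub>C x"
    and scaleC_scaleC: "c *\<^sub>C d *\<^sub>C x = (c * d) *\<^sub>C x"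
    and scaleC_one: "1 *\<^sub>C x = x"

global_interpretation cv: vector_space "scaleC :: complex \<Rightarrow> 'a \<Rightarrow> 'a::complex_vec"
  by unfold_locales (simp_all add: scaleC_add_right scaleC_add_left scaleC_scaleC scaleC_one)

abbreviation clinear :: "('a::complex_vec \<Rightarrow> 'b::complex_vec) \<Rightarrow> bool"
  where "clinear \<equiv> Vector_Spaces.linear scaleC scaleC"

class complex_alg = complex_vec + ring_1 +
  assumes scaleC_mult_left: "(c *\<^sub>C x) * y = c *\<^sub>C (x * y)"
    and scaleC_mult_right: "x * (c *\<^sub>C y) = c *\<^sub>C (x * y)"

instantiation complex :: complex_alg
begin
definition scaleC_complex :: "complex \<Rightarrow> complex \<Rightarrow> complex" where "scaleC_complex c x = c * x"
instance by standard (simp_all add: scaleC_complex_def algebra_simps)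
end

instantiation vec :: (complex_vec, finite) complex_vec
begin
definition scaleC_vec :: "complex \<Rightarrow> 'a ^ 'b \<Rightarrow> 'a ^ 'b" where "scaleC_vec c v = (\<chi> i. c *\<^sub>C (v $ i))"
instance
  by standard
    (simp_all add: scaleC_vec_def vec_eq_iff scaleC_add_right scaleC_add_left scaleC_scaleC scaleC_one)
end

instantiation poly_mapping :: (type, complex_vec) complex_vec
begin
lift_definition scaleC_poly_mapping :: "complex \<Rightarrow> ('a \<Rightarrow>\<^sub>0 'b) \<Rightarrow> 'a \<Rightarrow>\<^sub>0 'b"
  is "\<lambda>c f k. c *\<^sub>C f k"
  by (erule finite_subset[rotated]) auto
instance
  by standard
    (transfer; simp add: fun_eq_iff scaleC_add_right scaleC_add_left scaleC_scaleC scaleC_one)+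
end

lemma lookup_scaleC [simp]: "Poly_Mapping.lookup (c *\<^sub>C p) k = c *\<^sub>C Poly_Mapping.lookup p k"
  by transfer simp

lemma scaleC_single: "c *\<^sub>C Poly_Mapping.single k v = Poly_Mapping.single k (c *\<^sub>C v)"
  by (rule poly_mapping_eqI) (simp add: lookup_single when_def)

lemma poly_mapping_single_induct [case_names single add]:
  fixes p :: "'a \<Rightarrow>\<^sub>0 'b::comm_monoid_add"
  assumes "\<And>k v. P (Poly_Mapping.single k v)" and "\<And>p q. P p \<Longrightarrow> P q \<Longrightarrow> P (p + q)"
  shows "P p"
proof (induction p rule: update_induct)
  case const
  then show ?case using assms(1)[of undefined 0] by simp
next
  case (update f a b)
  have "Poly_Mapping.update a b f = Poly_Mapping.single a b + f"
    using update(1)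
    by (intro poly_mapping_eqI) (auto simp: lookup_add lookup_single lookup_update when_def in_keys_iff)
  then show ?case using assms update by simp
qed

lemma scaleC_eq_single_mult: "c *\<^sub>C p = Poly_Mapping.single 0 (c *\<^sub>C 1) * p"
  for p :: "'a::monoid_add \<Rightarrow>\<^sub>0 'b::complex_alg"
proof (induction p rule: poly_mapping_single_induct)
  case (single k v)
  then show ?case by (simp add: mult_single scaleC_single scaleC_mult_left)
next
  case (add p q)
  then show ?case by (simp add: scaleC_add_right distrib_left)
qed

lemma single_scalar_commute:
  "p * Poly_Mapping.single 0 (c *\<^sub>C 1) = Poly_Mapping.single 0 (c *\<^sub>C 1) * p"
  for p :: "'a::monoid_add \<Rightarrow>\<^sub>0 'b::complex_alg"
proof (induction p rule: poly_mapping_single_induct)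
  case (single k v)
  then show ?case by (simp add: mult_single scaleC_mult_left scaleC_mult_right)
next
  case (add p q)
  then show ?case by (simp add: distrib_left distrib_right)
qed

instance poly_mapping :: (monoid_add, complex_alg) complex_alg
proof
  fix c :: complex and x y :: "'a \<Rightarrow>\<^sub>0 'b"
  show "(c *\<^sub>C x) * y = c *\<^sub>C (x * y)"
    by (simp only: scaleC_eq_single_mult mult.assoc)
  show "x * (c *\<^sub>C y) = c *\<^sub>C (x * y)"
    unfolding scaleC_eq_single_mult[of c] mult.assoc[symmetric] single_scalar_commute ..
qed

instantiation fls :: (complex_alg) complex_alg
begin
definition scaleC_fls :: "complex \<Rightarrow> 'a fls \<Rightarrow> 'a fls" where "scaleC_fls c f = fls_const (c *\<^sub>C 1) * f"
instance
proof
  fix c d :: complex and x y :: "'a fls"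
  show "c *\<^sub>C (x + y) = c *\<^sub>C x + c *\<^sub>C y"
    by (simp add: scaleC_fls_def distrib_left)
  show "(c + d) *\<^sub>C x = c *\<^sub>C x + d *\<^sub>C x"
    by (simp add: scaleC_fls_def scaleC_add_left fls_plus_const[symmetric] distrib_right)
  show "c *\<^sub>C d *\<^sub>C x = (c * d) *\<^sub>C x"
    by (simp add: scaleC_fls_def mult.assoc[symmetric] fls_const_mult_const scaleC_mult_left scaleC_scaleC)
  show "1 *\<^sub>C x = x"
    by (simp add: scaleC_fls_def scaleC_one)
  show "(c *\<^sub>C x) * y = c *\<^sub>C (x * y)"
    by (simp add: scaleC_fls_def mult.assoc)
  have "x * fls_const (c *\<^sub>C 1) = fls_const (c *\<^sub>C 1) * x"
    by (rule fls_eqI) (simp add: scaleC_mult_left scaleC_mult_right)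
  then show "x * (c *\<^sub>C y) = c *\<^sub>C (x * y)"
    unfolding scaleC_fls_def mult.assoc[symmetric] by simp
qed
end

definition calg_hom :: "('a::complex_alg \<Rightarrow> 'b::complex_alg) \<Rightarrow> bool" where
  "calg_hom f \<longleftrightarrow> clinear f \<and> f 1 = 1 \<and> (\<forall>x y. f (x * y) = f x * f y)"

definition comm :: "'a::ring \<Rightarrow> 'a \<Rightarrow> 'a" where "comm x y = x * y - y * x"

inductive_set subalg :: "'a::complex_alg set \<Rightarrow> 'a set" for S where
  subalg_incl: "x \<in> S \<Longrightarrow> x \<in> subalg S"
| subalg_one: "1 \<in> subalg S"
| subalg_scale: "x \<in> subalg S \<Longrightarrow> c *\<^sub>C x \<in> subalg S"
| subalg_add: "x \<in> subalg S \<Longrightarrow> y \<in> subalg S \<Longrightarrow> x + y \<in> subalg S"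
| subalg_mult: "x \<in> subalg S \<Longrightarrow> y \<in> subalg S \<Longrightarrow> x * y \<in> subalg S"

definition lin_ext :: "('k \<Rightarrow> 'c::complex_vec) \<Rightarrow> ('k \<Rightarrow>\<^sub>0 complex) \<Rightarrow> 'c" where
  "lin_ext h p = (\<Sum>k\<in>Poly_Mapping.keys p. Poly_Mapping.lookup p k *\<^sub>C h k)"

lemma lin_ext_superset:
  "finite S \<Longrightarrow> Poly_Mapping.keys p \<subseteq> S \<Longrightarrow> lin_ext h p = (\<Sum>k\<in>S. Poly_Mapping.lookup p k *\<^sub>C h k)"
  unfolding lin_ext_def by (rule sum.mono_neutral_left) (auto simp: in_keys_iff)

lemma lin_ext_single: "lin_ext h (Poly_Mapping.single k c) = c *\<^sub>C h k"
  by (cases "c = 0") (auto simp: lin_ext_def)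

lemma clinear_lin_ext: "clinear (lin_ext h)"
proof -
  have "lin_ext h (p + q) = lin_ext h p + lin_ext h q" for p q
    using keys_add[of p q]
    by (simp add: lin_ext_superset[of "Poly_Mapping.keys p \<union> Poly_Mapping.keys q"] lookup_add scaleC_add_left sum.distrib)
  moreover have "lin_ext h (c *\<^sub>C p) = c *\<^sub>C lin_ext h p" for c p
  proof -
    have "Poly_Mapping.keys (c *\<^sub>C p) \<subseteq> Poly_Mapping.keys p" by (auto simp: in_keys_iff scaleC_complex_def)
    then show ?thesis
      by (simp add: lin_ext_superset[of "Poly_Mapping.keys p"] cv.scale_sum_right scaleC_scaleC scaleC_complex_def)
  qed
  ultimately show ?thesis
    by (simp add: Vector_Spaces.linear_iff cv.vector_space_axioms)
qed


section \<open>Free algebras and presentations\<close>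

datatype 'a fmon = FMon (letters: "'a list")

instantiation fmon :: (type) monoid_add
begin
definition "0 = FMon []"
definition "u + v = FMon (letters u @ letters v)"
instance by standard (simp_all add: zero_fmon_def plus_fmon_def)
end

text \<open>The free associative algebra: the (noncommutative) monoid algebra of the monoid of words,
  whose operation is written additively because \<open>poly_mapping\<close> convolves along \<open>+\<close>.\<close>
type_synonym 'a falg = "'a fmon \<Rightarrow>\<^sub>0 complex"

definition var :: "'a \<Rightarrow> 'a falg" where "var x = Poly_Mapping.single (FMon [x]) 1"

definition feval :: "('x \<Rightarrow> 'a::complex_alg) \<Rightarrow> 'x falg \<Rightarrow> 'a" where
  "feval g = lin_ext (\<lambda>w. prod_list (map g (letters w)))"

text \<open>The anti-homomorphism of the free algebra with prescribed values on the generators.\<close>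
definition feval_anti :: "('x \<Rightarrow> 'a::complex_alg) \<Rightarrow> 'x falg \<Rightarrow> 'a" where
  "feval_anti g = lin_ext (\<lambda>w. prod_list (rev (map g (letters w))))"

inductive_set two_sided_ideal :: "'a::ring_1 set \<Rightarrow> 'a set" for S where
  ideal_zero: "0 \<in> two_sided_ideal S"
| ideal_incl: "x \<in> S \<Longrightarrow> a * x * b \<in> two_sided_ideal S"
| ideal_add: "x \<in> two_sided_ideal S \<Longrightarrow> y \<in> two_sided_ideal S \<Longrightarrow> x + y \<in> two_sided_ideal S"

text \<open>\<open>presents g Rel\<close>: the algebra \<open>'a\<close> with the elements \<open>g x\<close> is the algebra with generators
  \<open>x\<close> and relations \<open>p = 0\<close>, \<open>p \<in> Rel\<close>, that is, \<open>feval g\<close> induces an isomorphism from the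
  quotient of the free algebra by the ideal generated by \<open>Rel\<close>.\<close>
definition presents :: "('x \<Rightarrow> 'a::complex_alg) \<Rightarrow> 'x falg set \<Rightarrow> bool" where
  "presents g Rel \<longleftrightarrow> surj (feval g) \<and> (\<forall>p. feval g p = 0 \<longleftrightarrow> p \<in> two_sided_ideal Rel)"


section \<open>Tensor products of algebras\<close>

datatype ('a, 'b) pure = Pure (pure_fst: 'a) (pure_snd: 'b)

text \<open>Only a carrier for the product \<open>(a \<otimes> b) (a' \<otimes> b') = aa' \<otimes> bb'\<close>, which has to be written as \<open>+\<close>
  for the convolution of \<open>poly_mapping\<close>.\<close>
instantiation pure :: (monoid_mult, monoid_mult) monoid_add
begin
definition "0 = Pure 1 1"
definition "u + v = Pure (pure_fst u * pure_fst v) (pure_snd u * pure_snd v)"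
instance by standard (simp_all add: zero_pure_def plus_pure_def mult.assoc)
end

abbreviation psingle :: "'a \<Rightarrow> 'b \<Rightarrow> (('a, 'b) pure \<Rightarrow>\<^sub>0 complex)" where
  "psingle a b \<equiv> Poly_Mapping.single (Pure a b) 1"

definition bilin_rels :: "(('a::complex_vec, 'b::complex_vec) pure \<Rightarrow>\<^sub>0 complex) set" where
  "bilin_rels =
     {psingle (a + a') b - psingle a b - psingle a' b | a a' b. True}
   \<union> {psingle a (b + b') - psingle a b - psingle a b' | a b b'. True}
   \<union> {psingle (c *\<^sub>C a) b - c *\<^sub>C psingle a b | c a b. True}
   \<union> {psingle a (c *\<^sub>C b) - c *\<^sub>C psingle a b | c a b. True}"

definition tensor_null :: "(('a::complex_vec, 'b::complex_vec) pure \<Rightarrow>\<^sub>0 complex) set" where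
  "tensor_null = cv.span bilin_rels"

lemma psingle_mult:
  "psingle a b * psingle a' b' = psingle (a * a') (b * b')"
  for a a' :: "'a::monoid_mult" and b b' :: "'b::monoid_mult"
  by (simp add: mult_single plus_pure_def)

lemma single_psingle: "Poly_Mapping.single k c = c *\<^sub>C psingle (pure_fst k) (pure_snd k)"
  by (simp add: scaleC_single scaleC_complex_def)

lemma bilin_relsI:
  "psingle (a + a') b - psingle a b - psingle a' b \<in> bilin_rels"
  "psingle a (b + b') - psingle a b - psingle a b' \<in> bilin_rels"
  "psingle (c *\<^sub>C a) b - c *\<^sub>C psingle a b \<in> bilin_rels"
  "psingle a (c *\<^sub>C b) - c *\<^sub>C psingle a b \<in> bilin_rels"
  unfolding bilin_rels_def by blast+

lemma psingle_mult_rel: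
  fixes x :: "'a::complex_alg" and y :: "'b::complex_alg"
  assumes "r \<in> bilin_rels"
  shows "psingle x y * r \<in> bilin_rels" "r * psingle x y \<in> bilin_rels"
proof -
  note E = right_diff_distrib left_diff_distrib scaleC_mult_left scaleC_mult_right psingle_mult
    semiring_class.distrib_left semiring_class.distrib_right
  from assms consider
      (1) a a' b where "r = psingle (a + a') b - psingle a b - psingle a' b"
    | (2) a b b' where "r = psingle a (b + b') - psingle a b - psingle a b'"
    | (3) c a b where "r = psingle (c *\<^sub>C a) b - c *\<^sub>C psingle a b"
    | (4) c a b where "r = psingle a (c *\<^sub>C b) - c *\<^sub>C psingle a b"
    unfolding bilin_rels_def by blast
  then have "psingle x y * r \<in> bilin_rels \<and> r * psingle x y \<in> bilin_rels"
  proof cases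
    case 1 show ?thesis unfolding 1 E by (intro conjI bilin_relsI)
  next
    case 2 show ?thesis unfolding 2 E by (intro conjI bilin_relsI)
  next
    case 3 show ?thesis unfolding 3 E by (intro conjI bilin_relsI)
  next
    case 4 show ?thesis unfolding 4 E by (intro conjI bilin_relsI)
  qed
  then show "psingle x y * r \<in> bilin_rels" "r * psingle x y \<in> bilin_rels" by auto
qed

lemma tensor_null_ideal:
  fixes p q :: "('a::complex_alg, 'b::complex_alg) pure \<Rightarrow>\<^sub>0 complex"
  assumes "q \<in> tensor_null"
  shows "p * q \<in> tensor_null" "q * p \<in> tensor_null"
proof -
  have 1: "p * r \<in> tensor_null \<and> r * p \<in> tensor_null" if r: "r \<in> bilin_rels" for r
  proof (induction p rule: poly_mapping_single_induct)
    case (single k v)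
    show ?case unfolding single_psingle[of k v] tensor_null_def scaleC_mult_left scaleC_mult_right
      by (intro conjI cv.span_scale[OF cv.span_base] psingle_mult_rel[OF r])
  next
    case (add p q)
    then show ?case unfolding tensor_null_def distrib_left distrib_right
      by (auto intro!: cv.span_add)
  qed
  have "p * q \<in> tensor_null \<and> q * p \<in> tensor_null"
    using assms[unfolded tensor_null_def]
  proof (induction rule: cv.span_induct_alt)
    case base
    then show ?case by (simp add: tensor_null_def cv.span_zero)
  next
    case (step c r q)
    then show ?case using 1[of r]
      by (auto simp: tensor_null_def distrib_left distrib_right scaleC_mult_left scaleC_mult_right
          intro!: cv.span_add cv.span_scale)
  qed
  then show "p * q \<in> tensor_null" "q * p \<in> tensor_null" by auto
qed

quotient_type (overloaded) ('a, 'b) tensor =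
  "('a::complex_alg, 'b::complex_alg) pure \<Rightarrow>\<^sub>0 complex" / "\<lambda>p q. p - q \<in> tensor_null"
proof (rule equivpI)
  show "reflp (\<lambda>p q :: ('a, 'b) pure \<Rightarrow>\<^sub>0 complex. p - q \<in> tensor_null)"
    by (auto simp: reflp_def tensor_null_def cv.span_zero)
  show "symp (\<lambda>p q :: ('a, 'b) pure \<Rightarrow>\<^sub>0 complex. p - q \<in> tensor_null)"
    unfolding symp_def tensor_null_def using cv.span_neg by fastforce
  show "transp (\<lambda>p q :: ('a, 'b) pure \<Rightarrow>\<^sub>0 complex. p - q \<in> tensor_null)"
    unfolding transp_def tensor_null_def using cv.span_add by fastforce
qed

lift_definition tens :: "'a::complex_alg \<Rightarrow> 'b::complex_alg \<Rightarrow> ('a, 'b) tensor" (infix "\<otimes>\<^sub>t" 72)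
  is psingle .

lemma ex_clinear_one: "\<exists>f :: 'a::complex_alg \<Rightarrow> complex. clinear f \<and> f 1 = 1"
proof -
  interpret vp: vector_space_pair "scaleC :: complex \<Rightarrow> 'a \<Rightarrow> 'a" "scaleC :: complex \<Rightarrow> complex \<Rightarrow> complex" ..
  have "cv.independent {1::'a}" by simp
  from vp.linear_independent_extend[OF this, of "\<lambda>_. 1"] show ?thesis by auto
qed

lemma lin_ext_tensor_null:
  assumes "\<And>b. clinear (\<lambda>a. \<beta> a b)" "\<And>a. clinear (\<beta> a)" "p \<in> tensor_null"
  shows "lin_ext (\<lambda>k. \<beta> (pure_fst k) (pure_snd k)) p = 0"
proof -
  let ?L = "lin_ext (\<lambda>k. \<beta> (pure_fst k) (pure_snd k))"
  interpret L: Vector_Spaces.linear scaleC scaleC ?L by (rule clinear_lin_ext)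
  have 1: "?L (psingle a b) = \<beta> a b" for a b by (simp add: lin_ext_single scaleC_one)
  have 2: "\<beta> (a + a') b = \<beta> a b + \<beta> a' b" "\<beta> (c *\<^sub>C a) b = c *\<^sub>C \<beta> a b"
    "\<beta> a (b + b') = \<beta> a b + \<beta> a b'" "\<beta> a (c *\<^sub>C b) = c *\<^sub>C \<beta> a b" for a a' b b' c
    using assms(1)[of b] assms(2)[of a] unfolding Vector_Spaces.linear_iff by auto
  from assms(3)[unfolded tensor_null_def] show ?thesis
  proof (induction rule: cv.span_induct_alt)
    case base then show ?case by (rule L.zero)
  next
    case (step c r q)
    have "?L r = 0" using step(1) unfolding bilin_rels_def
      by (auto simp: L.diff L.scale 1 2)
    then show ?case using step by (simp add: L.add L.scale)
  qed
qed

instantiation tensor :: (complex_alg, complex_alg) complex_alg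
begin
lift_definition zero_tensor :: "('a, 'b) tensor" is 0 .
lift_definition one_tensor :: "('a, 'b) tensor" is 1 .
lift_definition uminus_tensor :: "('a, 'b) tensor \<Rightarrow> ('a, 'b) tensor" is uminus
  unfolding tensor_null_def using cv.span_neg by fastforce
lift_definition plus_tensor :: "('a, 'b) tensor \<Rightarrow> ('a, 'b) tensor \<Rightarrow> ('a, 'b) tensor" is "(+)"
  unfolding tensor_null_def add_diff_add by (rule cv.span_add)
lift_definition minus_tensor :: "('a, 'b) tensor \<Rightarrow> ('a, 'b) tensor \<Rightarrow> ('a, 'b) tensor" is "(-)"
proof -
  fix p p' q q' :: "('a, 'b) pure \<Rightarrow>\<^sub>0 complex"
  assume "p - p' \<in> tensor_null" "q - q' \<in> tensor_null"
  then have "(p - p') - (q - q') \<in> tensor_null" unfolding tensor_null_def by (rule cv.span_diff)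
  then show "p - q - (p' - q') \<in> tensor_null" by (simp add: algebra_simps)
qed
lift_definition times_tensor :: "('a, 'b) tensor \<Rightarrow> ('a, 'b) tensor \<Rightarrow> ('a, 'b) tensor" is "(*)"
proof -
  fix p p' q q' :: "('a, 'b) pure \<Rightarrow>\<^sub>0 complex"
  assume "p - p' \<in> tensor_null" "q - q' \<in> tensor_null"
  then have "p * (q - q') + (p - p') * q' \<in> tensor_null"
    unfolding tensor_null_def by (intro cv.span_add tensor_null_ideal[unfolded tensor_null_def])
  then show "p * q - p' * q' \<in> tensor_null" by (simp add: algebra_simps)
qed
lift_definition scaleC_tensor :: "complex \<Rightarrow> ('a, 'b) tensor \<Rightarrow> ('a, 'b) tensor" is scaleC
  unfolding tensor_null_def cv.scale_right_diff_distrib[symmetric] by (rule cv.span_scale)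
instance
proof
  have z: "p - q \<in> tensor_null" if "p = q" for p q :: "('a, 'b) pure \<Rightarrow>\<^sub>0 complex"
    using that by (simp add: tensor_null_def cv.span_zero)
  fix a b c :: "('a, 'b) tensor" and s t :: complex
  show "a + b + c = a + (b + c)" by transfer (rule z, rule add.assoc)
  show "a + b = b + a" by transfer (rule z, rule add.commute)
  show "0 + a = a" by transfer (rule z, rule add_0_left)
  show "- a + a = 0" by transfer (rule z, rule left_minus)
  show "a - b = a + - b" by transfer (rule z, rule diff_conv_add_uminus)
  show "s *\<^sub>C (a + b) = s *\<^sub>C a + s *\<^sub>C b" by transfer (rule z, rule scaleC_add_right)
  show "(s + t) *\<^sub>C a = s *\<^sub>C a + t *\<^sub>C a" by transfer (rule z, rule scaleC_add_left)
  show "s *\<^sub>C t *\<^sub>C a = (s * t) *\<^sub>C a" by transfer (rule z, rule scaleC_scaleC)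
  show "1 *\<^sub>C a = a" by transfer (rule z, rule scaleC_one)
  show "a * b * c = a * (b * c)" by transfer (rule z, rule mult.assoc)
  show "1 * a = a" by transfer (rule z, rule mult_1_left)
  show "a * 1 = a" by transfer (rule z, rule mult_1_right)
  show "(a + b) * c = a * c + b * c" by transfer (rule z, rule semiring_class.distrib_right)
  show "a * (b + c) = a * b + a * c" by transfer (rule z, rule semiring_class.distrib_left)
  show "(s *\<^sub>C a) * b = s *\<^sub>C (a * b)" by transfer (rule z, rule scaleC_mult_left)
  show "a * (s *\<^sub>C b) = s *\<^sub>C (a * b)" by transfer (rule z, rule scaleC_mult_right)
  show "(0 :: ('a, 'b) tensor) \<noteq> 1"
  proof (transfer, rule notI)
    obtain f :: "'a \<Rightarrow> complex" and g :: "'b \<Rightarrow> complex"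
      where fg: "clinear f" "f 1 = 1" "clinear g" "g 1 = 1"
      using ex_clinear_one by metis
    assume "0 - (1 :: ('a, 'b) pure \<Rightarrow>\<^sub>0 complex) \<in> tensor_null"
    then have "(1 :: ('a, 'b) pure \<Rightarrow>\<^sub>0 complex) \<in> tensor_null"
      unfolding tensor_null_def using cv.span_neg by fastforce
    then have "lin_ext (\<lambda>k. f (pure_fst k) * g (pure_snd k)) (1 :: ('a, 'b) pure \<Rightarrow>\<^sub>0 complex) = 0"
      using fg by (intro lin_ext_tensor_null)
        (auto simp: Vector_Spaces.linear_iff scaleC_complex_def algebra_simps)
    moreover have "(1 :: ('a, 'b) pure \<Rightarrow>\<^sub>0 complex) = psingle 1 1"
      by (simp add: zero_pure_def flip: single_one)
    moreover have "lin_ext (\<lambda>k. f (pure_fst k) * g (pure_snd k)) (psingle 1 1) = 1"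
      using fg by (simp only: lin_ext_single) (simp add: scaleC_complex_def)
    ultimately show False by simp
  qed
qed
end

text \<open>The linear map on the tensor product induced by a bilinear map \<open>\<beta>\<close>
  (see \<open>tensor_lift_tens\<close>).\<close>
definition tensor_lift ::
  "('a::complex_alg \<Rightarrow> 'b::complex_alg \<Rightarrow> 'c::complex_vec) \<Rightarrow> ('a, 'b) tensor \<Rightarrow> 'c" where
  "tensor_lift \<beta> s = lin_ext (\<lambda>k. \<beta> (pure_fst k) (pure_snd k)) (rep_tensor s)"

lemma tensor_lift_abs:
  assumes "\<And>b. clinear (\<lambda>a. \<beta> a b)" "\<And>a. clinear (\<beta> a)"
  shows "tensor_lift \<beta> (abs_tensor p) = lin_ext (\<lambda>k. \<beta> (pure_fst k) (pure_snd k)) p"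
proof -
  let ?L = "lin_ext (\<lambda>k. \<beta> (pure_fst k) (pure_snd k))"
  interpret L: Vector_Spaces.linear scaleC scaleC ?L by (rule clinear_lin_ext)
  have "rep_tensor (abs_tensor p) - p \<in> tensor_null"
    by (rule Quotient3_rep_abs[OF Quotient3_tensor])
      (simp add: tensor_null_def cv.span_zero)
  then have "?L (rep_tensor (abs_tensor p) - p) = 0"
    by (rule lin_ext_tensor_null[OF assms])
  then show ?thesis by (simp add: tensor_lift_def L.diff)
qed

lemma tensor_lift_tens:
  assumes "\<And>b. clinear (\<lambda>a. \<beta> a b)" "\<And>a. clinear (\<beta> a)"
  shows "tensor_lift \<beta> (a \<otimes>\<^sub>t b) = \<beta> a b"
  using tensor_lift_abs[OF assms] by (simp add: tens.abs_eq lin_ext_single scaleC_one)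


section \<open>Simple Lie algebras and root data\<close>

class complex_lie = complex_vec +
  fixes lie :: "'a \<Rightarrow> 'a \<Rightarrow> 'a"
  assumes lie_add_left: "lie (x + y) z = lie x z + lie y z"
    and lie_scale_left: "lie (c *\<^sub>C x) y = c *\<^sub>C lie x y"
    and lie_add_right: "lie x (y + z) = lie x y + lie x z"
    and lie_scale_right: "lie x (c *\<^sub>C y) = c *\<^sub>C lie x y"
    and lie_alternating: "lie x x = 0"
    and lie_jacobi: "lie x (lie y z) + lie y (lie z x) + lie z (lie x y) = 0"

definition cbasis :: "'a::complex_vec set \<Rightarrow> bool" where
  "cbasis B \<longleftrightarrow> finite B \<and> cv.independent B \<and> cv.span B = UNIV"

definition simple_lie_algebra :: "'g::complex_lie itself \<Rightarrow> bool" where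
  "simple_lie_algebra _ \<longleftrightarrow>
     (\<exists>B :: 'g set. cbasis B) \<and>
     (\<exists>x y :: 'g. lie x y \<noteq> 0) \<and>
     (\<forall>I :: 'g set. cv.subspace I \<and> (\<forall>x. \<forall>y\<in>I. lie x y \<in> I) \<longrightarrow> I = {0} \<or> I = UNIV)"

fun lower_central :: "'g::complex_lie set \<Rightarrow> nat \<Rightarrow> 'g set" where
  "lower_central L 0 = L"
| "lower_central L (Suc k) = cv.span {lie x y | x y. x \<in> L \<and> y \<in> lower_central L k}"

text \<open>Nilpotent and self-normalizing.\<close>
definition cartan_subalgebra :: "'g::complex_lie set \<Rightarrow> bool" where
  "cartan_subalgebra H \<longleftrightarrow>
     cv.subspace H \<and> (\<forall>x\<in>H. \<forall>y\<in>H. lie x y \<in> H) \<and>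
     (\<exists>k. lower_central H k = {0}) \<and>
     (\<forall>x. (\<forall>y\<in>H. lie x y \<in> H) \<longrightarrow> x \<in> H)"

definition invariant_form :: "('g::complex_lie \<Rightarrow> 'g \<Rightarrow> complex) \<Rightarrow> bool" where
  "invariant_form form \<longleftrightarrow>
     (\<forall>x. clinear (form x)) \<and> (\<forall>x y. form x y = form y x) \<and>
     (\<forall>x y z. form (lie x y) z = form x (lie y z)) \<and>
     (\<forall>x. (\<forall>y. form x y = 0) \<longrightarrow> x = 0)"

definition dual_bases :: "('g::complex_vec \<Rightarrow> 'g \<Rightarrow> complex) \<Rightarrow> 'g set \<Rightarrow> ('g \<Rightarrow> 'g) \<Rightarrow> bool" where
  "dual_bases form B d \<longleftrightarrow>
     cbasis B \<and> (\<forall>b\<in>B. \<forall>b'\<in>B. form b (d b') = (if b = b' then 1 else 0))"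

definition orthonormal_basis :: "('g::complex_vec \<Rightarrow> 'g \<Rightarrow> complex) \<Rightarrow> 'g set \<Rightarrow> bool" where
  "orthonormal_basis form B \<longleftrightarrow> dual_bases form B id"

definition casimir_adjoint :: "('g::complex_lie \<Rightarrow> 'g \<Rightarrow> complex) \<Rightarrow> complex" where
  "casimir_adjoint form =
     (THE c. \<forall>B d. dual_bases form B d \<longrightarrow> (\<forall>x. (\<Sum>b\<in>B. lie b (lie (d b) x)) = c *\<^sub>C x))"

text \<open>The dual of the Cartan subalgebra \<open>H\<close> is identified with \<open>H\<close> by means of the invariant form:
  an element \<open>\<beta> \<in> H\<close> stands for the functional \<open>form \<beta>\<close>, so that the form on the dual is \<open>form\<close>
  itself, and a simple root \<open>\<alpha> i\<close> is at the same time the element \<open>h\<^sub>i\<close> of \<open>H\<close>.\<close>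
definition root_space :: "('g::complex_lie \<Rightarrow> 'g \<Rightarrow> complex) \<Rightarrow> 'g set \<Rightarrow> 'g \<Rightarrow> 'g set" where
  "root_space form H \<beta> = {x. \<forall>h\<in>H. lie h x = form \<beta> h *\<^sub>C x}"

definition roots :: "('g::complex_lie \<Rightarrow> 'g \<Rightarrow> complex) \<Rightarrow> 'g set \<Rightarrow> 'g set" where
  "roots form H = {\<beta> \<in> H. \<beta> \<noteq> 0 \<and> root_space form H \<beta> \<noteq> {0}}"

definition pos_roots ::
  "('g::complex_lie \<Rightarrow> 'g \<Rightarrow> complex) \<Rightarrow> 'g set \<Rightarrow> ('i::finite \<Rightarrow> 'g) \<Rightarrow> 'g set" where
  "pos_roots form H \<alpha> =
     {\<beta> \<in> roots form H. \<exists>c :: 'i \<Rightarrow> nat. \<beta> = (\<Sum>i\<in>UNIV. of_nat (c i) *\<^sub>C \<alpha> i)}"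

text \<open>All squared lengths of roots are positive multiples of each other, hence the short roots are
  those for which the modulus of the squared length is minimal.\<close>
definition short_root :: "('g::complex_lie \<Rightarrow> 'g \<Rightarrow> complex) \<Rightarrow> 'g set \<Rightarrow> 'g \<Rightarrow> bool" where
  "short_root form H \<beta> \<longleftrightarrow>
     \<beta> \<in> roots form H \<and> (\<forall>\<gamma>\<in>roots form H. cmod (form \<beta> \<beta>) \<le> cmod (form \<gamma> \<gamma>))"

definition root_data ::
  "('g::complex_lie \<Rightarrow> 'g \<Rightarrow> complex) \<Rightarrow> 'g set \<Rightarrow> ('i::finite \<Rightarrow> 'g) \<Rightarrow> bool" where
  "root_data form H \<alpha> \<longleftrightarrow>
     invariant_form form \<and> cartan_subalgebra H \<and>
     (\<forall>\<beta>. short_root form H \<beta> \<longrightarrow> form \<beta> \<beta> = 2) \<and>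
     inj \<alpha> \<and> range \<alpha> \<subseteq> roots form H \<and> cv.independent (range \<alpha>) \<and>
     (\<forall>\<beta>\<in>roots form H. \<beta> \<in> pos_roots form H \<alpha> \<or> - \<beta> \<in> pos_roots form H \<alpha>)"

definition root_vectors ::
  "('g::complex_lie \<Rightarrow> 'g \<Rightarrow> complex) \<Rightarrow> 'g set \<Rightarrow> ('i::finite \<Rightarrow> 'g) \<Rightarrow> ('g \<Rightarrow> 'g) \<Rightarrow> ('g \<Rightarrow> 'g) \<Rightarrow> bool"
  where
  "root_vectors form H \<alpha> xp xm \<longleftrightarrow>
     (\<forall>\<beta>\<in>pos_roots form H \<alpha>.
        xp \<beta> \<in> root_space form H \<beta> \<and> xm \<beta> \<in> root_space form H (- \<beta>) \<and> form (xp \<beta>) (xm \<beta>) = 1)"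


section \<open>The Yangian in the J-realization\<close>

datatype 'g jgen = Gen_x 'g | Gen_J 'g

definition sym3 :: "'a::complex_alg \<Rightarrow> 'a \<Rightarrow> 'a \<Rightarrow> 'a" where
  "sym3 a b c = (1/24) *\<^sub>C (a*b*c + a*c*b + b*a*c + b*c*a + c*a*b + c*b*a)"

definition yangian_rels :: "('g::complex_lie \<Rightarrow> 'g \<Rightarrow> complex) \<Rightarrow> 'g jgen falg set" where
  "yangian_rels form =
    (let X = (\<lambda>x. var (Gen_x x)); J = (\<lambda>x. var (Gen_J x)) in
       {comm (X x) (X y) - X (lie x y) | x y. True}
     \<union> {X (a *\<^sub>C x + b *\<^sub>C y) - (a *\<^sub>C X x + b *\<^sub>C X y) | a b x y. True}
     \<union> {J (a *\<^sub>C x + b *\<^sub>C y) - (a *\<^sub>C J x + b *\<^sub>C J y) | a b x y. True}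
     \<union> {J (lie x y) - comm (J x) (X y) | x y. True}
     \<union> {comm (J x) (comm (J y) (X z)) - comm (X x) (comm (J y) (J z))
          - (\<Sum>l\<in>B. \<Sum>m\<in>B. \<Sum>n\<in>B.
               form (lie x l) (lie (lie y m) (lie z n)) *\<^sub>C sym3 (X l) (X m) (X n))
        | x y z B. orthonormal_basis form B}
     \<union> {comm (comm (J x) (J y)) (comm (X z) (J w)) + comm (comm (J z) (J w)) (comm (X x) (J y))
          - (\<Sum>l\<in>B. \<Sum>m\<in>B. \<Sum>n\<in>B.
               (form (lie x l) (lie (lie y m) (lie (lie z w) n))
                + form (lie z l) (lie (lie w m) (lie (lie x y) n))) *\<^sub>C sym3 (X l) (X m) (J n))
        | x y z w B. orthonormal_basis form B})"

definition is_yangian ::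
  "('g::complex_lie \<Rightarrow> 'g \<Rightarrow> complex) \<Rightarrow> ('g \<Rightarrow> 'y::complex_alg) \<Rightarrow> ('g \<Rightarrow> 'y) \<Rightarrow> bool" where
  "is_yangian form inc J \<longleftrightarrow> presents (case_jgen inc J) (yangian_rels form)"

definition is_coproduct ::
  "('g::complex_lie \<Rightarrow> 'g \<Rightarrow> complex) \<Rightarrow> ('g \<Rightarrow> 'y::complex_alg) \<Rightarrow> ('g \<Rightarrow> 'y) \<Rightarrow>
     ('y \<Rightarrow> ('y, 'y) tensor) \<Rightarrow> bool" where
  "is_coproduct form inc J \<Delta> \<longleftrightarrow>
     calg_hom \<Delta> \<and>
     (\<forall>x. \<Delta> (inc x) = inc x \<otimes>\<^sub>t 1 + 1 \<otimes>\<^sub>t inc x) \<and>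
     (\<forall>B d x. dual_bases form B d \<longrightarrow>
        \<Delta> (J x) = J x \<otimes>\<^sub>t 1 + 1 \<otimes>\<^sub>t J x
          + (1/2) *\<^sub>C comm (inc x \<otimes>\<^sub>t 1) (\<Sum>b\<in>B. inc b \<otimes>\<^sub>t inc (d b)))"

text \<open>Formal series in \<open>u\<inverse>\<close> are elements of \<open>fps\<close> and \<open>fls\<close> whose variable is \<open>u\<inverse>\<close>; thus \<open>u\<close> is
  \<open>fls_X_inv\<close>.\<close>

definition is_shift ::
  "('g \<Rightarrow> 'y::complex_alg) \<Rightarrow> ('g \<Rightarrow> 'y) \<Rightarrow> ('y \<Rightarrow> 'y fls) \<Rightarrow> bool" where
  "is_shift inc J \<tau> \<longleftrightarrow>
     calg_hom \<tau> \<and>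
     (\<forall>x. \<tau> (inc x) = fls_const (inc x)) \<and>
     (\<forall>x. \<tau> (J x) = fls_const (J x) + fls_X_inv * fls_const (inc x))"

definition id_tensor_shift ::
  "('y::complex_alg \<Rightarrow> 'y fls) \<Rightarrow> ('y, 'y) tensor \<Rightarrow> ('y, 'y) tensor fls" where
  "id_tensor_shift \<tau> s = Abs_fls (\<lambda>k. tensor_lift (\<lambda>a b. a \<otimes>\<^sub>t fls_nth (\<tau> b) k) s)"

definition fps_map :: "('a::zero \<Rightarrow> 'b::zero) \<Rightarrow> 'a fps \<Rightarrow> 'b fps" where
  "fps_map f F = Abs_fps (\<lambda>k. f (fps_nth F k))"

text \<open>The second defining identity of the universal R-matrix, with \<open>R(u)\<inverse>\<close> moved to the other
  side; \<open>R(u)\<close> is invertible because its constant term is \<open>1\<close>.\<close>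
definition is_universal_R ::
  "('y::complex_alg \<Rightarrow> ('y, 'y) tensor) \<Rightarrow> ('y \<Rightarrow> 'y fls) \<Rightarrow> ('y, 'y) tensor fps \<Rightarrow> bool" where
  "is_universal_R \<Delta> \<tau> Rhat \<longleftrightarrow>
     fps_nth Rhat 0 = 1 \<and>
     fps_map (tensor_lift (\<lambda>a b. a \<otimes>\<^sub>t \<Delta> b)) Rhat =
       fps_map (tensor_lift (\<lambda>a b. a \<otimes>\<^sub>t (b \<otimes>\<^sub>t 1))) Rhat *
       fps_map (tensor_lift (\<lambda>a b. a \<otimes>\<^sub>t (1 \<otimes>\<^sub>t b))) Rhat \<and>
     (\<forall>y. fps_to_fls Rhat * id_tensor_shift \<tau> (tensor_lift (\<lambda>a b. b \<otimes>\<^sub>t a) (\<Delta> y)) =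
          id_tensor_shift \<tau> (\<Delta> y) * fps_to_fls Rhat)"


section \<open>The new realization\<close>

text \<open>\<open>Gen_e i k\<close> stands for the generator \<open>e\<^sub>i\<close> with upper index \<open>k + 1\<close>, so that there are no
  generators with upper index \<open>0\<close>; similarly for \<open>f\<close> and \<open>h\<close>.\<close>
datatype 'i newgen = Gen_e 'i nat | Gen_f 'i nat | Gen_h 'i nat

definition serre_sym :: "(nat \<Rightarrow> 'a::ring) \<Rightarrow> 'a \<Rightarrow> nat list \<Rightarrow> 'a" where
  "serre_sym x y rs =
     (\<Sum>\<pi> | \<pi> permutes {..<length rs}. fold comm (rev (map (\<lambda>k. x (rs ! \<pi> k)) [0..<length rs])) y)"

text \<open>\<open>c i j\<close> is \<open>(\<alpha>\<^sub>i, \<alpha>\<^sub>j)\<close>.\<close>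
definition new_yangian_rels :: "('i \<Rightarrow> 'i \<Rightarrow> complex) \<Rightarrow> 'i newgen falg set" where
  "new_yangian_rels c =
    (let e = (\<lambda>i r. var (Gen_e i (r - 1))); f = (\<lambda>i r. var (Gen_f i (r - 1)));
         h = (\<lambda>i r. var (Gen_h i (r - 1))) in
       {comm (h i r) (h j s) | i j r s. r \<ge> 1 \<and> s \<ge> 1}
     \<union> {comm (e i r) (f j s) - (if i = j then h i (r + s - 1) else 0) | i j r s. r \<ge> 1 \<and> s \<ge> 1}
     \<union> {comm (h i 1) (e j s) - c i j *\<^sub>C e j s | i j s. s \<ge> 1}
     \<union> {comm (h i 1) (f j s) + c i j *\<^sub>C f j s | i j s. s \<ge> 1}
     \<union> {comm (h i (r + 1)) (e j s) - comm (h i r) (e j (s + 1))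
          - (c i j / 2) *\<^sub>C (h i r * e j s + e j s * h i r) | i j r s. r \<ge> 1 \<and> s \<ge> 1}
     \<union> {comm (h i (r + 1)) (f j s) - comm (h i r) (f j (s + 1))
          + (c i j / 2) *\<^sub>C (h i r * f j s + f j s * h i r) | i j r s. r \<ge> 1 \<and> s \<ge> 1}
     \<union> {comm (e i (r + 1)) (e j s) - comm (e i r) (e j (s + 1))
          - (c i j / 2) *\<^sub>C (e i r * e j s + e j s * e i r) | i j r s. r \<ge> 1 \<and> s \<ge> 1}
     \<union> {comm (f i (r + 1)) (f j s) - comm (f i r) (f j (s + 1))
          + (c i j / 2) *\<^sub>C (f i r * f j s + f j s * f i r) | i j r s. r \<ge> 1 \<and> s \<ge> 1}
     \<union> {serre_sym (e i) (e j s) rs | i j s rs. i \<noteq> j \<and> s \<ge> 1 \<and> (\<forall>r\<in>set rs. r \<ge> 1) \<and>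
          of_nat (length rs) = 1 - 2 * c i j / c i i}
     \<union> {serre_sym (f i) (f j s) rs | i j s rs. i \<noteq> j \<and> s \<ge> 1 \<and> (\<forall>r\<in>set rs. r \<ge> 1) \<and>
          of_nat (length rs) = 1 - 2 * c i j / c i i})"

text \<open>The values of the families \<open>e\<close>, \<open>f\<close>, \<open>h\<close> at upper index \<open>0\<close> are irrelevant.\<close>
definition is_new_yangian ::
  "('i \<Rightarrow> 'i \<Rightarrow> complex) \<Rightarrow> ('i \<Rightarrow> nat \<Rightarrow> 'n::complex_alg) \<Rightarrow> ('i \<Rightarrow> nat \<Rightarrow> 'n) \<Rightarrow> ('i \<Rightarrow> nat \<Rightarrow> 'n) \<Rightarrow> bool"
  where
  "is_new_yangian c e f h \<longleftrightarrow>
     presents (case_newgen (\<lambda>i k. e i (k + 1)) (\<lambda>i k. f i (k + 1)) (\<lambda>i k. h i (k + 1)))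
       (new_yangian_rels c)"

definition is_identification ::
  "('g::complex_lie \<Rightarrow> 'g \<Rightarrow> complex) \<Rightarrow> 'g set \<Rightarrow> ('i::finite \<Rightarrow> 'g) \<Rightarrow> ('g \<Rightarrow> 'g) \<Rightarrow> ('g \<Rightarrow> 'g) \<Rightarrow>
     ('g \<Rightarrow> 'y::complex_alg) \<Rightarrow> ('g \<Rightarrow> 'y) \<Rightarrow>
     ('i \<Rightarrow> nat \<Rightarrow> 'n::complex_alg) \<Rightarrow> ('i \<Rightarrow> nat \<Rightarrow> 'n) \<Rightarrow> ('i \<Rightarrow> nat \<Rightarrow> 'n) \<Rightarrow> ('n \<Rightarrow> 'y) \<Rightarrow> bool" where
  "is_identification form H \<alpha> xp xm inc J e f h \<phi> \<longleftrightarrow>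
     calg_hom \<phi> \<and> bij \<phi> \<and>
     (\<forall>i. \<phi> (h i 1) = inc (\<alpha> i)) \<and>
     (\<forall>i. \<phi> (e i 1) = inc (xp (\<alpha> i))) \<and>
     (\<forall>i. \<phi> (f i 1) = inc (xm (\<alpha> i))) \<and>
     (\<forall>i. \<phi> (h i 2) =
        J (\<alpha> i)
        - (1/4) *\<^sub>C (\<Sum>\<beta>\<in>pos_roots form H \<alpha>. form \<beta> (\<alpha> i) *\<^sub>C
             (inc (xp \<beta>) * inc (xm \<beta>) + inc (xm \<beta>) * inc (xp \<beta>)))
        + (1/2) *\<^sub>C (inc (\<alpha> i))\<^sup>2)"


section \<open>Fundamental representations\<close>

definition is_matrix_rep :: "('y::complex_alg \<Rightarrow> complex ^ 'm ^ 'm::finite) \<Rightarrow> bool" where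
  "is_matrix_rep \<rho> \<longleftrightarrow> clinear \<rho> \<and> \<rho> 1 = mat 1 \<and> (\<forall>x y. \<rho> (x * y) = \<rho> x ** \<rho> y)"

definition fund_poly :: "'i \<Rightarrow> complex \<Rightarrow> 'i \<Rightarrow> complex poly" where
  "fund_poly i a j = (if j = i then [:- a, 1:] else 1)"

text \<open>The expansion of \<open>P(u + d) / P(u)\<close> at \<open>u = \<infinity>\<close>.\<close>
definition hw_series :: "complex \<Rightarrow> complex poly \<Rightarrow> complex fls" where
  "hw_series d P =
     poly (map_poly fls_const P) (fls_X_inv + fls_const d) / poly (map_poly fls_const P) fls_X_inv"

text \<open>The invariant subspace \<open>W\<close> is a module \<open>V(\<omega>\<^sub>i, a)\<close>; \<open>e\<close> and \<open>h\<close> are the new generators, and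
  \<open>d j = (\<alpha>\<^sub>j, \<alpha>\<^sub>j) / 2\<close>.\<close>
definition is_fundamental ::
  "('y::complex_alg \<Rightarrow> complex ^ 'm ^ 'm::finite) \<Rightarrow> ('i \<Rightarrow> nat \<Rightarrow> 'y) \<Rightarrow> ('i \<Rightarrow> nat \<Rightarrow> 'y) \<Rightarrow>
     ('i \<Rightarrow> complex) \<Rightarrow> 'i \<Rightarrow> complex \<Rightarrow> (complex ^ 'm) set \<Rightarrow> bool" where
  "is_fundamental \<rho> e h d i a W \<longleftrightarrow>
     cv.subspace W \<and> (\<forall>y. \<forall>v\<in>W. \<rho> y *v v \<in> W) \<and>
     W \<noteq> {0} \<and>
     (\<forall>U. cv.subspace U \<and> U \<subseteq> W \<and> (\<forall>y. \<forall>v\<in>U. \<rho> y *v v \<in> U) \<longrightarrow> U = {0} \<or> U = W) \<and>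
     (\<exists>v\<in>W. {\<rho> y *v v | y. True} = W \<and>
        (\<forall>j. \<forall>r\<ge>1. \<rho> (e j r) *v v = 0) \<and>
        (\<forall>j. \<forall>r\<ge>1. \<rho> (h j r) *v v = fls_nth (hw_series (d j) (fund_poly i a j)) (int r) *\<^sub>C v))"

text \<open>The direct sum of the fundamental modules is written in a basis indexed by \<open>'m\<close> that is adapted
  to the decomposition; \<open>blk a\<close> is the index of the summand containing the basis vector \<open>a\<close>.\<close>
definition blk_space :: "('m::finite \<Rightarrow> 'i) \<Rightarrow> 'i \<Rightarrow> (complex ^ 'm) set" where
  "blk_space blk i = {v. \<forall>a. v $ a \<noteq> 0 \<longrightarrow> blk a = i}"

definition is_sum_of_fundamentals ::
  "('y::complex_alg \<Rightarrow> complex ^ 'm ^ 'm::finite) \<Rightarrow> ('i \<Rightarrow> nat \<Rightarrow> 'y) \<Rightarrow> ('i \<Rightarrow> nat \<Rightarrow> 'y) \<Rightarrow>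
     ('i \<Rightarrow> complex) \<Rightarrow> ('m \<Rightarrow> 'i) \<Rightarrow> bool" where
  "is_sum_of_fundamentals \<rho> e h d blk \<longleftrightarrow>
     is_matrix_rep \<rho> \<and> (\<forall>i. is_fundamental \<rho> e h d i 0 (blk_space blk i))"


section \<open>The RTT-realization\<close>

text \<open>The coefficient of \<open>u\<^sup>-\<^sup>k\<close> in the matrix \<open>R(u)\<close>, obtained from the universal R-matrix at \<open>-u\<close>; rows
  and columns are indexed by pairs.\<close>
definition R_coeff ::
  "('y::complex_alg \<Rightarrow> complex ^ 'm ^ 'm::finite) \<Rightarrow> ('y, 'y) tensor fps \<Rightarrow>
     nat \<Rightarrow> 'm \<times> 'm \<Rightarrow> 'm \<times> 'm \<Rightarrow> complex" where
  "R_coeff \<rho> Rhat k p q =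
     (-1) ^ k * tensor_lift (\<lambda>x y. \<rho> x $ fst p $ fst q * \<rho> y $ snd p $ snd q) (fps_nth Rhat k)"

text \<open>The generator \<open>(k, a, b)\<close> stands for \<open>t\<^sub>a\<^sub>b\<close> with upper index \<open>k + 1\<close>.\<close>
definition t_gen :: "nat \<Rightarrow> 'm \<Rightarrow> 'm \<Rightarrow> (nat \<times> 'm \<times> 'm) falg" where
  "t_gen r a b = (case r of 0 \<Rightarrow> (if a = b then 1 else 0) | Suc k \<Rightarrow> var (k, a, b))"

text \<open>\<open>(u - v)\<^sup>-\<^sup>k = \<Sum>\<^sub>m inv_diff_coeff k m v\<^sup>m u\<^sup>-\<^sup>k\<^sup>-\<^sup>m\<close>.\<close>
definition inv_diff_coeff :: "nat \<Rightarrow> nat \<Rightarrow> complex" where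
  "inv_diff_coeff k m = (-1) ^ m * ((- of_nat k) gchoose m)"

text \<open>The coefficient of \<open>u\<^sup>-\<^sup>p v\<^sup>-\<^sup>q\<close> in the entry \<open>((a,b),(c,d))\<close> of
  \<open>R(u-v) T\<^sub>1(u) T\<^sub>2(v) - T\<^sub>2(v) T\<^sub>1(u) R(u-v)\<close>, where \<open>R(u-v)\<close> is expanded in the domain of series in \<open>u\<inverse>\<close>
  whose coefficients are Laurent series in \<open>v\<inverse>\<close>; each coefficient is a finite sum.\<close>
definition rtt_rel ::
  "(nat \<Rightarrow> 'm \<times> 'm \<Rightarrow> 'm \<times> 'm \<Rightarrow> complex) \<Rightarrow> 'm::finite \<Rightarrow> 'm \<Rightarrow> 'm \<Rightarrow> 'm \<Rightarrow> nat \<Rightarrow> int \<Rightarrow>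
     (nat \<times> 'm \<times> 'm) falg" where
  "rtt_rel R a b c d p q =
     (\<Sum>(k, m) \<in> {(k, m). k + m \<le> p \<and> 0 \<le> q + int m}. inv_diff_coeff k m *\<^sub>C
        (\<Sum>a'\<in>UNIV. \<Sum>b'\<in>UNIV.
             R k (a, b) (a', b') *\<^sub>C (t_gen (p - k - m) a' c * t_gen (nat (q + int m)) b' d)
           - R k (a', b') (c, d) *\<^sub>C (t_gen (nat (q + int m)) b b' * t_gen (p - k - m) a a')))"

text \<open>The coefficients of the series \<open>T(u)\<inverse>\<close>.\<close>
fun t_inv :: "nat \<Rightarrow> 'm::finite \<Rightarrow> 'm \<Rightarrow> (nat \<times> 'm \<times> 'm) falg" where
  "t_inv r a b =
     (if r = 0 then (if a = b then 1 else 0)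
      else - (\<Sum>s\<in>{1..r}. \<Sum>c\<in>UNIV. t_gen s a c * t_inv (r - s) c b))"

declare t_inv.simps [simp del]

text \<open>The antipode: the anti-homomorphism with \<open>T(u) \<mapsto> T(u)\<inverse>\<close>.\<close>
definition antipode :: "(nat \<times> 'm::finite \<times> 'm) falg \<Rightarrow> (nat \<times> 'm \<times> 'm) falg" where
  "antipode = feval_anti (\<lambda>(k, a, b). t_inv (k + 1) a b)"

text \<open>The coefficient of \<open>u\<^sup>-\<^sup>r\<close> in \<open>t\<^sub>a\<^sub>b(u + s)\<close>.\<close>
definition t_shift :: "complex \<Rightarrow> nat \<Rightarrow> 'm \<Rightarrow> 'm \<Rightarrow> (nat \<times> 'm \<times> 'm) falg" where
  "t_shift s r a b = (\<Sum>k\<le>r. (((- of_nat k) gchoose (r - k)) * s ^ (r - k)) *\<^sub>C t_gen k a b)"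

definition is_RTT_yangian ::
  "(nat \<Rightarrow> 'm::finite \<times> 'm \<Rightarrow> 'm \<times> 'm \<Rightarrow> complex) \<Rightarrow> complex \<Rightarrow>
     (nat \<Rightarrow> 'm \<Rightarrow> 'm \<Rightarrow> 'v::complex_alg) \<Rightarrow> bool" where
  "is_RTT_yangian R cg t \<longleftrightarrow>
     (\<forall>a b. t 0 a b = (if a = b then 1 else 0)) \<and>
     presents (\<lambda>(k, a, b). t (k + 1) a b)
       ({rtt_rel R a b c d p q | a b c d p q. True}
        \<union> {antipode (antipode (t_gen r a b)) - t_shift (cg / 2) r a b | r a b. True})"

definition YV_filt :: "(nat \<Rightarrow> 'm \<Rightarrow> 'm \<Rightarrow> 'v::complex_alg) \<Rightarrow> nat \<Rightarrow> 'v set" where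
  "YV_filt t r =
     cv.span {prod_list (map (\<lambda>(s, a, b). t s a b) ws) | ws.
       (\<forall>w\<in>set ws. fst w \<ge> 1) \<and> sum_list (map fst ws) \<le> r}"


section \<open>The groups\<close>

definition GL :: "(complex ^ 'k ^ 'k::finite) monoid" where
  "GL = \<lparr>carrier = {A. invertible A}, mult = (**), one = mat 1\<rparr>"

definition mexp :: "complex ^ 'k ^ 'k \<Rightarrow> complex ^ 'k ^ 'k::finite" where
  "mexp A = suminf (\<lambda>k. (1 / fact k) *\<^sub>R ((\<lambda>B. A ** B) ^^ k) (mat 1))"

text \<open>The connected Lie subgroup of \<open>GL\<close> with Lie algebra \<open>range \<iota>\<close>.\<close>
definition lin_group :: "('g::complex_lie \<Rightarrow> complex ^ 'k ^ 'k::finite) \<Rightarrow> (complex ^ 'k ^ 'k) monoid" where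
  "lin_group \<iota> = GL\<lparr>carrier := generate GL (range (\<lambda>x. mexp (\<iota> x)))\<rparr>"

text \<open>The connected simply connected group is realized as a linear group, by means of any faithful
  representation \<open>\<iota>\<close> of the Lie algebra that makes \<open>lin_group \<iota>\<close> simply connected.\<close>
definition is_simply_connected_realization ::
  "('g::complex_lie \<Rightarrow> complex ^ 'k ^ 'k::finite) \<Rightarrow> bool" where
  "is_simply_connected_realization \<iota> \<longleftrightarrow>
     clinear \<iota> \<and> inj \<iota> \<and> (\<forall>x y. \<iota> (lie x y) = \<iota> x ** \<iota> y - \<iota> y ** \<iota> x) \<and>
     simply_connected (carrier (lin_group \<iota>))"

text \<open>\<open>\<rho>G\<close> is the representation of the group whose differential is \<open>\<rho> \<circ> inc\<close>.\<close>
definition integrates ::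
  "('g::complex_lie \<Rightarrow> complex ^ 'k ^ 'k::finite) \<Rightarrow> ('g \<Rightarrow> complex ^ 'm ^ 'm::finite) \<Rightarrow>
     (complex ^ 'k ^ 'k \<Rightarrow> complex ^ 'm ^ 'm) \<Rightarrow> bool" where
  "integrates \<iota> \<sigma> \<rho>G \<longleftrightarrow>
     \<rho>G \<in> hom (lin_group \<iota>) GL \<and> (\<forall>x. \<rho>G (mexp (\<iota> x)) = mexp (\<sigma> x))"

definition group_center :: "('a, 'b) monoid_scheme \<Rightarrow> 'a set" where
  "group_center G = {z \<in> carrier G. \<forall>x\<in>carrier G. z \<otimes>\<^bsub>G\<^esub> x = x \<otimes>\<^bsub>G\<^esub> z}"

definition adjoint_group ::
  "('g::complex_lie \<Rightarrow> complex ^ 'k ^ 'k::finite) \<Rightarrow> (complex ^ 'k ^ 'k) set monoid" where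
  "adjoint_group \<iota> = lin_group \<iota> Mod group_center (lin_group \<iota>)"

definition adjoint_class ::
  "('g::complex_lie \<Rightarrow> complex ^ 'k ^ 'k::finite) \<Rightarrow> complex ^ 'k ^ 'k \<Rightarrow> (complex ^ 'k ^ 'k) set" where
  "adjoint_class \<iota> C = group_center (lin_group \<iota>) #>\<^bsub>lin_group \<iota>\<^esub> C"

text \<open>The Lie algebra of a closed subgroup \<open>S\<close> of the adjoint group, as a subset of \<open>'g\<close>.\<close>
definition subgroup_lie_algebra ::
  "('g::complex_lie \<Rightarrow> complex ^ 'k ^ 'k::finite) \<Rightarrow> (complex ^ 'k ^ 'k) set set \<Rightarrow> 'g set" where
  "subgroup_lie_algebra \<iota> S = {x. \<forall>s :: real. adjoint_class \<iota> (mexp (\<iota> (complex_of_real s *\<^sub>C x))) \<in> S}"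

definition regular_elements ::
  "('g::complex_lie \<Rightarrow> complex ^ 'k ^ 'k::finite) \<Rightarrow> nat \<Rightarrow> (complex ^ 'k ^ 'k) set set" where
  "regular_elements \<iota> n =
     {c \<in> carrier (adjoint_group \<iota>).
        cv.dim (subgroup_lie_algebra \<iota>
          {x \<in> carrier (adjoint_group \<iota>). x \<otimes>\<^bsub>adjoint_group \<iota>\<^esub> c = c \<otimes>\<^bsub>adjoint_group \<iota>\<^esub> x}) = n}"

text \<open>The objects attached below to a regular element of the adjoint group are defined through its
  representatives in the simply connected group and do not depend on the representative.\<close>
definition regular_lifts ::
  "('g::complex_lie \<Rightarrow> complex ^ 'k ^ 'k::finite) \<Rightarrow> nat \<Rightarrow> (complex ^ 'k ^ 'k) set" where
  "regular_lifts \<iota> n = {C \<in> carrier (lin_group \<iota>). adjoint_class \<iota> C \<in> regular_elements \<iota> n}"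


section \<open>Bethe subalgebras\<close>

text \<open>The coefficient of \<open>u\<^sup>-\<^sup>r\<close> in the trace over the \<open>i\<close>-th summand of \<open>M T\<^sup>i(u)\<close>; only the \<open>i\<close>-th
  diagonal block of \<open>M\<close> matters.\<close>
definition bethe_tau ::
  "(nat \<Rightarrow> 'm \<Rightarrow> 'm \<Rightarrow> 'v::complex_alg) \<Rightarrow> ('m::finite \<Rightarrow> 'i) \<Rightarrow> 'i \<Rightarrow> complex ^ 'm ^ 'm \<Rightarrow> nat \<Rightarrow> 'v" where
  "bethe_tau t blk i M r = (\<Sum>a | blk a = i. \<Sum>b | blk b = i. M $ a $ b *\<^sub>C t r b a)"

definition bethe ::
  "(nat \<Rightarrow> 'm \<Rightarrow> 'm \<Rightarrow> 'v::complex_alg) \<Rightarrow> ('m::finite \<Rightarrow> 'i) \<Rightarrow> ('c \<Rightarrow> complex ^ 'm ^ 'm) \<Rightarrow> 'c \<Rightarrow> 'v set"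
  where "bethe t blk \<rho>G C = subalg {bethe_tau t blk i (\<rho>G C) r | i r. True}"

definition bethe_component ::
  "(nat \<Rightarrow> 'm \<Rightarrow> 'm \<Rightarrow> 'v::complex_alg) \<Rightarrow> ('m::finite \<Rightarrow> 'i) \<Rightarrow> ('c \<Rightarrow> complex ^ 'm ^ 'm) \<Rightarrow>
     nat \<Rightarrow> 'c \<Rightarrow> 'v set" where
  "bethe_component t blk \<rho>G r C = YV_filt t r \<inter> bethe t blk \<rho>G C"

text \<open>The common dimension of the components for the elements of \<open>Reg\<close>.\<close>
definition bethe_dim ::
  "(nat \<Rightarrow> 'm \<Rightarrow> 'm \<Rightarrow> 'v::complex_alg) \<Rightarrow> ('m::finite \<Rightarrow> 'i) \<Rightarrow> ('c \<Rightarrow> complex ^ 'm ^ 'm) \<Rightarrow>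
     'c set \<Rightarrow> nat \<Rightarrow> nat" where
  "bethe_dim t blk \<rho>G Reg r = (THE n. \<forall>C\<in>Reg. cv.dim (bethe_component t blk \<rho>G r C) = n)"


section \<open>Zariski topologies\<close>

text \<open>A point of a product of projective varieties is given by homogeneous coordinates, a function on
  a set \<open>'k\<close> of coordinate indices; \<open>fac k\<close> is the factor to which the coordinate \<open>k\<close> belongs.
  \<open>multihom fac D F\<close> says that \<open>F\<close> is a polynomial in finitely many coordinates which is homogeneous
  of degree \<open>D l\<close> in the coordinates of each factor \<open>l\<close>.\<close>
inductive multihom :: "('k \<Rightarrow> 'l) \<Rightarrow> ('l \<Rightarrow> nat) \<Rightarrow> (('k \<Rightarrow> complex) \<Rightarrow> complex) \<Rightarrow> bool" for fac where
  multihom_const: "multihom fac (\<lambda>_. 0) (\<lambda>_. c)"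
| multihom_coord: "multihom fac (\<lambda>l. if l = fac k then 1 else 0) (\<lambda>x. x k)"
| multihom_add: "multihom fac D F \<Longrightarrow> multihom fac D G \<Longrightarrow> multihom fac D (\<lambda>x. F x + G x)"
| multihom_mult: "multihom fac D F \<Longrightarrow> multihom fac E G \<Longrightarrow> multihom fac (\<lambda>l. D l + E l) (\<lambda>x. F x * G x)"

text \<open>\<open>A\<close> is the set of points and \<open>crd P\<close> the set of all homogeneous coordinates of \<open>P\<close>. The topology
  is generated by the complements of the hypersurfaces. For an infinite product this is the inverse
  limit of the Zariski topologies on the finite subproducts, since a polynomial involves finitely many
  coordinates only.\<close>
definition zariski_topology ::
  "('k \<Rightarrow> 'l) \<Rightarrow> 'p set \<Rightarrow> ('p \<Rightarrow> ('k \<Rightarrow> complex) set) \<Rightarrow> 'p topology" where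
  "zariski_topology fac A crd =
     topology_generated_by {{P \<in> A. \<forall>x\<in>crd P. F x \<noteq> 0} | F D. multihom fac D F}"

definition grassmannian :: "nat \<Rightarrow> 'a::complex_vec set \<Rightarrow> 'a set set" where
  "grassmannian d W = {U. cv.subspace U \<and> U \<subseteq> W \<and> cv.dim U = d}"

definition proj_space :: "'a::complex_vec set \<Rightarrow> 'a set set" where
  "proj_space W = {{c *\<^sub>C w | c. True} | w. w \<in> W \<and> w \<noteq> 0}"

definition is_basis_list :: "'a::complex_vec list \<Rightarrow> 'a set \<Rightarrow> bool" where
  "is_basis_list bs U \<longleftrightarrow> distinct bs \<and> cv.independent (set bs) \<and> cv.span (set bs) = U"

text \<open>The determinant of the matrix \<open>(l\<^sub>a(b\<^sub>c))\<close>, the value of the functional \<open>l\<^sub>0 \<and> \<dots> \<and> l\<^sub>d\<^sub>-\<^sub>1\<close> on the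
  exterior product of the basis \<open>b\<close>.\<close>
definition minor :: "'a list \<Rightarrow> (nat \<Rightarrow> 'a \<Rightarrow> complex) \<Rightarrow> complex" where
  "minor bs l =
     (\<Sum>\<pi> | \<pi> permutes {..<length bs}. of_int (sign \<pi>) * (\<Prod>a<length bs. l a (bs ! \<pi> a)))"

text \<open>Pluecker coordinates of a family of subspaces indexed by \<open>I\<close>. In place of fixing a basis of the
  ambient space, there is one coordinate for each sequence of linear functionals; the coordinates for
  indices outside \<open>I\<close> or for nonlinear functions are void.\<close>
definition plucker_coords ::
  "nat set \<Rightarrow> (nat \<Rightarrow> 'v::complex_vec set) \<Rightarrow> (nat \<times> (nat \<Rightarrow> 'v \<Rightarrow> complex) \<Rightarrow> complex) set" where
  "plucker_coords I z =
     {\<lambda>(r, l). if r \<in> I \<and> (\<forall>a. clinear (l a)) then minor (bs r) l else 0 | bs.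
        \<forall>r\<in>I. is_basis_list (bs r) (z r)}"

definition matrix_coords ::
  "('i \<Rightarrow> (complex ^ 'm ^ 'm::finite) set) \<Rightarrow> ('i \<times> 'm \<times> 'm \<Rightarrow> complex) set" where
  "matrix_coords X = {\<lambda>(i, a, b). M i $ a $ b | M. \<forall>i. M i \<in> X i \<and> M i \<noteq> 0}"


section \<open>Limit subalgebras and the wonderful compactification\<close>

definition theta ::
  "(nat \<Rightarrow> 'm \<Rightarrow> 'm \<Rightarrow> 'v::complex_alg) \<Rightarrow> ('m::finite \<Rightarrow> 'i) \<Rightarrow> ('c \<Rightarrow> complex ^ 'm ^ 'm) \<Rightarrow>
     nat set \<Rightarrow> 'c \<Rightarrow> nat \<Rightarrow> 'v set" where
  "theta t blk \<rho>G I C = (\<lambda>r\<in>I. bethe_component t blk \<rho>G r C)"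

definition gr_product ::
  "(nat \<Rightarrow> 'm \<Rightarrow> 'm \<Rightarrow> 'v::complex_alg) \<Rightarrow> ('m::finite \<Rightarrow> 'i) \<Rightarrow> ('c \<Rightarrow> complex ^ 'm ^ 'm) \<Rightarrow>
     'c set \<Rightarrow> nat set \<Rightarrow> (nat \<Rightarrow> 'v set) set" where
  "gr_product t blk \<rho>G Reg I = (\<Pi>\<^sub>E r\<in>I. grassmannian (bethe_dim t blk \<rho>G Reg r) (YV_filt t r))"

definition Z_level ::
  "(nat \<Rightarrow> 'm \<Rightarrow> 'm \<Rightarrow> 'v::complex_alg) \<Rightarrow> ('m::finite \<Rightarrow> 'i) \<Rightarrow> ('c \<Rightarrow> complex ^ 'm ^ 'm) \<Rightarrow>
     'c set \<Rightarrow> nat \<Rightarrow> (nat \<Rightarrow> 'v set) set" where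
  "Z_level t blk \<rho>G Reg r =
     zariski_topology fst (gr_product t blk \<rho>G Reg {1..r}) (plucker_coords {1..r})
       closure_of (theta t blk \<rho>G {1..r} ` Reg)"

definition Z_limit ::
  "(nat \<Rightarrow> 'm \<Rightarrow> 'm \<Rightarrow> 'v::complex_alg) \<Rightarrow> ('m::finite \<Rightarrow> 'i) \<Rightarrow> ('c \<Rightarrow> complex ^ 'm ^ 'm) \<Rightarrow>
     'c set \<Rightarrow> (nat \<Rightarrow> 'v set) set" where
  "Z_limit t blk \<rho>G Reg =
     {z \<in> extensional {1..}. \<forall>r\<ge>1. restrict z {1..r} \<in> Z_level t blk \<rho>G Reg r}"

definition limit_subalgebra :: "(nat \<Rightarrow> 'v set) \<Rightarrow> 'v set" where
  "limit_subalgebra z = (\<Union>r\<in>{1..}. z r)"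

definition blk_End :: "('m \<Rightarrow> 'i) \<Rightarrow> 'i \<Rightarrow> (complex ^ 'm ^ 'm::finite) set" where
  "blk_End blk i = {M. \<forall>a b. M $ a $ b \<noteq> 0 \<longrightarrow> blk a = i \<and> blk b = i}"

definition blk_part :: "('m \<Rightarrow> 'i) \<Rightarrow> 'i \<Rightarrow> complex ^ 'm ^ 'm \<Rightarrow> complex ^ 'm ^ 'm::finite" where
  "blk_part blk i M = (\<chi> a b. if blk a = i \<and> blk b = i then M $ a $ b else 0)"

text \<open>The image of a group element in the product of the projective spaces of the \<open>End V(\<omega>\<^sub>i, 0)\<close>.\<close>
definition proj_point ::
  "('m \<Rightarrow> 'i) \<Rightarrow> ('c \<Rightarrow> complex ^ 'm ^ 'm::finite) \<Rightarrow> 'c \<Rightarrow> 'i \<Rightarrow> (complex ^ 'm ^ 'm) set" where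
  "proj_point blk \<rho>G C i = {c *\<^sub>C blk_part blk i (\<rho>G C) | c. True}"

definition wonderful_compactification ::
  "('m \<Rightarrow> 'i) \<Rightarrow> ('c \<Rightarrow> complex ^ 'm ^ 'm::finite) \<Rightarrow> 'c set \<Rightarrow> ('i \<Rightarrow> (complex ^ 'm ^ 'm) set) set" where
  "wonderful_compactification blk \<rho>G G =
     zariski_topology fst {X. \<forall>i. X i \<in> proj_space (blk_End blk i)} matrix_coords
       closure_of (proj_point blk \<rho>G ` G)"

definition bethe_bar ::
  "(nat \<Rightarrow> 'm \<Rightarrow> 'm \<Rightarrow> 'v::complex_alg) \<Rightarrow> ('m::finite \<Rightarrow> 'i) \<Rightarrow>
     ('i \<Rightarrow> (complex ^ 'm ^ 'm) set) \<Rightarrow> 'v set" where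
  "bethe_bar t blk X = subalg {bethe_tau t blk i M r | i r M. M \<in> X i \<and> M \<noteq> 0}"

definition Z_tilde ::
  "(nat \<Rightarrow> 'm \<Rightarrow> 'm \<Rightarrow> 'v::complex_alg) \<Rightarrow> ('m::finite \<Rightarrow> 'i) \<Rightarrow> ('c \<Rightarrow> complex ^ 'm ^ 'm) \<Rightarrow>
     'c set \<Rightarrow> 'c set \<Rightarrow> ((nat \<Rightarrow> 'v set) \<times> ('i \<Rightarrow> (complex ^ 'm ^ 'm) set)) set" where
  "Z_tilde t blk \<rho>G G Reg =
     zariski_topology (map_sum fst fst) (Z_limit t blk \<rho>G Reg \<times> wonderful_compactification blk \<rho>G G)
       (\<lambda>(z, X). {case_sum x y | x y. x \<in> plucker_coords {1..} z \<and> y \<in> matrix_coords X})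
       closure_of ((\<lambda>C. (theta t blk \<rho>G {1..} C, proj_point blk \<rho>G C)) ` Reg)"

end

theory Submission
  imports Defs "Jordan_Normal_Form.Determinant"
begin

text \<open>Both assertions are closed conditions. If \<open>v\<close> is a vector depending multihomogeneously on the
  coordinates of a point of \<open>Z \<times> G\<close>-bar, then Cramer's rule turns \<open>v \<in> B\<^sup>(\<^sup>r\<^sup>)(z)\<close> into equations in the Pluecker
  coordinates; so the inclusions \<open>B\<^sup>(\<^sup>r\<^sup>) B\<^sup>(\<^sup>s\<^sup>) \<subseteq> B\<^sup>(\<^sup>r\<^sup>+\<^sup>s\<^sup>)\<close>, which say that \<open>B(z)\<close> is a subalgebra, and the membership of
  the coefficients of \<open>\<tau>\<^sub>i(u, X)\<close> pass from the regular elements to their closure. Similarly the vanishing of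
  \<open>[\<tau>\<^sub>i(u, X), \<tau>\<^sub>j(v, X)]\<close> is a bilinear equation in \<open>X\<^sub>i\<close>, \<open>X\<^sub>j\<close>, so it suffices to verify it on \<open>G\<close>. There the
  R-matrix commutes with \<open>\<rho>(C) \<otimes> \<rho>(C)\<close>, because \<open>\<Delta>(x) = x \<otimes> 1 + 1 \<otimes> x\<close> is cocommutative and fixed by the shift, and
  taking traces in the RTT relation, multiplied by \<open>R(u - v)\<inverse>\<close>, gives the commutativity.\<close>

text \<open>A point of the limit space is a sequence of subspaces with no preferred vectors, so
  products in B(z) cannot be compared directly with products at regular points. The remedy is to
  realise each basis vector of \<open>z r\<close>, up to a nonzero scalar, as the value at (z, X) of
  a function multihomogeneous in the Pluecker coordinates whose values at regular C lie in the
  component of B(C): the interior product of the Pluecker vector with all but one of the functionals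
  dual to the basis. Such functions can be multiplied, and coordinates are determined only up to one
  nonzero scalar for each factor, so nothing finer than a value up to scalars is available.

  Commutativity is claimed for every X in the compactification. Reading it off from B(X) \<subseteq>
  B(z) would take commutativity of B(z) and surjectivity of the projection to the compactification,
  hence the direct argument. It has to treat two different fundamental modules at once; for this the
  block structure of R is combined with its commutation with \<rho>(C) \<otimes> \<rho>(C).\<close>

hide_const (open) Matrix.mat Determinant.det Matrix.row
no_notation Matrix.vec_index (infixl "$" 100)
no_notation fps_nth (infixl "$" 75)

section \<open>Linear functionals and minors\<close>

definition minor_mat :: "'a list \<Rightarrow> (nat \<Rightarrow> 'a \<Rightarrow> complex) \<Rightarrow> complex mat" where
  "minor_mat bs l = Matrix.mat (length bs) (length bs) (\<lambda>(a, c). l a (bs ! c))"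

lemma minor_mat_carrier [simp]: "minor_mat bs l \<in> carrier_mat (length bs) (length bs)"
  by (simp add: minor_mat_def)

text \<open>Passing from the Leibniz sum to \<open>Determinant.det\<close> makes cofactors,
  adjugates and multiplicativity available.\<close>

lemma minor_eq_det: "minor bs l = Determinant.det (minor_mat bs l)"
  unfolding minor_def minor_mat_def
  by (subst det_def'[of _ "length bs"]) (auto simp: atLeast0LessThan intro!: sum.cong prod.cong dest: permutes_in_image)

text \<open>Changing \<open>l i\<close> affects row i only, and the cofactors along row i do not see
  that row; hence Laplace expansion works with the cofactors of the old matrix and is linear in the
  new functional g.\<close>

lemma minor_upd_expand:
  assumes "i < length bs"
  shows "minor bs (l(i := g)) = (\<Sum>j<length bs. g (bs ! j) * cofactor (minor_mat bs l) i j)"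
proof -
  have "cofactor (minor_mat bs (l(i := g))) i j = cofactor (minor_mat bs l) i j" for j
    unfolding cofactor_def mat_delete_def minor_mat_def using assms
    by (intro arg_cong[of _ _ "\<lambda>A. _ * Determinant.det A"] eq_matI) auto
  then show ?thesis
    unfolding minor_eq_det
    by (subst laplace_expansion_row[OF minor_mat_carrier assms])
       (auto simp: minor_mat_def assms intro!: sum.cong)
qed

text \<open>The identity adj(A) A = det(A) 1 collapses the sum over j to the column c. No division
  occurs and the result is linear in the minors, which makes it an equation in Pluecker
  coordinates.\<close>

lemma minor_cramer:
  assumes "c < length bs"
  shows "g (bs ! c) * minor bs l = (\<Sum>i<length bs. l i (bs ! c) * minor bs (l(i := g)))"
proof -
  let ?n = "length bs" and ?A = "minor_mat bs l"
  have "(\<Sum>i<?n. l i (bs ! c) * cofactor ?A i j) = (if j = c then minor bs l else 0)" if "j < ?n" for j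
  proof -
    have "(adj_mat ?A * ?A) $$ (j, c) = (minor bs l \<cdot>\<^sub>m 1\<^sub>m ?n) $$ (j, c)"
      using adj_mat(3)[OF minor_mat_carrier[of bs l]] by (simp add: minor_eq_det)
    then show ?thesis
      using that assms
      by (simp add: adj_mat_def scalar_prod_def minor_mat_def atLeast0LessThan mult.commute)
  qed
  then have "g (bs ! c) * minor bs l =
      (\<Sum>j<?n. g (bs ! j) * (\<Sum>i<?n. l i (bs ! c) * cofactor ?A i j))"
    using assms by (simp add: if_distrib[of "\<lambda>x. _ * x"] cong: if_cong)
  also have "\<dots> = (\<Sum>i<?n. l i (bs ! c) * minor bs (l(i := g)))"
    unfolding sum_distrib_left
    by (subst sum.swap) (auto simp: minor_upd_expand sum_distrib_left algebra_simps intro!: sum.cong)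
  finally show ?thesis .
qed

lemma minor_upd_other:
  assumes "i < length bs" "j < length bs" "i \<noteq> j"
  shows "minor bs (l(i := l j)) = 0"
  unfolding minor_eq_det using assms
  by (intro det_identical_rows[OF minor_mat_carrier, of i j]) (auto simp: minor_mat_def)

section \<open>Linear functionals and bases of finite-dimensional subspaces\<close>

lemma clinear_add: "clinear f \<Longrightarrow> f (x + y) = f x + f y"
  and clinear_scale: "clinear f \<Longrightarrow> f (c *\<^sub>C x) = c *\<^sub>C f x"
  unfolding Vector_Spaces.linear_iff by auto

lemma clinearI: "(\<And>x y. f (x + y) = f x + f y) \<Longrightarrow> (\<And>c x. f (c *\<^sub>C x) = c *\<^sub>C f x) \<Longrightarrow> clinear f"
  by (simp add: Vector_Spaces.linear_iff cv.vector_space_axioms)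

lemma clinear_sum:
  assumes "clinear f" shows "f (\<Sum>i\<in>A. c i *\<^sub>C x i) = (\<Sum>i\<in>A. c i *\<^sub>C f (x i))"
proof -
  interpret Vector_Spaces.linear scaleC scaleC f by fact
  show ?thesis by (simp add: sum scale)
qed

lemma subspace_basis_list: "is_basis_list bs U \<Longrightarrow> cv.subspace U"
  unfolding is_basis_list_def using cv.subspace_span by blast

lemma basis_list_coords:
  assumes "is_basis_list bs U" "v \<in> U"
  obtains c where "v = (\<Sum>j<length bs. c j *\<^sub>C (bs ! j))"
proof -
  have "v \<in> cv.span (set bs)" using assms by (simp add: is_basis_list_def)
  then obtain u where u: "v = (\<Sum>b\<in>set bs. u b *\<^sub>C b)"
    by (auto simp: cv.span_finite)
  have "bij_betw ((!) bs) {..<length bs} (set bs)"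
    using assms by (auto simp: is_basis_list_def intro: bij_betw_nth)
  then have "v = (\<Sum>j<length bs. u (bs ! j) *\<^sub>C (bs ! j))"
    unfolding u by (intro sum.reindex_bij_betw[symmetric])
  then show ?thesis by (rule that)
qed

lemma dual_functionals:
  fixes U :: "'a::complex_vec set"
  assumes "is_basis_list bs U"
  shows "\<exists>l :: nat \<Rightarrow> 'a \<Rightarrow> complex. (\<forall>i. clinear (l i)) \<and>
    (\<forall>i<length bs. \<forall>j<length bs. l i (bs ! j) = (if i = j then 1 else 0))"
proof -
  interpret vp: vector_space_pair "scaleC :: complex \<Rightarrow> 'a \<Rightarrow> 'a" "scaleC :: complex \<Rightarrow> complex \<Rightarrow> complex" ..
  have "\<exists>f::'a \<Rightarrow> complex. clinear f \<and> (\<forall>x\<in>set bs. f x = (if x = bs ! i then 1 else 0))" for i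
    using vp.linear_independent_extend[of "set bs" "\<lambda>x. if x = bs ! i then 1 else 0"] assms
    by (auto simp: is_basis_list_def)
  then obtain l :: "nat \<Rightarrow> 'a \<Rightarrow> complex" where l: "\<And>i. clinear (l i)"
      "\<And>i x. x \<in> set bs \<Longrightarrow> l i x = (if x = bs ! i then 1 else 0)"
    by metis
  have "l i (bs ! j) = (if i = j then 1 else 0)" if "i < length bs" "j < length bs" for i j
    using that assms l(2)[of "bs ! j" i] by (auto simp: is_basis_list_def nth_eq_iff_index_eq)
  with l(1) show ?thesis by blast
qed

lemma separating_functional:
  fixes U :: "'a::complex_vec set"
  assumes "cv.subspace U" "v \<notin> U"
  shows "\<exists>g :: 'a \<Rightarrow> complex. clinear g \<and> (\<forall>u\<in>U. g u = 0) \<and> g v = 1"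
proof -
  interpret vp: vector_space_pair "scaleC :: complex \<Rightarrow> 'a \<Rightarrow> 'a" "scaleC :: complex \<Rightarrow> complex \<Rightarrow> complex" ..
  obtain B where B: "B \<subseteq> U" "cv.independent B" "U \<subseteq> cv.span B"
    using cv.basis_exists by metis
  have sB: "cv.span B = U" using B assms(1) by (simp add: cv.span_minimal subset_antisym)
  then have ind: "cv.independent (insert v B)"
    using B assms cv.independent_insert[of v B] by auto
  obtain f :: "'a \<Rightarrow> complex" where f: "clinear f" "\<forall>x\<in>insert v B. f x = (if x = v then 1 else 0)"
    using vp.linear_independent_extend[OF ind, of "\<lambda>x. if x = v then 1 else 0"] by blast
  interpret f: Vector_Spaces.linear scaleC scaleC f by fact
  have "f u = 0" if "u \<in> U" for u
    using that unfolding sB[symmetric]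
    by (rule f.eq_0_on_span[rotated]) (use f(2) B(1) assms(2) in auto)
  then show ?thesis using f by auto
qed

lemma basis_list_exists:
  assumes "cv.subspace U" "U \<subseteq> cv.span S" "finite S"
  obtains bs where "is_basis_list bs U"
proof -
  obtain B where B: "B \<subseteq> U" "cv.independent B" "U \<subseteq> cv.span B" "card B = cv.dim U"
    using cv.basis_exists by metis
  have sB: "cv.span B = U" using B assms(1) by (simp add: cv.span_minimal subset_antisym)
  have "finite B" using cv.independent_span_bound[of S B] assms B by auto
  then obtain bs where "set bs = B" "distinct bs" using finite_distinct_list by blast
  with B sB have "is_basis_list bs U" by (simp add: is_basis_list_def)
  then show ?thesis by (rule that)
qed

lemma length_basis_list: "is_basis_list bs U \<Longrightarrow> length bs = cv.dim U"
  unfolding is_basis_list_def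
  by (auto simp: cv.dim_eq_card_independent distinct_card)

lemma basis_list_nth: "is_basis_list bs U \<Longrightarrow> j < length bs \<Longrightarrow> bs ! j \<in> U"
  unfolding is_basis_list_def using cv.span_base[of "bs ! j" "set bs"] nth_mem by auto

text \<open>The matrices of \<open>l\<close> on \<open>bs'\<close> and of \<open>k\<close> on
  \<open>bs\<close> are the two transition matrices between these bases of U, hence inverse to each
  other. So functionals adapted to one fixed basis detect the Pluecker vector computed from any
  other.\<close>

lemma minor_dual_nonzero:
  fixes U :: "'a::complex_vec set"
  assumes bs: "is_basis_list bs U" and bs': "is_basis_list bs' U"
    and l: "\<forall>i. clinear (l i)"
      "\<forall>i<length bs. \<forall>j<length bs. l i (bs ! j) = (if i = j then 1 else 0)"
  shows "minor bs' l \<noteq> 0"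
proof -
  obtain k :: "nat \<Rightarrow> 'a \<Rightarrow> complex" where k: "\<forall>i. clinear (k i)"
    "\<forall>i<length bs'. \<forall>j<length bs'. k i (bs' ! j) = (if i = j then 1 else 0)"
    using dual_functionals[OF bs'] by blast
  have len: "length bs' = length bs" using bs bs' by (simp add: length_basis_list)
  have "minor_mat bs' l * minor_mat bs k = 1\<^sub>m (length bs)"
  proof (rule eq_matI)
    fix i j assume ij: "i < dim_row (1\<^sub>m (length bs))" "j < dim_col (1\<^sub>m (length bs))"
    then have jU: "bs ! j \<in> U" by (simp add: basis_list_nth[OF bs])
    obtain c where c: "bs ! j = (\<Sum>m<length bs'. c m *\<^sub>C (bs' ! m))"
      by (rule basis_list_coords[OF bs' jU])
    have apply_c: "f (bs ! j) = (\<Sum>m<length bs'. c m * f (bs' ! m))" if "clinear f" for f :: "'a \<Rightarrow> complex"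
      by (subst c, subst clinear_sum[OF that]) (simp add: scaleC_complex_def)
    have km: "k m (bs ! j) = c m" if "m < length bs'" for m
    proof -
      have "k m (bs ! j) = (\<Sum>m'<length bs'. c m' * (if m = m' then 1 else 0))"
        unfolding apply_c[OF k(1)[rule_format]] using that k(2) by (intro sum.cong) auto
      then show ?thesis using that by (simp add: if_distrib[of "\<lambda>x. _ * x"] cong: if_cong)
    qed
    have "(minor_mat bs' l * minor_mat bs k) $$ (i, j) = (\<Sum>m<length bs'. l i (bs' ! m) * k m (bs ! j))"
      using ij len by (simp add: minor_mat_def scalar_prod_def atLeast0LessThan)
    also have "\<dots> = l i (bs ! j)"
      unfolding apply_c[OF l(1)[rule_format]] by (intro sum.cong) (auto simp: km mult.commute)
    finally show "(minor_mat bs' l * minor_mat bs k) $$ (i, j) = 1\<^sub>m (length bs) $$ (i, j)"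
      using ij l(2) by simp
  qed (simp_all add: minor_mat_def len)
  then have "minor bs' l * minor bs k = 1"
    unfolding minor_eq_det by (metis det_mult det_one minor_mat_carrier len)
  then show ?thesis by auto
qed

section \<open>Zariski closure\<close>

lemma zariski_closure_subset: "zariski_topology fac A crd closure_of S \<subseteq> A"
proof (rule subset_trans[OF closure_of_subset_topspace])
  show "topspace (zariski_topology fac A crd) \<subseteq> A"
    unfolding zariski_topology_def topology_generated_by_topspace by blast
qed

text \<open>A basic open set requires F to be nonzero at all coordinate vectors of a point, so its
  complement asks for a single zero and F may be tested at any convenient representative. Basic open
  sets lie in A, so points of S outside A impose nothing.\<close>

lemma zariski_closure_zero:
  assumes P: "P \<in> zariski_topology fac A crd closure_of S" and F: "multihom fac D F"
    and S: "\<And>Q. Q \<in> S \<Longrightarrow> Q \<in> A \<Longrightarrow> \<exists>x\<in>crd Q. F x = 0"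
  shows "\<exists>x\<in>crd P. F x = 0"
proof (rule ccontr)
  let ?T = "zariski_topology fac A crd" and ?O = "{Q \<in> A. \<forall>x\<in>crd Q. F x \<noteq> 0}"
  assume no_zero: "\<not> (\<exists>x\<in>crd P. F x = 0)"
  have "openin ?T ?O"
    unfolding zariski_topology_def using F by (intro topology_generated_by_Basis) blast
  moreover have "P \<in> ?O" using subsetD[OF zariski_closure_subset P] no_zero by simp
  ultimately have "\<exists>Q. Q \<in> S \<and> Q \<in> ?O"
    using P[unfolded in_closure_of, THEN conjunct2, rule_format, of ?O] by simp
  then obtain Q where "Q \<in> S" "Q \<in> ?O" by blast
  then show False using S[of Q] by auto
qed

lemma multihom_cmult: "multihom fac D F \<Longrightarrow> multihom fac D (\<lambda>x. c * F x)"
  using multihom_mult[OF multihom_const[of fac c], of D F] by simp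

text \<open>The zero function of degree D is obtained as 0 times a function of degree D; G serves as
  that function when I is empty.\<close>

lemma multihom_sum:
  assumes "finite I" "multihom fac D G" "\<And>i. i \<in> I \<Longrightarrow> multihom fac D (F i)"
  shows "multihom fac D (\<lambda>x. \<Sum>i\<in>I. F i x)"
  using assms(1,3)
proof (induction I rule: finite_induct)
  case empty
  show ?case using multihom_cmult[OF assms(2), of 0] by simp
next
  case (insert i I)
  then show ?case by (simp add: multihom_add)
qed

lemma multihom_diff: "multihom fac D F \<Longrightarrow> multihom fac D G \<Longrightarrow> multihom fac D (\<lambda>x. F x - G x)"
  using multihom_add[OF _ multihom_cmult[of fac D G "-1"], of F] by simp

text \<open>These are the multihomogeneous polynomials with coefficients in \<open>'v\<close>.
  Linear functionals turn them into scalar equations, and multiplication in the algebra adds their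
  degrees.\<close>

inductive vec_multihom :: "('k \<Rightarrow> 'l) \<Rightarrow> ('l \<Rightarrow> nat) \<Rightarrow> (('k \<Rightarrow> complex) \<Rightarrow> 'v::complex_vec) \<Rightarrow> bool" for fac where
  vec_multihom_scale: "multihom fac D F \<Longrightarrow> vec_multihom fac D (\<lambda>x. F x *\<^sub>C v)"
| vec_multihom_add: "vec_multihom fac D V \<Longrightarrow> vec_multihom fac D W \<Longrightarrow> vec_multihom fac D (\<lambda>x. V x + W x)"

lemma vec_multihom_zero:
  assumes "multihom fac D F" shows "vec_multihom fac D (\<lambda>_. 0)"
  using vec_multihom_scale[OF assms, of 0] by simp

lemma vec_multihom_sum:
  assumes "finite I" "multihom fac D F" "\<And>i. i \<in> I \<Longrightarrow> vec_multihom fac D (V i)"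
  shows "vec_multihom fac D (\<lambda>x. \<Sum>i\<in>I. V i x)"
  using assms(1,3)
proof (induction I rule: finite_induct)
  case empty
  show ?case using vec_multihom_zero[OF assms(2)] by simp
next
  case (insert i I)
  then show ?case by (simp add: vec_multihom_add)
qed

lemma vec_multihom_functional:
  assumes "vec_multihom fac D V" "clinear g"
  shows "multihom fac D (\<lambda>x. g (V x))"
  using assms(1)
proof (induction rule: vec_multihom.induct)
  case (vec_multihom_scale D F v)
  show ?case
    using multihom_cmult[OF vec_multihom_scale, of "g v"]
    by (simp add: clinear_scale[OF assms(2)] scaleC_complex_def mult.commute)
next
  case (vec_multihom_add D V W)
  then show ?case by (simp add: clinear_add[OF assms(2)] multihom_add)
qed

lemma vec_multihom_mult:
  fixes V W :: "('k \<Rightarrow> complex) \<Rightarrow> 'v::complex_alg"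
  assumes "vec_multihom fac D V" "vec_multihom fac E W"
  shows "vec_multihom fac (\<lambda>l. D l + E l) (\<lambda>x. V x * W x)"
  using assms(1)
proof (induction rule: vec_multihom.induct)
  case (vec_multihom_scale D F v)
  show ?case using assms(2)
  proof (induction rule: vec_multihom.induct)
    case (vec_multihom_scale E G w)
    from multihom_mult[OF \<open>multihom fac D F\<close> this]
    have "vec_multihom fac (\<lambda>l. D l + E l) (\<lambda>x. (F x * G x) *\<^sub>C (v * w))"
      by (rule vec_multihom.vec_multihom_scale)
    then show ?case by (simp add: scaleC_mult_left scaleC_mult_right scaleC_scaleC mult.commute)
  next
    case (vec_multihom_add E V W)
    then show ?case by (simp add: distrib_left vec_multihom.vec_multihom_add)
  qed
next
  case (vec_multihom_add D V W)
  then show ?case by (simp add: distrib_right vec_multihom.vec_multihom_add)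
qed

definition pair_coords ::
  "(nat \<Rightarrow> 'v::complex_vec set) \<times> ('i \<Rightarrow> (complex ^ 'm ^ 'm::finite) set) \<Rightarrow>
     ((nat \<times> (nat \<Rightarrow> 'v \<Rightarrow> complex)) + ('i \<times> 'm \<times> 'm) \<Rightarrow> complex) set" where
  "pair_coords = (\<lambda>(z, X). {case_sum x y | x y. x \<in> plucker_coords {1..} z \<and> y \<in> matrix_coords X})"

lemma pair_coordsD:
  assumes "x \<in> pair_coords (z, X)"
  shows "\<exists>bs. \<forall>r\<ge>1. is_basis_list (bs r) (z r) \<and>
      (\<forall>l. (\<forall>a. clinear (l a)) \<longrightarrow> x (Inl (r, l)) = minor (bs r) l)"
    and "\<exists>M. \<forall>i. M i \<in> X i \<and> M i \<noteq> 0 \<and> (\<forall>a b. x (Inr (i, a, b)) = M i $ a $ b)"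
proof -
  obtain bs M where "x = case_sum (\<lambda>(r, l). if r \<in> {1..} \<and> (\<forall>a. clinear (l a)) then minor (bs r) l else 0)
      (\<lambda>(i, a, b). M i $ a $ b)"
    and "\<forall>r\<in>{1..}. is_basis_list (bs r) (z r)" "\<forall>i. M i \<in> X i \<and> M i \<noteq> 0"
    using assms unfolding pair_coords_def plucker_coords_def matrix_coords_def by blast
  then show "\<exists>bs. \<forall>r\<ge>1. is_basis_list (bs r) (z r) \<and>
      (\<forall>l. (\<forall>a. clinear (l a)) \<longrightarrow> x (Inl (r, l)) = minor (bs r) l)"
    and "\<exists>M. \<forall>i. M i \<in> X i \<and> M i \<noteq> 0 \<and> (\<forall>a b. x (Inr (i, a, b)) = M i $ a $ b)"
    by (intro exI[of _ bs] exI[of _ M]; simp)+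
qed

text \<open>A vector-valued coordinate function lying in \<open>z r\<close> on \<open>S\<close> lies in it on the closure: when \<open>v\<close>
  is outside \<open>z r\<close>, Cramer's rule for functionals dual to a basis of \<open>z r\<close> together with one that
  separates \<open>v\<close> from \<open>z r\<close> is a multihomogeneous equation violated there.\<close>
lemma closure_membership:
  fixes z :: "nat \<Rightarrow> 'v::complex_vec set"
  assumes cl: "(z, X) \<in> zariski_topology (map_sum fst fst) A pair_coords closure_of S"
    and V: "vec_multihom (map_sum fst fst) D V"
    and r: "r \<ge> 1" and dim: "\<And>z X. (z, X) \<in> A \<Longrightarrow> cv.dim (z r) = d"
    and U: "is_basis_list us (z r)"
    and S: "\<And>z X. (z, X) \<in> S \<Longrightarrow> (z, X) \<in> A \<Longrightarrow> \<exists>x\<in>pair_coords (z, X). V x \<in> z r"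
    and v: "\<And>x. x \<in> pair_coords (z, X) \<Longrightarrow> \<exists>c. c \<noteq> 0 \<and> V x = c *\<^sub>C v"
  shows "v \<in> z r"
proof (rule ccontr)
  assume "v \<notin> z r"
  have zA: "(z, X) \<in> A"
    by (rule subsetD[OF zariski_closure_subset cl])
  then have len: "length us = d" using length_basis_list[OF U] dim[OF zA] by simp
  have "cv.subspace (z r)" by (rule subspace_basis_list[OF U])
  then obtain g :: "'v \<Rightarrow> complex" where g: "clinear g" "\<forall>u\<in>z r. g u = 0" "g v = 1"
    using separating_functional[OF _ \<open>v \<notin> z r\<close>] by blast
  obtain l :: "nat \<Rightarrow> 'v \<Rightarrow> complex" where l: "\<forall>i. clinear (l i)"
      "\<forall>i<length us. \<forall>j<length us. l i (us ! j) = (if i = j then 1 else 0)"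
    using dual_functionals[OF U] by blast
  have lg: "\<forall>a. clinear ((l(i := g)) a)" for i using l g by auto
  \<comment> \<open>The defect of Cramer's rule for \<open>V x\<close>. Every term carries exactly
    one Pluecker coordinate of the factor r, whence the degree \<open>?E\<close>; the range i < d
    fits all points because the dimension of the r-th component is constant on A.\<close>
  define F where "F x = g (V x) * x (Inl (r, l)) - (\<Sum>i<d. l i (V x) * x (Inl (r, l(i := g))))" for x
  let ?E = "\<lambda>k. D k + (if k = Inl r then 1 else 0)"
  have summand: "multihom (map_sum fst fst) ?E (\<lambda>x. h (V x) * x (Inl (r, l')))" if "clinear h" for h l'
    using multihom_mult[OF vec_multihom_functional[OF V that] multihom_coord[of "map_sum fst fst" "Inl (r, l')"]]
    by simp
  have "multihom (map_sum fst fst) ?E F"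
    unfolding F_def
    by (rule multihom_diff[OF summand[OF g(1)]
          multihom_sum[OF finite_lessThan summand[OF g(1)] summand[OF l(1)[rule_format]]]])
  moreover have "\<exists>x\<in>pair_coords Q. F x = 0" if Q: "Q \<in> S" "Q \<in> A" for Q
  proof -
    obtain z' X' where Q': "Q = (z', X')" by (cases Q)
    obtain x where x: "x \<in> pair_coords (z', X')" "V x \<in> z' r" using S Q Q' by blast
    obtain bs where bs: "is_basis_list (bs r) (z' r)"
        and crd: "\<And>l. \<forall>a. clinear (l a) \<Longrightarrow> x (Inl (r, l)) = minor (bs r) l"
      using pair_coordsD(1)[OF x(1)] r by blast
    have n: "length (bs r) = d" using length_basis_list[OF bs] dim Q Q' by simp
    obtain c where c: "V x = (\<Sum>j<length (bs r). c j *\<^sub>C (bs r ! j))"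
      by (rule basis_list_coords[OF bs x(2)])
    note c = c[unfolded n]
    have app: "h (V x) = (\<Sum>j<d. c j * h (bs r ! j))" if "clinear h" for h :: "'v \<Rightarrow> complex"
      unfolding c by (subst clinear_sum[OF that]) (simp add: scaleC_complex_def)
    \<comment> \<open>Over S the vector \<open>V x\<close> is a combination of a basis of the
      component, so Cramer's rule for each basis vector makes the defect vanish.\<close>
    have "(\<Sum>i<d. l i (V x) * minor (bs r) (l(i := g))) =
        (\<Sum>j<d. c j * (\<Sum>i<d. l i (bs r ! j) * minor (bs r) (l(i := g))))"
      unfolding app[OF l(1)[rule_format]] sum_distrib_left sum_distrib_right
      by (subst sum.swap) (simp add: mult.assoc)
    also have "\<dots> = (\<Sum>j<d. c j * (g (bs r ! j) * minor (bs r) l))"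
      using n by (intro sum.cong) (auto simp: minor_cramer)
    also have "\<dots> = g (V x) * minor (bs r) l"
      unfolding app[OF g(1)] sum_distrib_right by (simp add: mult.assoc)
    finally have "F x = 0" unfolding F_def crd[OF l(1)] crd[OF lg] by simp
    then show ?thesis using x Q' by auto
  qed
  ultimately have "\<exists>x\<in>pair_coords (z, X). F x = 0"
    by (rule zariski_closure_zero[OF cl])
  then obtain x where x: "x \<in> pair_coords (z, X)" "F x = 0" by blast
  obtain bs where bs: "is_basis_list (bs r) (z r)"
      and crd: "\<And>l. \<forall>a. clinear (l a) \<Longrightarrow> x (Inl (r, l)) = minor (bs r) l"
    using pair_coordsD(1)[OF x(1)] r by blast
  have n: "length (bs r) = d" using length_basis_list[OF bs] length_basis_list[OF U] len by simp
  obtain c where c: "c \<noteq> 0" "V x = c *\<^sub>C v" using v x by blast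
  \<comment> \<open>At the limit point g kills the whole row i, so only \<open>g (V x)\<close> times
    the nonzero \<open>minor (bs r) l\<close> is left of \<open>F x\<close>.\<close>
  have "minor (bs r) (l(i := g)) = 0" if "i < d" for i
    using that n by (simp add: minor_upd_expand g(2) basis_list_nth[OF bs])
  moreover have "g (V x) = c"
    using c g(3) clinear_scale[OF g(1)] by (simp add: scaleC_complex_def)
  ultimately have "F x = c * minor (bs r) l"
    unfolding F_def crd[OF l(1)] crd[OF lg] by simp
  with minor_dual_nonzero[OF U bs l] c x show False by simp
qed

text \<open>The interior product of the Pluecker vector with all \<open>k a\<close>, \<open>a \<noteq> j\<close>, written in the basis \<open>es\<close>
  with dual basis \<open>es'\<close>.\<close>
definition contraction ::
  "nat \<Rightarrow> (nat \<Rightarrow> 'v \<Rightarrow> complex) \<Rightarrow> nat \<Rightarrow> 'v list \<Rightarrow> (nat \<Rightarrow> 'v \<Rightarrow> complex) \<Rightarrow>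
     ((nat \<times> (nat \<Rightarrow> 'v \<Rightarrow> complex)) + 'c \<Rightarrow> complex) \<Rightarrow> 'v::complex_vec" where
  "contraction r k j es es' x = (\<Sum>p<length es. x (Inl (r, k(j := es' p))) *\<^sub>C (es ! p))"

lemma vec_multihom_contraction:
  "vec_multihom (map_sum fst fst) (\<lambda>l. if l = Inl r then 1 else 0) (contraction r k j es es')"
proof -
  have "multihom (map_sum fst fst) (\<lambda>l. if l = Inl r then 1 else 0) (\<lambda>x. x (Inl (r, k')))" for k'
    using multihom_coord[of "map_sum fst fst" "Inl (r, k')"] by simp
  then show ?thesis
    unfolding contraction_def by (intro vec_multihom_sum[OF finite_lessThan] vec_multihom_scale)
qed

text \<open>Expansion along row j is linear in the functional placed there, so summing over the dual
  bases \<open>es'\<close>, \<open>es\<close> returns the vectors \<open>bs ! m\<close> themselves.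
  The ambient basis drops out, and the result visibly lies in U.\<close>

lemma contraction_eq:
  fixes W :: "'v::complex_vec set"
  assumes es: "is_basis_list es W" "\<forall>i. clinear (es' i)"
      "\<forall>i<length es. \<forall>j<length es. es' i (es ! j) = (if i = j then 1 else 0)"
    and k: "\<forall>i. clinear (k i)" and bs: "is_basis_list bs U" and UW: "U \<subseteq> W" and j: "j < length bs"
    and x: "\<forall>l. (\<forall>a. clinear (l a)) \<longrightarrow> x (Inl (r, l)) = minor bs l"
  shows "contraction r k j es es' x = (\<Sum>m<length bs. cofactor (minor_mat bs k) j m *\<^sub>C (bs ! m))"
proof -
  have expand: "(\<Sum>p<length es. es' p w *\<^sub>C (es ! p)) = w" if w: "w \<in> W" for w
  proof -
    obtain c where c: "w = (\<Sum>q<length es. c q *\<^sub>C (es ! q))"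
      by (rule basis_list_coords[OF es(1) w])
    have "es' p w = c p" if "p < length es" for p
    proof -
      have "es' p w = (\<Sum>q<length es. c q * (if p = q then 1 else 0))"
        unfolding c clinear_sum[OF es(2)[rule_format]] using that es(3)
        by (intro sum.cong) (auto simp: scaleC_complex_def)
      then show ?thesis using that by (simp add: if_distrib[of "\<lambda>x. _ * x"] cong: if_cong)
    qed
    then have "(\<Sum>p<length es. es' p w *\<^sub>C (es ! p)) = (\<Sum>p<length es. c p *\<^sub>C (es ! p))"
      by (intro sum.cong) auto
    then show ?thesis using c by simp
  qed
  have lin: "\<forall>a. clinear ((k(j := es' p)) a)" for p using k es(2) by simp
  have "contraction r k j es es' x =
      (\<Sum>p<length es. \<Sum>m<length bs. (es' p (bs ! m) * cofactor (minor_mat bs k) j m) *\<^sub>C (es ! p))"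
    unfolding contraction_def x[rule_format, OF lin[rule_format]] minor_upd_expand[OF j] cv.scale_sum_left ..
  also have "\<dots> = (\<Sum>m<length bs. cofactor (minor_mat bs k) j m *\<^sub>C (\<Sum>p<length es. es' p (bs ! m) *\<^sub>C (es ! p)))"
    unfolding cv.scale_sum_right by (subst sum.swap) (simp add: scaleC_scaleC mult.commute)
  also have "\<dots> = (\<Sum>m<length bs. cofactor (minor_mat bs k) j m *\<^sub>C (bs ! m))"
    by (intro sum.cong refl) (simp add: expand subsetD[OF UW] basis_list_nth[OF bs])
  finally show ?thesis .
qed

lemma subspace_combination:
  "cv.subspace U \<Longrightarrow> (\<And>m. m \<in> I \<Longrightarrow> v m \<in> U) \<Longrightarrow> (\<Sum>m\<in>I. c m *\<^sub>C v m) \<in> U"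
  by (intro cv.subspace_sum cv.subspace_scale)

lemma contraction_mem:
  fixes W :: "'v::complex_vec set"
  assumes es: "is_basis_list es W" "\<forall>i. clinear (es' i)"
      "\<forall>i<length es. \<forall>j<length es. es' i (es ! j) = (if i = j then 1 else 0)"
    and k: "\<forall>i. clinear (k i)" and bs: "is_basis_list bs U" and UW: "U \<subseteq> W" and j: "j < length bs"
    and x: "\<forall>l. (\<forall>a. clinear (l a)) \<longrightarrow> x (Inl (r, l)) = minor bs l"
  shows "contraction r k j es es' x \<in> U"
  unfolding contraction_eq[OF assms]
  by (intro subspace_combination subspace_basis_list[OF bs]) (simp add: basis_list_nth[OF bs])

text \<open>When k is dual to \<open>us\<close>, the i-th coordinate of the contraction is the minor
  with row j replaced by \<open>k i\<close>; for i \<noteq> j it has two equal rows. Only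
  \<open>us ! j\<close> survives.\<close>

lemma contraction_dual:
  fixes W :: "'v::complex_vec set"
  assumes es: "is_basis_list es W" "\<forall>i. clinear (es' i)"
      "\<forall>i<length es. \<forall>j<length es. es' i (es ! j) = (if i = j then 1 else 0)"
    and k: "\<forall>i. clinear (k i)"
      "\<forall>i<length us. \<forall>j<length us. k i (us ! j) = (if i = j then 1 else 0)"
    and us: "is_basis_list us U"
    and bs: "is_basis_list bs U" and UW: "U \<subseteq> W" and j: "j < length us"
    and x: "\<forall>l. (\<forall>a. clinear (l a)) \<longrightarrow> x (Inl (r, l)) = minor bs l"
  shows "contraction r k j es es' x = minor bs k *\<^sub>C (us ! j)"
proof -
  let ?v = "contraction r k j es es' x"
  have len: "length us = length bs" using us bs by (simp add: length_basis_list)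
  have j': "j < length bs" using j len by simp
  note eq = contraction_eq[OF es k(1) bs UW j' x]
  have app: "g ?v = minor bs (k(j := g))" if "clinear g" for g :: "'v \<Rightarrow> complex"
    unfolding eq minor_upd_expand[OF j'] by (subst clinear_sum[OF that]) (simp add: scaleC_complex_def mult.commute)
  obtain c where c: "?v = (\<Sum>m<length us. c m *\<^sub>C (us ! m))"
    by (rule basis_list_coords[OF us contraction_mem[OF es k(1) bs UW j' x]])
  have "c i = (if i = j then minor bs k else 0)" if i: "i < length us" for i
  proof -
    have "k i ?v = (\<Sum>m<length us. c m * (if i = m then 1 else 0))"
      unfolding c clinear_sum[OF k(1)[rule_format]] using i k(2)
      by (intro sum.cong) (auto simp: scaleC_complex_def)
    also have "\<dots> = c i" using i by (simp add: if_distrib[of "\<lambda>x. _ * x"] cong: if_cong)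
    finally have "c i = minor bs (k(j := k i))" using app[OF k(1)[rule_format]] by simp
    then show ?thesis using minor_upd_other[of j bs i k] i j len by auto
  qed
  then have "?v = (\<Sum>m<length us. (if m = j then minor bs k else 0) *\<^sub>C (us ! m))"
    unfolding c by (intro sum.cong) auto
  then show ?thesis using j by (simp add: if_distrib[of "\<lambda>c. c *\<^sub>C _"] cong: if_cong)
qed

section \<open>Filtered components of the limit subalgebras\<close>

lemma length_le_sum_list: "\<forall>w\<in>set ws. (1::nat) \<le> f w \<Longrightarrow> length ws \<le> sum_list (map f ws)"
  by (induction ws) auto

text \<open>Letters have degree at least 1, so a bound on the total degree bounds the length of a
  word as well as its upper indices. This is the finite-dimensionality of the filtered
  components.\<close>

lemma finite_words:
  "finite {ws :: (nat \<times> 'm::finite \<times> 'm) list. (\<forall>w\<in>set ws. fst w \<ge> 1) \<and> sum_list (map fst ws) \<le> r}"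
proof (rule finite_subset)
  let ?L = "{ws. set ws \<subseteq> {..r} \<times> (UNIV :: ('m \<times> 'm) set) \<and> length ws \<le> r}"
  show "finite ?L" by (intro finite_lists_length_le) auto
  show "{ws :: (nat \<times> 'm \<times> 'm) list. (\<forall>w\<in>set ws. fst w \<ge> 1) \<and> sum_list (map fst ws) \<le> r} \<subseteq> ?L"
  proof
    fix ws :: "(nat \<times> 'm \<times> 'm) list"
    assume ws: "ws \<in> {ws. (\<forall>w\<in>set ws. fst w \<ge> 1) \<and> sum_list (map fst ws) \<le> r}"
    then have "fst w \<le> r" if "w \<in> set ws" for w
      using member_le_sum_list[of "fst w" "map fst ws"] that by auto
    moreover have "length ws \<le> r" using ws length_le_sum_list[of ws fst] by auto
    ultimately show "ws \<in> ?L" by auto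
  qed
qed

lemma YV_filt_basis:
  fixes t :: "nat \<Rightarrow> 'm::finite \<Rightarrow> 'm \<Rightarrow> 'v::complex_alg"
  assumes "cv.subspace U" "U \<subseteq> YV_filt t r"
  obtains bs where "is_basis_list bs U"
proof (rule basis_list_exists)
  show "finite {prod_list (map (\<lambda>(s, a, b). t s a b) ws) |ws.
      (\<forall>w\<in>set ws. fst w \<ge> 1) \<and> sum_list (map fst ws) \<le> r}"
    by (rule finite_image_set[OF finite_words])
qed (use assms that in \<open>auto simp: YV_filt_def\<close>)

lemma subspace_YV_filt: "cv.subspace (YV_filt t r)"
  unfolding YV_filt_def by (rule cv.subspace_span)

lemma YV_filt_word:
  "\<forall>w\<in>set ws. fst w \<ge> 1 \<Longrightarrow> sum_list (map fst ws) \<le> r \<Longrightarrow>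
    prod_list (map (\<lambda>(s, a, b). t s a b) ws) \<in> YV_filt t r"
  unfolding YV_filt_def by (intro cv.span_base) blast

lemma YV_filt_one: "1 \<in> YV_filt t r"
  using YV_filt_word[of "[]"] by simp

lemma YV_filt_t: "r \<ge> 1 \<Longrightarrow> t r a b \<in> YV_filt t r"
  using YV_filt_word[of "[(r, a, b)]" r t] by simp

lemma YV_filt_mult:
  assumes "x \<in> YV_filt t r" "y \<in> YV_filt t s"
  shows "x * y \<in> YV_filt t (r + s)"
  using assms(1) unfolding YV_filt_def[of t r]
proof (induction rule: cv.span_induct_alt)
  case base
  then show ?case using cv.subspace_0[OF subspace_YV_filt] by simp
next
  case (step c u x)
  then obtain us where us: "u = prod_list (map (\<lambda>(s, a, b). t s a b) us)"
      "\<forall>w\<in>set us. fst w \<ge> 1" "sum_list (map fst us) \<le> r" by auto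
  have "u * y \<in> YV_filt t (r + s)"
    using assms(2) unfolding YV_filt_def[of t s]
  proof (induction rule: cv.span_induct_alt)
    case base
    then show ?case using cv.subspace_0[OF subspace_YV_filt] by simp
  next
    case (step d v y)
    then obtain vs where vs: "v = prod_list (map (\<lambda>(s, a, b). t s a b) vs)"
        "\<forall>w\<in>set vs. fst w \<ge> 1" "sum_list (map fst vs) \<le> s" by auto
    have "u * v \<in> YV_filt t (r + s)"
      using YV_filt_word[of "us @ vs" "r + s" t] us vs by auto
    with step show ?case
      by (simp add: distrib_left scaleC_mult_right cv.subspace_add cv.subspace_scale subspace_YV_filt)
  qed
  with step show ?case
    by (simp add: distrib_right scaleC_mult_left cv.subspace_add cv.subspace_scale subspace_YV_filt)
qed

lemma Z_limit_component:
  assumes "z \<in> Z_limit t blk \<rho>G Reg" "r \<ge> 1"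
  shows "z r \<in> grassmannian (bethe_dim t blk \<rho>G Reg r) (YV_filt t r)"
proof -
  have "restrict z {1..r} \<in> Z_level t blk \<rho>G Reg r" using assms by (simp add: Z_limit_def)
  then have "restrict z {1..r} \<in> gr_product t blk \<rho>G Reg {1..r}"
    unfolding Z_level_def by (rule subsetD[OF zariski_closure_subset])
  then have "restrict z {1..r} r \<in> grassmannian (bethe_dim t blk \<rho>G Reg r) (YV_filt t r)"
    unfolding gr_product_def by (rule PiE_mem) (use assms in simp)
  then show ?thesis using assms by simp
qed

lemma bethe_tau_scale: "bethe_tau t blk i (c *\<^sub>C M) r = c *\<^sub>C bethe_tau t blk i M r"
  unfolding bethe_tau_def cv.scale_sum_right by (simp add: scaleC_vec_def scaleC_complex_def scaleC_scaleC)

lemma bethe_tau_blk_part: "bethe_tau t blk i (blk_part blk i M) r = bethe_tau t blk i M r"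
  unfolding bethe_tau_def blk_part_def by (intro sum.cong refl) simp

lemma bethe_tau_YV_filt: "r \<ge> 1 \<Longrightarrow> bethe_tau t blk i M r \<in> YV_filt t r"
  unfolding bethe_tau_def
  by (intro cv.subspace_sum[OF subspace_YV_filt] cv.subspace_scale[OF subspace_YV_filt] YV_filt_t)

lemma proj_space_scalar:
  assumes "X \<in> proj_space W" "M \<in> X" "M \<noteq> 0" "N \<in> X" "N \<noteq> 0"
  shows "\<exists>c. c \<noteq> 0 \<and> M = c *\<^sub>C N"
proof -
  obtain w c d where "w \<noteq> 0" "M = c *\<^sub>C w" "N = d *\<^sub>C w"
    using assms unfolding proj_space_def by blast
  then show ?thesis using assms
    by (intro exI[of _ "c / d"]) (auto simp: scaleC_scaleC)
qed

lemma proj_space_nonzero: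
  assumes "X \<in> proj_space W" obtains M where "M \<in> X" "M \<noteq> 0"
proof -
  obtain w where "w \<noteq> 0" "X = {c *\<^sub>C w | c. True}" using assms by (auto simp: proj_space_def)
  then show ?thesis using that[of w] scaleC_one[of w] by (metis (mono_tags, lifting) mem_Collect_eq)
qed

lemma pair_coords_nonempty:
  assumes "z \<in> Z_limit t blk \<rho>G Reg" "\<forall>i. X i \<in> proj_space (W i)"
  shows "\<exists>x. x \<in> pair_coords (z, X)"
proof -
  have "\<exists>bs. is_basis_list bs (z r)" if "r \<ge> 1" for r
    using Z_limit_component[OF assms(1) that] YV_filt_basis[of "z r" t r]
    by (auto simp: grassmannian_def)
  then obtain bs where bs: "\<forall>r\<in>{1..}. is_basis_list (bs r) (z r)" by (metis atLeast_iff)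
  have "\<forall>i. \<exists>M. M \<in> X i \<and> M \<noteq> 0" using assms(2) proj_space_nonzero by metis
  then obtain M where "\<forall>i. M i \<in> X i \<and> M i \<noteq> 0" by metis
  then show ?thesis
    using bs unfolding pair_coords_def plucker_coords_def matrix_coords_def by blast
qed

section \<open>Passing from regular elements to points of the closure\<close>

lemma wonderful_proj_space:
  "X \<in> wonderful_compactification blk \<rho>G G \<Longrightarrow> X i \<in> proj_space (blk_End blk i)"
  unfolding wonderful_compactification_def by (drule subsetD[OF zariski_closure_subset]) simp

lemma Z_tilde_closure:
  "Z_tilde t blk \<rho>G G Reg =
     zariski_topology (map_sum fst fst) (Z_limit t blk \<rho>G Reg \<times> wonderful_compactification blk \<rho>G G)
       pair_coords closure_of ((\<lambda>C. (theta t blk \<rho>G {1..} C, proj_point blk \<rho>G C)) ` Reg)"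
  unfolding Z_tilde_def pair_coords_def ..

lemma Z_tilde_points:
  assumes "(z, X) \<in> Z_tilde t blk \<rho>G G Reg"
  shows "z \<in> Z_limit t blk \<rho>G Reg" "X \<in> wonderful_compactification blk \<rho>G G"
proof -
  have "(z, X) \<in> Z_limit t blk \<rho>G Reg \<times> wonderful_compactification blk \<rho>G G"
    by (rule subsetD[OF zariski_closure_subset assms[unfolded Z_tilde_closure]])
  then show "z \<in> Z_limit t blk \<rho>G Reg" "X \<in> wonderful_compactification blk \<rho>G G" by auto
qed

lemma Z_tilde_basis:
  fixes t :: "nat \<Rightarrow> 'm::finite \<Rightarrow> 'm \<Rightarrow> 'v::complex_alg"
  assumes "z \<in> Z_limit t blk \<rho>G Reg" "r \<ge> 1"
  obtains us where "is_basis_list us (z r)"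
  using Z_limit_component[OF assms] YV_filt_basis[of "z r" t r] by (auto simp: grassmannian_def)

text \<open>Keeps the bases and matrices that produce the coordinate vector x in view. Only Pluecker
  coordinates with positive r and linear functionals are recorded; the others are void.\<close>

definition coords_at ::
  "((nat \<times> (nat \<Rightarrow> 'v \<Rightarrow> complex)) + ('i \<times> 'm \<times> 'm) \<Rightarrow> complex) \<Rightarrow>
     (nat \<Rightarrow> 'v::complex_vec set) \<Rightarrow> ('i \<Rightarrow> (complex ^ 'm ^ 'm::finite) set) \<Rightarrow>
     (nat \<Rightarrow> 'v list) \<Rightarrow> ('i \<Rightarrow> complex ^ 'm ^ 'm) \<Rightarrow> bool" where
  "coords_at x z X bs M \<longleftrightarrow>
     (\<forall>r\<ge>1. is_basis_list (bs r) (z r) \<and>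
        (\<forall>l. (\<forall>a. clinear (l a)) \<longrightarrow> x (Inl (r, l)) = minor (bs r) l)) \<and>
     (\<forall>i. M i \<in> X i \<and> M i \<noteq> 0 \<and> (\<forall>a b. x (Inr (i, a, b)) = M i $ a $ b))"

lemma pair_coords_coords_at:
  assumes "x \<in> pair_coords (z, X)"
  obtains bs M where "coords_at x z X bs M"
  using pair_coordsD[OF assms] unfolding coords_at_def by blast

text \<open>Regular points in the ambient product have the component dimensions of z. This supplies
  the equality of lengths offered to the hypothesis on \<open>Reg\<close>, so that an index below
  the length of a basis of \<open>z r\<close> can also be used at the regular point.\<close>

lemma Z_tilde_membership:
  fixes t :: "nat \<Rightarrow> 'm::finite \<Rightarrow> 'm \<Rightarrow> 'v::complex_alg" and blk :: "'m \<Rightarrow> 'i"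
  assumes ZX: "(z, X) \<in> Z_tilde t blk \<rho>G G Reg"
    and V: "vec_multihom (map_sum fst fst) D V"
    and r: "r \<ge> 1"
    and S: "\<And>C x bs M. C \<in> Reg \<Longrightarrow>
      coords_at x (theta t blk \<rho>G {1..} C) (proj_point blk \<rho>G C) bs M \<Longrightarrow>
      (\<And>s. s \<ge> 1 \<Longrightarrow> length (bs s) = cv.dim (z s)) \<Longrightarrow> V x \<in> bethe_component t blk \<rho>G r C"
    and v: "\<And>x bs M. coords_at x z X bs M \<Longrightarrow> \<exists>c. c \<noteq> 0 \<and> V x = c *\<^sub>C v"
  shows "v \<in> z r"
proof -
  obtain us where us: "is_basis_list us (z r)"
    by (rule Z_tilde_basis[OF Z_tilde_points(1)[OF ZX] r])
  have dim_z: "cv.dim (z s) = bethe_dim t blk \<rho>G Reg s" if "s \<ge> 1" for s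
    using Z_limit_component[OF Z_tilde_points(1)[OF ZX] that] by (simp add: grassmannian_def)
  show ?thesis
  proof (rule closure_membership[OF ZX[unfolded Z_tilde_closure] V r _ us])
    fix z' :: "nat \<Rightarrow> 'v set" and X' :: "'i \<Rightarrow> (complex ^ 'm ^ 'm) set"
    assume A: "(z', X') \<in> Z_limit t blk \<rho>G Reg \<times> wonderful_compactification blk \<rho>G G"
    then have dim: "cv.dim (z' s) = bethe_dim t blk \<rho>G Reg s" if "s \<ge> 1" for s
      using Z_limit_component[of z' t blk \<rho>G Reg s] that by (auto simp: grassmannian_def)
    then show "cv.dim (z' r) = bethe_dim t blk \<rho>G Reg r" using r .
    assume "(z', X') \<in> (\<lambda>C. (theta t blk \<rho>G {1..} C, proj_point blk \<rho>G C)) ` Reg"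
    then obtain C where C: "C \<in> Reg" "z' = theta t blk \<rho>G {1..} C" "X' = proj_point blk \<rho>G C"
      by auto
    have "\<forall>i. X' i \<in> proj_space (blk_End blk i)" using A by (auto intro: wonderful_proj_space)
    then obtain x where x: "x \<in> pair_coords (z', X')"
      using pair_coords_nonempty[of z' t blk \<rho>G Reg X'] A by blast
    obtain bs M where bs: "coords_at x z' X' bs M" by (rule pair_coords_coords_at[OF x])
    have "length (bs s) = cv.dim (z s)" if "s \<ge> 1" for s
    proof -
      have "is_basis_list (bs s) (z' s)" using bs that unfolding coords_at_def by blast
      from length_basis_list[OF this] show ?thesis using dim[OF that] dim_z[OF that] by simp
    qed
    then have "V x \<in> bethe_component t blk \<rho>G r C" using S[of C x bs M] bs C by simp
    then have "V x \<in> z' r" using C r by (simp add: theta_def)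
    with x show "\<exists>x\<in>pair_coords (z', X'). V x \<in> z' r" by blast
  next
    fix x :: "nat \<times> (nat \<Rightarrow> 'v \<Rightarrow> complex) + 'i \<times> 'm \<times> 'm \<Rightarrow> complex"
    assume "x \<in> pair_coords (z, X)"
    then obtain bs M where "coords_at x z X bs M" by (rule pair_coords_coords_at)
    then show "\<exists>c. c \<noteq> 0 \<and> V x = c *\<^sub>C v" by (rule v)
  qed
qed

lemma bethe_component_mult:
  assumes "x \<in> bethe_component t blk \<rho>G r C" "y \<in> bethe_component t blk \<rho>G s C"
  shows "x * y \<in> bethe_component t blk \<rho>G (r + s) C"
  using assms unfolding bethe_component_def bethe_def by (auto intro: YV_filt_mult subalg_mult)

lemma Z_tilde_basis_vector:
  fixes t :: "nat \<Rightarrow> 'm::finite \<Rightarrow> 'm \<Rightarrow> 'v::complex_alg" and blk :: "'m \<Rightarrow> 'i"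
  assumes ZX: "(z, X) \<in> Z_tilde t blk \<rho>G G Reg" and r: "r \<ge> 1"
    and us: "is_basis_list us (z r)" and j: "j < length us"
  shows "\<exists>D (V :: (nat \<times> (nat \<Rightarrow> 'v \<Rightarrow> complex) + 'i \<times> 'm \<times> 'm \<Rightarrow> complex) \<Rightarrow> 'v).
    vec_multihom (map_sum fst fst) D V \<and>
    (\<forall>C x bs M. coords_at x (theta t blk \<rho>G {1..} C) (proj_point blk \<rho>G C) bs M \<longrightarrow>
        length (bs r) = cv.dim (z r) \<longrightarrow> V x \<in> bethe_component t blk \<rho>G r C) \<and>
    (\<forall>x bs M. coords_at x z X bs M \<longrightarrow> (\<exists>c. c \<noteq> 0 \<and> V x = c *\<^sub>C (us ! j)))"
proof -
  \<comment> \<open>One ambient basis serves all points, because every r-th component is contained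
    in \<open>YV_filt t r\<close>; thus the contraction is a single function.\<close>
  obtain es where es: "is_basis_list es (YV_filt t r)"
    using YV_filt_basis[OF subspace_YV_filt order_refl] by blast
  obtain es' :: "nat \<Rightarrow> 'v \<Rightarrow> complex" where es': "\<forall>i. clinear (es' i)"
      "\<forall>i<length es. \<forall>j<length es. es' i (es ! j) = (if i = j then 1 else 0)"
    using dual_functionals[OF es] by blast
  obtain k :: "nat \<Rightarrow> 'v \<Rightarrow> complex" where k: "\<forall>i. clinear (k i)"
      "\<forall>i<length us. \<forall>j<length us. k i (us ! j) = (if i = j then 1 else 0)"
    using dual_functionals[OF us] by blast
  have zr: "z r \<subseteq> YV_filt t r"
    using Z_limit_component[OF Z_tilde_points(1)[OF ZX] r] by (simp add: grassmannian_def)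
  let ?V = "contraction r k j es es' :: (_ + 'i \<times> 'm \<times> 'm \<Rightarrow> complex) \<Rightarrow> 'v"
  have "?V x \<in> bethe_component t blk \<rho>G r C"
    if x: "coords_at x (theta t blk \<rho>G {1..} C) (proj_point blk \<rho>G C) bs M"
      and len: "length (bs r) = cv.dim (z r)" for C x bs M
  proof (rule contraction_mem[OF es es' k(1)])
    show "is_basis_list (bs r) (bethe_component t blk \<rho>G r C)"
      using x r by (simp add: coords_at_def theta_def)
    show "j < length (bs r)" using j length_basis_list[OF us] len by simp
    show "\<forall>l. (\<forall>a. clinear (l a)) \<longrightarrow> x (Inl (r, l)) = minor (bs r) l"
      using x r unfolding coords_at_def by blast
  qed (simp add: bethe_component_def)
  moreover have "\<exists>c. c \<noteq> 0 \<and> ?V x = c *\<^sub>C (us ! j)" if x: "coords_at x z X bs M" for x bs M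
  proof (intro exI conjI)
    have bs: "is_basis_list (bs r) (z r)"
      and crd: "\<forall>l. (\<forall>a. clinear (l a)) \<longrightarrow> x (Inl (r, l)) = minor (bs r) l"
      using x r unfolding coords_at_def by blast+
    show "minor (bs r) k \<noteq> 0" by (rule minor_dual_nonzero[OF us bs k])
    show "?V x = minor (bs r) k *\<^sub>C (us ! j)" by (rule contraction_dual[OF es es' k us bs zr j crd])
  qed
  ultimately show ?thesis using vec_multihom_contraction[of r k j es es'] by blast
qed

lemma Z_tilde_one:
  fixes t :: "nat \<Rightarrow> 'm::finite \<Rightarrow> 'm \<Rightarrow> 'v::complex_alg"
  assumes ZX: "(z, X) \<in> Z_tilde t blk \<rho>G G Reg" and "r \<ge> 1"
  shows "1 \<in> z r"
proof -
  have V: "vec_multihom (map_sum fst fst) (\<lambda>_. 0) (\<lambda>_. 1::'v)"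
    using vec_multihom_scale[OF multihom_const[where c = 1], where v = "1::'v"] by (simp add: scaleC_one)
  show ?thesis
  proof (rule Z_tilde_membership[OF ZX V assms(2)])
    show "1 \<in> bethe_component t blk \<rho>G r C" for C
      by (simp add: bethe_component_def bethe_def YV_filt_one subalg_one)
    show "\<exists>c. c \<noteq> 0 \<and> (1::'v) = c *\<^sub>C 1" by (intro exI[of _ 1]) (simp add: scaleC_one)
  qed
qed

lemma Z_tilde_subspace:
  "(z, X) \<in> Z_tilde t blk \<rho>G G Reg \<Longrightarrow> r \<ge> 1 \<Longrightarrow> cv.subspace (z r)"
  using Z_limit_component[OF Z_tilde_points(1)] by (fastforce simp: grassmannian_def)

text \<open>The product of the lifts of two basis vectors takes values in the component r + s over
  the regular elements, and at (z, X) it is a nonzero multiple of the product of the basis vectors.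
  Bilinearity does the rest.\<close>

lemma Z_tilde_mult:
  fixes t :: "nat \<Rightarrow> 'm::finite \<Rightarrow> 'm \<Rightarrow> 'v::complex_alg"
  assumes ZX: "(z, X) \<in> Z_tilde t blk \<rho>G G Reg" and r: "r \<ge> 1" and s: "s \<ge> 1"
    and u: "u \<in> z r" and w: "w \<in> z s"
  shows "u * w \<in> z (r + s)"
proof -
  note Z = Z_tilde_points(1)[OF ZX]
  obtain us where us: "is_basis_list us (z r)" by (rule Z_tilde_basis[OF Z r])
  obtain ws where ws: "is_basis_list ws (z s)" by (rule Z_tilde_basis[OF Z s])
  have basis: "us ! i * ws ! j \<in> z (r + s)" if i: "i < length us" and j: "j < length ws" for i j
  proof -
    from Z_tilde_basis_vector[OF ZX r us i] obtain D V where
      V: "vec_multihom (map_sum fst fst) D V"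
      "\<And>C x bs M. coords_at x (theta t blk \<rho>G {1..} C) (proj_point blk \<rho>G C) bs M \<Longrightarrow>
        length (bs r) = cv.dim (z r) \<Longrightarrow> V x \<in> bethe_component t blk \<rho>G r C"
      "\<And>x bs M. coords_at x z X bs M \<Longrightarrow> \<exists>c. c \<noteq> 0 \<and> V x = c *\<^sub>C (us ! i)"
      by blast
    from Z_tilde_basis_vector[OF ZX s ws j] obtain E W where
      W: "vec_multihom (map_sum fst fst) E W"
      "\<And>C x bs M. coords_at x (theta t blk \<rho>G {1..} C) (proj_point blk \<rho>G C) bs M \<Longrightarrow>
        length (bs s) = cv.dim (z s) \<Longrightarrow> W x \<in> bethe_component t blk \<rho>G s C"
      "\<And>x bs M. coords_at x z X bs M \<Longrightarrow> \<exists>c. c \<noteq> 0 \<and> W x = c *\<^sub>C (ws ! j)"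
      by blast
    show ?thesis
    proof (rule Z_tilde_membership[OF ZX vec_multihom_mult[OF V(1) W(1)]])
      fix C x bs M assume "coords_at x (theta t blk \<rho>G {1..} C) (proj_point blk \<rho>G C) bs M"
        and "\<And>s. s \<ge> 1 \<Longrightarrow> length (bs s) = cv.dim (z s)"
      then show "V x * W x \<in> bethe_component t blk \<rho>G (r + s) C"
        using V(2)[of x C bs M] W(2)[of x C bs M] r s by (intro bethe_component_mult) auto
    next
      fix x bs M assume x: "coords_at x z X bs M"
      obtain c d where cd: "c \<noteq> 0" "d \<noteq> 0" "V x = c *\<^sub>C (us ! i)" "W x = d *\<^sub>C (ws ! j)"
        using V(3)[OF x] W(3)[OF x] by blast
      then show "\<exists>c. c \<noteq> 0 \<and> V x * W x = c *\<^sub>C (us ! i * ws ! j)"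
        by (intro exI[of _ "c * d"]) (simp add: scaleC_mult_left scaleC_mult_right scaleC_scaleC)
    qed (use r in simp)
  qed
  obtain c where c: "u = (\<Sum>i<length us. c i *\<^sub>C (us ! i))" by (rule basis_list_coords[OF us u])
  obtain d where d: "w = (\<Sum>j<length ws. d j *\<^sub>C (ws ! j))" by (rule basis_list_coords[OF ws w])
  have sub: "cv.subspace (z (r + s))" by (rule Z_tilde_subspace[OF ZX]) (use r in simp)
  have "u * w = (\<Sum>i<length us. c i *\<^sub>C (us ! i * w))"
    unfolding c sum_distrib_right scaleC_mult_left ..
  also have "\<dots> = (\<Sum>i<length us. c i *\<^sub>C (\<Sum>j<length ws. d j *\<^sub>C (us ! i * ws ! j)))"
    unfolding d sum_distrib_left scaleC_mult_right ..
  also have "\<dots> \<in> z (r + s)"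
    by (intro subspace_combination sub basis) auto
  finally show ?thesis .
qed

text \<open>\<open>Z_limit\<close> does not impose that the components increase. But 1 lies in
  \<open>z (s - r)\<close>, and multiplying by it moves \<open>z r\<close> into
  \<open>z s\<close>.\<close>

lemma Z_tilde_mono:
  fixes t :: "nat \<Rightarrow> 'm::finite \<Rightarrow> 'm \<Rightarrow> 'v::complex_alg"
  assumes ZX: "(z, X) \<in> Z_tilde t blk \<rho>G G Reg" and r: "r \<ge> 1" and "r \<le> s"
  shows "z r \<subseteq> z s"
proof (cases "r = s")
  case False
  then have s: "s - r \<ge> 1" "r + (s - r) = s" using assms by auto
  then show ?thesis
    using Z_tilde_mult[OF ZX r s(1) _ Z_tilde_one[OF ZX s(1)]] by auto
qed simp

lemma Z_tilde_bethe_tau: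
  fixes t :: "nat \<Rightarrow> 'm::finite \<Rightarrow> 'm \<Rightarrow> 'v::complex_alg" and blk :: "'m \<Rightarrow> 'i"
  assumes ZX: "(z, X) \<in> Z_tilde t blk \<rho>G G Reg" and r: "r \<ge> 1" and N: "N \<in> X i" "N \<noteq> 0"
  shows "bethe_tau t blk i N r \<in> z r"
proof -
  \<comment> \<open>The homogeneous coordinates in the matrix factor i are the matrix entries, and
    the trace is linear in them.\<close>
  define V where "V x = (\<Sum>a | blk a = i. \<Sum>b | blk b = i. x (Inr (i, a, b)) *\<^sub>C t r b a)"
    for x :: "nat \<times> (nat \<Rightarrow> 'v \<Rightarrow> complex) + 'i \<times> 'm \<times> 'm \<Rightarrow> complex"
  have V_eq: "V x = bethe_tau t blk i (M i) r" if "coords_at x z' X' bs M" for x z' X' bs M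
    using that unfolding V_def bethe_tau_def coords_at_def by simp
  let ?D = "\<lambda>l. if l = Inr i then 1 else 0"
  have coord: "multihom (map_sum fst fst) ?D (\<lambda>x. x (Inr (i, a, b)))" for a b
    using multihom_coord[of "map_sum fst fst" "Inr (i, a, b)"] by simp
  have V: "vec_multihom (map_sum fst fst) ?D V"
    unfolding V_def by (intro vec_multihom_sum[OF finite coord] vec_multihom_scale coord)
  show ?thesis
  proof (rule Z_tilde_membership[OF ZX V r])
    fix C x bs M assume x: "coords_at x (theta t blk \<rho>G {1..} C) (proj_point blk \<rho>G C) bs M"
    \<comment> \<open>The point of a regular element determines the i-th block of
      \<open>\<rho>G C\<close> only up to a factor; the trace reads that block alone, and a factor
      is harmless in a subalgebra.\<close>
    then obtain c where c: "M i = c *\<^sub>C blk_part blk i (\<rho>G C)"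
      unfolding coords_at_def proj_point_def by blast
    then show "V x \<in> bethe_component t blk \<rho>G r C"
      unfolding V_eq[OF x] bethe_component_def bethe_def c bethe_tau_scale bethe_tau_blk_part
      by (intro IntI cv.subspace_scale[OF subspace_YV_filt] bethe_tau_YV_filt r subalg_scale subalg_incl) blast
  next
    fix x bs M assume x: "coords_at x z X bs M"
    have "X i \<in> proj_space (blk_End blk i)" by (rule wonderful_proj_space[OF Z_tilde_points(2)[OF ZX]])
    then obtain c where "c \<noteq> 0" "M i = c *\<^sub>C N"
      using proj_space_scalar[of "X i" _ "M i" N] x N unfolding coords_at_def by blast
    then show "\<exists>c. c \<noteq> 0 \<and> V x = c *\<^sub>C bethe_tau t blk i N r"
      unfolding V_eq[OF x] by (auto simp: bethe_tau_scale)
  qed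
qed

lemma limit_subalgebra_contains:
  fixes t :: "nat \<Rightarrow> 'm::finite \<Rightarrow> 'm \<Rightarrow> 'v::complex_alg" and blk :: "'m \<Rightarrow> 'i"
  assumes t0: "\<And>a b. t 0 a b = (if a = b then 1 else 0)"
    and ZX: "(z, X) \<in> Z_tilde t blk \<rho>G G Reg"
  shows "bethe_bar t blk X \<subseteq> limit_subalgebra z"
proof
  note one = Z_tilde_one[OF ZX] and sub = Z_tilde_subspace[OF ZX]
  fix x assume "x \<in> bethe_bar t blk X"
  then have "\<exists>r\<ge>1. x \<in> z r" unfolding bethe_bar_def
  proof (induction rule: subalg.induct)
    case (subalg_incl x)
    then obtain i r M where x: "x = bethe_tau t blk i M r" "M \<in> X i" "M \<noteq> 0" by blast
    show ?case
    proof (cases "r = 0")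
      \<comment> \<open>The coefficient of u^0 is the trace of the block times 1, as T(u) starts
        with the identity. The filtered components are indexed from 1, so it is placed in
        \<open>z 1\<close>.\<close>
      case True
      have "t 0 b a \<in> z 1" for a b
        using one[of 1] cv.subspace_0[OF sub[of 1]] by (simp add: t0)
      then have "x \<in> z 1" unfolding x bethe_tau_def True
        by (intro cv.subspace_sum cv.subspace_scale sub) auto
      then show ?thesis by blast
    next
      case False
      then have "r \<ge> 1" by simp
      with Z_tilde_bethe_tau[OF ZX _ x(2,3)] x(1) show ?thesis by blast
    qed
  next
    case subalg_one
    then show ?case using one[of 1] by blast
  next
    case (subalg_scale x c)
    then show ?case using sub cv.subspace_scale by blast
  next
    case (subalg_add x y)
    then obtain r s where "r \<ge> 1" "s \<ge> 1" "x \<in> z r" "y \<in> z s" by blast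
    then have "x \<in> z (max r s)" "y \<in> z (max r s)" "max r s \<ge> 1"
      using Z_tilde_mono[OF ZX, of r "max r s"] Z_tilde_mono[OF ZX, of s "max r s"] by auto
    then show ?case using sub cv.subspace_add by blast
  next
    case (subalg_mult x y)
    then obtain r s where "r \<ge> 1" "s \<ge> 1" "x \<in> z r" "y \<in> z s" by blast
    then show ?case using Z_tilde_mult[OF ZX] by (intro exI[of _ "r + s"]) auto
  qed
  then show "x \<in> limit_subalgebra z" unfolding limit_subalgebra_def by auto
qed

section \<open>Commutativity on the closure\<close>

text \<open>Centralizers are closed under the algebra operations. This is applied first to the
  centralizer of a generator, then to that of an element of the generated subalgebra.\<close>

lemma subalg_commute:
  assumes gen: "\<And>x y. x \<in> S \<Longrightarrow> y \<in> S \<Longrightarrow> x * y = y * x"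
    and "x \<in> subalg S" "y \<in> subalg S"
  shows "x * y = y * x"
proof -
  have step: "a * y = y * a" if "a \<in> S" "y \<in> subalg S" for a y
    using that(2)
  proof (induction rule: subalg.induct)
    case (subalg_mult x y)
    then show ?case by (metis mult.assoc)
  qed (simp_all add: gen that(1) scaleC_mult_left scaleC_mult_right distrib_left distrib_right)
  show ?thesis using assms(2)
  proof (induction rule: subalg.induct)
    case (subalg_incl x)
    then show ?case using step assms(3) by blast
  next
    case (subalg_mult x y)
    then show ?case by (metis mult.assoc)
  qed (simp_all add: scaleC_mult_left scaleC_mult_right distrib_left distrib_right)
qed

lemma matrix_coordsD:
  assumes "x \<in> matrix_coords X"
  shows "\<exists>M. \<forall>i. M i \<in> X i \<and> M i \<noteq> 0 \<and> (\<forall>a b. x (i, a, b) = M i $ a $ b)"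
  using assms unfolding matrix_coords_def by auto

lemma matrix_coords_nonempty:
  assumes "\<forall>i. X i \<in> proj_space (W i)"
  shows "\<exists>x. x \<in> matrix_coords X"
proof -
  have "\<forall>i. \<exists>M. M \<in> X i \<and> M \<noteq> 0" using assms proj_space_nonzero by metis
  then obtain M where "\<forall>i. M i \<in> X i \<and> M i \<noteq> 0" by metis
  then show ?thesis unfolding matrix_coords_def by blast
qed

lemma bethe_tau_commute_closure:
  fixes t :: "nat \<Rightarrow> 'm::finite \<Rightarrow> 'm \<Rightarrow> 'v::complex_alg" and blk :: "'m \<Rightarrow> 'i"
  assumes X: "X \<in> wonderful_compactification blk \<rho>G G"
    and G: "\<And>C. C \<in> G \<Longrightarrow>
      bethe_tau t blk i (\<rho>G C) r * bethe_tau t blk j (\<rho>G C) s =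
      bethe_tau t blk j (\<rho>G C) s * bethe_tau t blk i (\<rho>G C) r"
    and M: "M \<in> X i" "M \<noteq> 0" and N: "N \<in> X j" "N \<noteq> 0"
  shows "bethe_tau t blk i M r * bethe_tau t blk j N s = bethe_tau t blk j N s * bethe_tau t blk i M r"
proof (rule ccontr)
  let ?c = "bethe_tau t blk i M r * bethe_tau t blk j N s - bethe_tau t blk j N s * bethe_tau t blk i M r"
  assume "\<not> ?thesis"
  then have "?c \<notin> {0}" by simp
  \<comment> \<open>One functional detects the supposed nonzero commutator at X; applied to the
    general commutator it yields a single scalar multihomogeneous equation.\<close>
  then obtain g :: "'v \<Rightarrow> complex" where g: "clinear g" "g ?c = 1"
    using separating_functional[OF cv.subspace_single_0] by blast
  define V where "V i r x = (\<Sum>a | blk a = i. \<Sum>b | blk b = i. x (i, a, b) *\<^sub>C t r b a)"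
    for i r and x :: "'i \<times> 'm \<times> 'm \<Rightarrow> complex"
  have V: "vec_multihom fst (\<lambda>l. if l = i then 1 else 0) (V i r)" for i r
  proof -
    have coord: "multihom fst (\<lambda>l. if l = i then 1 else 0) (\<lambda>x. x (i, a, b))" for a b
      using multihom_coord[of fst "(i, a, b)"] by simp
    show ?thesis
      unfolding V_def by (intro vec_multihom_sum[OF finite coord] vec_multihom_scale coord)
  qed
  have V_eq: "V i r x = bethe_tau t blk i (N i) r"
    if "\<forall>i. N i \<in> Y i \<and> N i \<noteq> 0 \<and> (\<forall>a b. x (i, a, b) = N i $ a $ b)" for x N Y i r
    using that unfolding V_def bethe_tau_def by simp
  have "multihom fst (\<lambda>l. (if l = i then 1 else 0) + (if l = j then 1 else 0)) (\<lambda>x. g (V i r x * V j s x))"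
    by (intro vec_multihom_functional[OF vec_multihom_mult[OF V V] g(1)])
  \<comment> \<open>The degree of this product arrives with the summands for i and j interchanged;
    both products need the same degree function before they can be subtracted.\<close>
  moreover have "multihom fst (\<lambda>l. (if l = i then 1 else 0) + (if l = j then 1 else 0)) (\<lambda>x. g (V j s x * V i r x))"
    using vec_multihom_functional[OF vec_multihom_mult[OF V[of j s] V[of i r]] g(1)]
    by (subst add.commute)
  ultimately have F: "multihom fst (\<lambda>l. (if l = i then 1 else 0) + (if l = j then 1 else 0))
      (\<lambda>x. g (V i r x * V j s x) - g (V j s x * V i r x))"
    by (rule multihom_diff)
  have "\<exists>x\<in>matrix_coords X. g (V i r x * V j s x) - g (V j s x * V i r x) = 0"
  proof (rule zariski_closure_zero[OF X[unfolded wonderful_compactification_def] F])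
    fix Y assume "Y \<in> proj_point blk \<rho>G ` G" "Y \<in> {X. \<forall>i. X i \<in> proj_space (blk_End blk i)}"
    then obtain C where C: "C \<in> G" "Y = proj_point blk \<rho>G C"
      and Y: "\<forall>i. Y i \<in> proj_space (blk_End blk i)" by blast
    obtain x where x: "x \<in> matrix_coords Y" using matrix_coords_nonempty[OF Y] by blast
    obtain K where K: "\<forall>i. K i \<in> Y i \<and> K i \<noteq> 0 \<and> (\<forall>a b. x (i, a, b) = K i $ a $ b)"
      using matrix_coordsD[OF x] by blast
    have "\<exists>c. K i = c *\<^sub>C blk_part blk i (\<rho>G C)" for i
      using K unfolding C(2) proj_point_def by blast
    then obtain c where c: "\<And>i. K i = c i *\<^sub>C blk_part blk i (\<rho>G C)" by metis
    have "V i r x * V j s x = V j s x * V i r x"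
      unfolding V_eq[OF K] c bethe_tau_scale bethe_tau_blk_part
      using G[OF C(1)] by (simp add: scaleC_mult_left scaleC_mult_right scaleC_scaleC mult.commute)
    then show "\<exists>x\<in>matrix_coords Y. g (V i r x * V j s x) - g (V j s x * V i r x) = 0"
      by (intro bexI[OF _ x]) simp
  qed
  then obtain x where x: "x \<in> matrix_coords X"
    and zero: "g (V i r x * V j s x) - g (V j s x * V i r x) = 0" by blast
  obtain K where K: "\<forall>i. K i \<in> X i \<and> K i \<noteq> 0 \<and> (\<forall>a b. x (i, a, b) = K i $ a $ b)"
    using matrix_coordsD[OF x] by blast
  obtain c where c: "c \<noteq> 0" "K i = c *\<^sub>C M"
    using proj_space_scalar[OF wonderful_proj_space[OF X], of "K i" i M] K M by blast
  obtain d where d: "d \<noteq> 0" "K j = d *\<^sub>C N"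
    using proj_space_scalar[OF wonderful_proj_space[OF X], of "K j" j N] K N by blast
  \<comment> \<open>The coordinates come from K i and K j instead of the given M and N; this changes
    the commutator by the nonzero factor c d.\<close>
  have "V i r x * V j s x - V j s x * V i r x = (c * d) *\<^sub>C ?c"
    unfolding V_eq[OF K] c d bethe_tau_scale
    by (simp add: scaleC_mult_left scaleC_mult_right scaleC_scaleC cv.scale_right_diff_distrib mult.commute)
  moreover have "g (u - w) = g u - g w" for u w
    using clinear_add[OF g(1), of "u - w" w] by simp
  ultimately have "(c * d) *\<^sub>C g ?c = 0"
    using zero clinear_scale[OF g(1), of "c * d" ?c] by metis
  then show False using g(2) c(1) d(1) by (simp add: scaleC_complex_def)
qed

lemma bethe_bar_commute:
  fixes t :: "nat \<Rightarrow> 'm::finite \<Rightarrow> 'm \<Rightarrow> 'v::complex_alg" and blk :: "'m \<Rightarrow> 'i"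
  assumes "X \<in> wonderful_compactification blk \<rho>G G"
    and "\<And>C i j r s. C \<in> G \<Longrightarrow>
      bethe_tau t blk i (\<rho>G C) r * bethe_tau t blk j (\<rho>G C) s =
      bethe_tau t blk j (\<rho>G C) s * bethe_tau t blk i (\<rho>G C) r"
    and "x \<in> bethe_bar t blk X" "y \<in> bethe_bar t blk X"
  shows "x * y = y * x"
  using assms(3,4) unfolding bethe_bar_def
proof (rule subalg_commute[rotated])
  fix x y assume x: "x \<in> {bethe_tau t blk i M r |i r M. M \<in> X i \<and> M \<noteq> 0}"
    and y: "y \<in> {bethe_tau t blk i M r |i r M. M \<in> X i \<and> M \<noteq> 0}"
  obtain i r M where "x = bethe_tau t blk i M r" "M \<in> X i" "M \<noteq> 0" using x by blast
  moreover obtain j s N where "y = bethe_tau t blk j N s" "N \<in> X j" "N \<noteq> 0" using y by blast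
  ultimately show "x * y = y * x" using bethe_tau_commute_closure[OF assms(1,2)] by simp
qed

section \<open>Traces of the RTT relation\<close>

lemma clinear_feval: "clinear (feval g)"
  unfolding feval_def by (rule clinear_lin_ext)

lemma feval_single: "feval g (Poly_Mapping.single w c) = c *\<^sub>C prod_list (map g (letters w))"
  unfolding feval_def by (rule lin_ext_single)

lemma feval_mult: "feval g (p * q) = feval g p * feval g q"
proof (induction p rule: poly_mapping_single_induct)
  case (single u a)
  show ?case
  proof (induction q rule: poly_mapping_single_induct)
    case (single v b)
    show ?case
      by (simp add: mult_single feval_single plus_fmon_def scaleC_mult_left scaleC_mult_right scaleC_scaleC mult.commute)
  next
    case (add p q)
    then show ?case by (simp add: distrib_left clinear_add[OF clinear_feval])
  qed
next
  case (add p q)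
  then show ?case by (simp add: distrib_right clinear_add[OF clinear_feval])
qed

lemma feval_one: "feval g 1 = 1"
  unfolding single_one[symmetric] feval_single by (simp add: zero_fmon_def scaleC_one)

lemma feval_var: "feval g (var x) = g x"
  by (simp add: var_def feval_single scaleC_one)

lemma feval_zero: "feval g 0 = 0"
  using clinear_scale[OF clinear_feval, of g 0 0] by simp

lemma feval_sum: "feval g (\<Sum>i\<in>A. p i) = (\<Sum>i\<in>A. feval g (p i))"
  using clinear_sum[OF clinear_feval, of g "\<lambda>_. 1" p A] by (simp add: scaleC_one)

lemma feval_diff: "feval g (p - q) = feval g p - feval g q"
  using clinear_add[OF clinear_feval, of g "p - q" q] by (simp add: algebra_simps)

lemma presents_rel: "presents g Rel \<Longrightarrow> p \<in> Rel \<Longrightarrow> feval g p = 0"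
  using ideal_incl[of p Rel 1 1] by (simp add: presents_def)

lemma feval_t_gen:
  assumes "\<forall>a b. t 0 a b = (if a = b then 1 else 0)"
  shows "feval (\<lambda>(k, a, b). t (k + 1) a b) (t_gen r a b) = t r a b"
  by (cases r) (simp_all add: t_gen_def feval_var feval_one feval_zero assms)

lemma inv_diff_coeff_0: "inv_diff_coeff 0 m = (if m = 0 then 1 else 0)"
  by (cases m) (simp_all add: inv_diff_coeff_def gbinomial_Suc)

text \<open>Comparison of coefficients in \<open>(u - v)\<^sup>-\<^sup>j (u - v)\<^sup>-\<^sup>k = (u - v)\<^sup>-\<^sup>j\<^sup>-\<^sup>k\<close>.\<close>
lemma inv_diff_coeff_add:
  "(\<Sum>l\<le>m. inv_diff_coeff j l * inv_diff_coeff k (m - l)) = inv_diff_coeff (j + k) m"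
proof -
  have "(\<Sum>l\<le>m. inv_diff_coeff j l * inv_diff_coeff k (m - l)) =
      (\<Sum>l\<le>m. (-1) ^ m * (((- of_nat j) gchoose l) * ((- of_nat k) gchoose (m - l))))"
    by (intro sum.cong) (auto simp: inv_diff_coeff_def power_add[symmetric])
  also have "\<dots> = (-1) ^ m * ((- of_nat j + - of_nat k) gchoose m)"
    unfolding sum_distrib_left[symmetric] gbinomial_Vandermonde[symmetric] atMost_atLeast0 ..
  finally show ?thesis by (simp add: inv_diff_coeff_def)
qed

lemma finite_triangle: "finite {(j, l). j + l \<le> (p::nat)}"
  by (rule finite_subset[of _ "{..p} \<times> {..p}"]) auto

text \<open>Groups a product of two expansions by the total powers n = j + k and \<mu> = l + m. The
  truncated subtraction p - j - l is exact because j + l \<le> p.\<close>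

lemma sum_convolution:
  fixes F :: "nat \<Rightarrow> nat \<Rightarrow> nat \<Rightarrow> nat \<Rightarrow> 'a::comm_monoid_add"
  shows "(\<Sum>(j, l)\<in>{(j, l). j + l \<le> p}. \<Sum>(k, m)\<in>{(k, m). k + m \<le> p - j - l}. F j k l m) =
    (\<Sum>(n, \<mu>)\<in>{(n, \<mu>). n + \<mu> \<le> p}. \<Sum>j\<le>n. \<Sum>l\<le>\<mu>. F j (n - j) l (\<mu> - l))"
proof -
  have fin: "finite {jl. fst jl + snd jl \<le> (q::nat)}" for q
    using finite_triangle[of q] by (simp add: split_def)
  let ?A = "SIGMA jl:{(j, l). j + l \<le> p}. {(k, m). k + m \<le> p - fst jl - snd jl}"
  let ?B = "SIGMA nm:{(n, \<mu>). n + \<mu> \<le> p}. {..fst nm} \<times> {..snd nm}"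
  have "(\<Sum>(j, l)\<in>{(j, l). j + l \<le> p}. \<Sum>(k, m)\<in>{(k, m). k + m \<le> p - j - l}. F j k l m) =
      (\<Sum>((j, l), (k, m))\<in>?A. F j k l m)"
    by (subst sum.Sigma[symmetric]) (auto simp: fin split_def)
  also have "\<dots> = (\<Sum>((n, \<mu>), (j, l))\<in>?B. F j (n - j) l (\<mu> - l))"
    by (rule sum.reindex_bij_witness[where
          i = "\<lambda>((n, \<mu>), (j, l)). ((j, l), (n - j, \<mu> - l))" and
          j = "\<lambda>((j, l), (k, m)). ((j + k, l + m), (j, l))"]) auto
  also have "\<dots> = (\<Sum>(n, \<mu>)\<in>{(n, \<mu>). n + \<mu> \<le> p}. \<Sum>j\<le>n. \<Sum>l\<le>\<mu>. F j (n - j) l (\<mu> - l))"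
    by (subst sum.Sigma[symmetric]) (auto simp: fin split_def sum.cartesian_product)
  finally show ?thesis .
qed

text \<open>\<open>trace_T1_T2 t Z P Q\<close> is the coefficient of \<open>u\<^sup>-\<^sup>P v\<^sup>-\<^sup>Q\<close> in the trace of \<open>Z T\<^sub>1(u) T\<^sub>2(v)\<close>, and
  \<open>trace_T2_T1\<close> the one for \<open>Z T\<^sub>2(v) T\<^sub>1(u)\<close>.\<close>
definition trace_T1_T2 ::
  "(nat \<Rightarrow> 'm \<Rightarrow> 'm \<Rightarrow> 'v::complex_alg) \<Rightarrow> complex ^ ('m \<times> 'm) ^ ('m \<times> 'm::finite) \<Rightarrow> nat \<Rightarrow> int \<Rightarrow> 'v" where
  "trace_T1_T2 t Z P Q = (if Q < 0 then 0 else
     \<Sum>x\<in>UNIV. \<Sum>y\<in>UNIV. Z $ y $ x *\<^sub>C (t P (fst x) (fst y) * t (nat Q) (snd x) (snd y)))"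

definition trace_T2_T1 ::
  "(nat \<Rightarrow> 'm \<Rightarrow> 'm \<Rightarrow> 'v::complex_alg) \<Rightarrow> complex ^ ('m \<times> 'm) ^ ('m \<times> 'm::finite) \<Rightarrow> nat \<Rightarrow> int \<Rightarrow> 'v" where
  "trace_T2_T1 t Z P Q = (if Q < 0 then 0 else
     \<Sum>x\<in>UNIV. \<Sum>y\<in>UNIV. Z $ y $ x *\<^sub>C (t (nat Q) (snd x) (snd y) * t P (fst x) (fst y)))"

lemma trace_add:
  "trace_T1_T2 t (Z + W) P Q = trace_T1_T2 t Z P Q + trace_T1_T2 t W P Q"
  "trace_T2_T1 t (Z + W) P Q = trace_T2_T1 t Z P Q + trace_T2_T1 t W P Q"
  by (simp_all add: trace_T1_T2_def trace_T2_T1_def scaleC_add_left sum.distrib)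

lemma trace_zero: "trace_T1_T2 t 0 P Q = 0" "trace_T2_T1 t 0 P Q = 0"
  by (simp_all add: trace_T1_T2_def trace_T2_T1_def)

lemma trace_sum:
  "trace_T1_T2 t (\<Sum>i\<in>A. Z i) P Q = (\<Sum>i\<in>A. trace_T1_T2 t (Z i) P Q)"
  "trace_T2_T1 t (\<Sum>i\<in>A. Z i) P Q = (\<Sum>i\<in>A. trace_T2_T1 t (Z i) P Q)"
  by (induction A rule: infinite_finite_induct; simp add: trace_add trace_zero)+

text \<open>The RTT relation is multiplied by the scalar matrix Z and traced. The entries of T(u)
  and T(v) do not commute, but the complex entries of R and Z commute with everything, so in the
  second term R may be moved cyclically in front of Z.\<close>

lemma trace_relation:
  fixes R :: "nat \<Rightarrow> complex ^ ('m \<times> 'm) ^ ('m \<times> 'm::finite)"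
  assumes "is_RTT_yangian (\<lambda>k x y. R k $ x $ y) cg t"
  shows "(\<Sum>(k, m)\<in>{(k, m). k + m \<le> p}. inv_diff_coeff k m *\<^sub>C
      (trace_T1_T2 t (Z ** R k) (p - k - m) (q + int m) - trace_T2_T1 t (R k ** Z) (p - k - m) (q + int m))) = 0"
proof -
  have t0: "\<forall>a b. t 0 a b = (if a = b then 1 else 0)" using assms by (simp add: is_RTT_yangian_def)
  define g where "g = (\<lambda>(k, a, b). t (k + 1) a b)"
  have gen: "feval g (t_gen r a b) = t r a b" for r a b
    unfolding g_def by (rule feval_t_gen[where t = t, OF t0])
  let ?Rc = "\<lambda>k x y. R k $ x $ y"
  define I where "I = {(k, m). k + m \<le> p \<and> 0 \<le> q + int m}"
  define E where "E k m x y = (\<Sum>x'\<in>UNIV.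
      R k $ x $ x' *\<^sub>C (t (p - k - m) (fst x') (fst y) * t (nat (q + int m)) (snd x') (snd y))
      - R k $ x' $ y *\<^sub>C (t (nat (q + int m)) (snd x) (snd x') * t (p - k - m) (fst x) (fst x')))" for k m x y
  have rel: "(\<Sum>(k, m)\<in>I. inv_diff_coeff k m *\<^sub>C E k m x y) = 0" for x y
  proof -
    have "feval g (rtt_rel ?Rc (fst x) (snd x) (fst y) (snd y) p q) = 0"
      using assms unfolding is_RTT_yangian_def g_def by (elim conjE presents_rel) blast
    then show ?thesis
      unfolding rtt_rel_def feval_sum I_def E_def UNIV_Times_UNIV[symmetric]
      by (simp add: split_def feval_sum feval_diff feval_mult clinear_scale[OF clinear_feval]
          gen sum.cartesian_product)
  qed
  have contract: "(\<Sum>x\<in>UNIV. \<Sum>y\<in>UNIV. Z $ y $ x *\<^sub>C E k m x y) =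
      trace_T1_T2 t (Z ** R k) (p - k - m) (q + int m) - trace_T2_T1 t (R k ** Z) (p - k - m) (q + int m)"
    if "0 \<le> q + int m" for k m
  proof -
    let ?L = "\<lambda>x y. t (p - k - m) (fst x) (fst y) * t (nat (q + int m)) (snd x) (snd y)"
    let ?L' = "\<lambda>x y. t (nat (q + int m)) (snd x) (snd y) * t (p - k - m) (fst x) (fst y)"
    have "(\<Sum>x\<in>UNIV. \<Sum>y\<in>UNIV. Z $ y $ x *\<^sub>C E k m x y) =
        (\<Sum>x\<in>UNIV. \<Sum>y\<in>UNIV. \<Sum>x'\<in>UNIV. (Z $ y $ x * R k $ x $ x') *\<^sub>C ?L x' y)
        - (\<Sum>x\<in>UNIV. \<Sum>y\<in>UNIV. \<Sum>x'\<in>UNIV. (Z $ y $ x * R k $ x' $ y) *\<^sub>C ?L' x x')"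
      by (simp add: E_def cv.scale_sum_right cv.scale_right_diff_distrib scaleC_scaleC sum_subtractf)
    also have "(\<Sum>x\<in>UNIV. \<Sum>y\<in>UNIV. \<Sum>x'\<in>UNIV. (Z $ y $ x * R k $ x $ x') *\<^sub>C ?L x' y) =
        (\<Sum>x'\<in>UNIV. \<Sum>y\<in>UNIV. (Z ** R k) $ y $ x' *\<^sub>C ?L x' y)"
      unfolding matrix_matrix_mult_def
      by (simp add: cv.scale_sum_left, subst sum.swap, subst (2) sum.swap, subst sum.swap, simp)
    also have "(\<Sum>x\<in>UNIV. \<Sum>y\<in>UNIV. \<Sum>x'\<in>UNIV. (Z $ y $ x * R k $ x' $ y) *\<^sub>C ?L' x x') =
        (\<Sum>x\<in>UNIV. \<Sum>x'\<in>UNIV. (R k ** Z) $ x' $ x *\<^sub>C ?L' x x')"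
      unfolding matrix_matrix_mult_def
      by (simp add: cv.scale_sum_left mult.commute, subst (2) sum.swap, simp)
    finally show ?thesis using that by (simp add: trace_T1_T2_def trace_T2_T1_def)
  qed
  \<comment> \<open>Pairs with q + m < 0 may be included: both traces are 0 there by convention, as
    T(v) has no positive powers of v.\<close>
  have "(\<Sum>(k, m)\<in>{(k, m). k + m \<le> p}. inv_diff_coeff k m *\<^sub>C
      (trace_T1_T2 t (Z ** R k) (p - k - m) (q + int m) - trace_T2_T1 t (R k ** Z) (p - k - m) (q + int m))) =
    (\<Sum>(k, m)\<in>I. inv_diff_coeff k m *\<^sub>C
      (trace_T1_T2 t (Z ** R k) (p - k - m) (q + int m) - trace_T2_T1 t (R k ** Z) (p - k - m) (q + int m)))"
    unfolding I_def
    by (rule sum.mono_neutral_right[OF finite_triangle]) (auto simp: trace_T1_T2_def trace_T2_T1_def split: if_splits)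
  also have "\<dots> = (\<Sum>(k, m)\<in>I. \<Sum>x\<in>UNIV. \<Sum>y\<in>UNIV. Z $ y $ x *\<^sub>C inv_diff_coeff k m *\<^sub>C E k m x y)"
  proof (intro sum.cong refl, clarify)
    fix k m assume "(k, m) \<in> I"
    then have m: "0 \<le> q + int m" by (simp add: I_def)
    show "inv_diff_coeff k m *\<^sub>C
        (trace_T1_T2 t (Z ** R k) (p - k - m) (q + int m) - trace_T2_T1 t (R k ** Z) (p - k - m) (q + int m)) =
        (\<Sum>x\<in>UNIV. \<Sum>y\<in>UNIV. Z $ y $ x *\<^sub>C inv_diff_coeff k m *\<^sub>C E k m x y)"
      unfolding contract[OF m, symmetric] by (simp add: cv.scale_sum_right scaleC_scaleC mult.commute)
  qed
  also have "\<dots> = (\<Sum>x\<in>UNIV. \<Sum>y\<in>UNIV. Z $ y $ x *\<^sub>C (\<Sum>(k, m)\<in>I. inv_diff_coeff k m *\<^sub>C E k m x y))"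
    by (simp add: split_def cv.scale_sum_right sum.swap[of _ I])
  finally show ?thesis by (simp add: rel)
qed

text \<open>The trace of \<open>K T\<^sub>1(u) T\<^sub>2(v) = K R(u - v)\<inverse> T\<^sub>2(v) T\<^sub>1(u) R(u - v)\<close> is that of \<open>K T\<^sub>2(v) T\<^sub>1(u)\<close> when
  \<open>R(u - v)\<close> commutes with \<open>K\<close>.\<close>
lemma trace_T1_T2_commute:
  fixes R S :: "nat \<Rightarrow> complex ^ ('m \<times> 'm) ^ ('m \<times> 'm::finite)"
  assumes rtt: "is_RTT_yangian (\<lambda>k x y. R k $ x $ y) cg t"
    and K: "\<And>k. R k ** K = K ** R k"
    and SR: "\<And>n. (\<Sum>j\<le>n. S j ** R (n - j)) = (if n = 0 then mat 1 else 0)"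
    and RS: "\<And>n. (\<Sum>j\<le>n. R (n - j) ** S j) = (if n = 0 then mat 1 else 0)"
  shows "trace_T1_T2 t K p q = trace_T2_T1 t K p q"
proof -
  \<comment> \<open>The factors S and R stand in the order in which they occur on each side, S R
    with T_1 T_2 and R S with T_2 T_1; both convolutions collapse because S is a two-sided
    inverse.\<close>
  define G where "G j k P Q = trace_T1_T2 t (K ** (S j ** R k)) P Q - trace_T2_T1 t (K ** (R k ** S j)) P Q" for j k P Q
  have G_sum: "(\<Sum>j\<le>n. G j (n - j) P Q) = (if n = 0 then trace_T1_T2 t K P Q - trace_T2_T1 t K P Q else 0)" for n P Q
  proof -
    have distr: "(\<Sum>j\<le>n. K ** X j) = K ** (\<Sum>j\<le>n. X j)" for X :: "nat \<Rightarrow> complex ^ ('m \<times> 'm) ^ ('m \<times> 'm)"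
      by (induction n) (simp_all add: matrix_add_ldistrib)
    show ?thesis
      unfolding G_def sum_subtractf trace_sum[symmetric] distr SR RS
      by (simp add: trace_zero)
  qed
  \<comment> \<open>This is the term u^(-j-l) v^l of (u - v)^(-j) times the relation traced with Z =
    K S_j. Moving R_k past K brings it to the form G.\<close>
  have "(\<Sum>(k, m)\<in>{(k, m). k + m \<le> p - j - l}. (inv_diff_coeff j l * inv_diff_coeff k m) *\<^sub>C
      G j k (p - (j + k) - (l + m)) (q + int (l + m))) = 0" for j l
  proof -
    have "R k ** (K ** S j) = K ** (R k ** S j)" "K ** S j ** R k = K ** (S j ** R k)" for k
      by (simp_all add: matrix_mul_assoc K)
    then have "inv_diff_coeff j l *\<^sub>C (\<Sum>(k, m)\<in>{(k, m). k + m \<le> p - j - l}. inv_diff_coeff k m *\<^sub>C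
        G j k (p - j - l - k - m) (q + int l + int m)) = 0"
      using trace_relation[OF rtt, where p = "p - j - l" and Z = "K ** S j" and q = "q + int l"] by (simp add: G_def)
    then show ?thesis
      by (simp add: cv.scale_sum_right split_def scaleC_scaleC algebra_simps diff_diff_left)
  qed
  then have "0 = (\<Sum>(j, l)\<in>{(j, l). j + l \<le> p}. \<Sum>(k, m)\<in>{(k, m). k + m \<le> p - j - l}.
      (inv_diff_coeff j l * inv_diff_coeff k m) *\<^sub>C G j k (p - (j + k) - (l + m)) (q + int (l + m)))"
    by simp
  also have "\<dots> = (\<Sum>(n, \<mu>)\<in>{(n, \<mu>). n + \<mu> \<le> p}. \<Sum>j\<le>n. \<Sum>l\<le>\<mu>.
      (inv_diff_coeff j l * inv_diff_coeff (n - j) (\<mu> - l)) *\<^sub>C G j (n - j) (p - n - \<mu>) (q + int \<mu>))"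
    unfolding sum_convolution by (intro sum.cong) auto
  also have "\<dots> = (\<Sum>(n, \<mu>)\<in>{(n, \<mu>). n + \<mu> \<le> p}. inv_diff_coeff n \<mu> *\<^sub>C
      (\<Sum>j\<le>n. G j (n - j) (p - n - \<mu>) (q + int \<mu>)))"
    unfolding cv.scale_sum_left[symmetric] inv_diff_coeff_add cv.scale_sum_right
    by (intro sum.cong) auto
  \<comment> \<open>For n > 0 the inner sum is 0, and for n = 0 the expansion of (u - v)^0 = 1
    leaves only \<mu> = 0.\<close>
  also have "\<dots> = (\<Sum>x\<in>{(n, \<mu>). n + \<mu> \<le> p}. if x = (0, 0) then trace_T1_T2 t K p q - trace_T2_T1 t K p q else 0)"
    by (intro sum.cong) (auto simp: G_sum inv_diff_coeff_0 scaleC_one split: if_splits)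
  also have "\<dots> = trace_T1_T2 t K p q - trace_T2_T1 t K p q"
    using finite_triangle by (simp add: sum.delta)
  finally show ?thesis by simp
qed

section \<open>The R-matrix and tensor products of representations\<close>

lemma tens_add_left: "(a + a') \<otimes>\<^sub>t b = a \<otimes>\<^sub>t b + a' \<otimes>\<^sub>t b"
  by transfer (auto simp: tensor_null_def diff_diff_eq[symmetric] intro!: cv.span_base bilin_relsI)

lemma tens_add_right: "a \<otimes>\<^sub>t (b + b') = a \<otimes>\<^sub>t b + a \<otimes>\<^sub>t b'"
  by transfer (auto simp: tensor_null_def diff_diff_eq[symmetric] intro!: cv.span_base bilin_relsI)

lemma tens_scale_left: "(c *\<^sub>C a) \<otimes>\<^sub>t b = c *\<^sub>C (a \<otimes>\<^sub>t b)"
  by transfer (auto simp: tensor_null_def intro!: cv.span_base bilin_relsI)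

lemma tens_scale_right: "a \<otimes>\<^sub>t (c *\<^sub>C b) = c *\<^sub>C (a \<otimes>\<^sub>t b)"
  by transfer (auto simp: tensor_null_def intro!: cv.span_base bilin_relsI)

lemma abs_tensor_cases:
  obtains p where "s = abs_tensor p"
  using Quotient3_abs_rep[OF Quotient3_tensor] by metis

text \<open>\<open>tensor_lift\<close> is computed on a chosen representative of a tensor, so even
  additivity rests on the bilinearity of \<beta>.\<close>

lemma tensor_lift_add:
  assumes "\<And>b. clinear (\<lambda>a. \<beta> a b)" "\<And>a. clinear (\<beta> a)"
  shows "tensor_lift \<beta> (s + s') = tensor_lift \<beta> s + tensor_lift \<beta> s'"
proof -
  obtain p q where "s = abs_tensor p" "s' = abs_tensor q" by (metis abs_tensor_cases)
  then show ?thesis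
    by (simp add: plus_tensor.abs_eq tensor_lift_abs[OF assms] clinear_add[OF clinear_lin_ext])
qed

lemma fls_nth_scaleC: "fls_nth (c *\<^sub>C f) k = c *\<^sub>C fls_nth f k"
  by (simp add: scaleC_fls_def scaleC_mult_left)

lemma id_tensor_shift_primitive:
  assumes "calg_hom \<tau>" "\<tau> x = fls_const x"
  shows "id_tensor_shift \<tau> (x \<otimes>\<^sub>t 1 + 1 \<otimes>\<^sub>t x) = fls_const (x \<otimes>\<^sub>t 1 + 1 \<otimes>\<^sub>t x)"
proof -
  have lin: "clinear \<tau>" and one: "\<tau> 1 = 1" using assms by (auto simp: calg_hom_def)
  have bil: "clinear (\<lambda>a. a \<otimes>\<^sub>t fls_nth (\<tau> b) k)" "clinear (\<lambda>b. a \<otimes>\<^sub>t fls_nth (\<tau> b) k)" for a b k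
    by (auto intro!: clinearI simp: tens_add_left tens_add_right tens_scale_left tens_scale_right
        clinear_add[OF lin] clinear_scale[OF lin] fls_nth_scaleC)
  have zero: "a \<otimes>\<^sub>t 0 = 0" for a :: 'a
    using tens_scale_right[of a 0 0] by simp
  have "tensor_lift (\<lambda>a b. a \<otimes>\<^sub>t fls_nth (\<tau> b) k) (x \<otimes>\<^sub>t 1 + 1 \<otimes>\<^sub>t x) =
      fls_nth (fls_const (x \<otimes>\<^sub>t 1 + 1 \<otimes>\<^sub>t x)) k" for k
    by (simp add: tensor_lift_add[OF bil] tensor_lift_tens[OF bil] assms(2) one zero)
  then show ?thesis unfolding id_tensor_shift_def by (simp only: fls_nth_inverse)
qed

lemma universal_R_primitive:
  fixes inc :: "'g::complex_lie \<Rightarrow> 'y::complex_alg"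
  assumes cop: "is_coproduct form inc J \<Delta>" and shift: "is_shift inc J \<tau>" and R: "is_universal_R \<Delta> \<tau> Rhat"
  shows "fps_nth Rhat k * (inc x \<otimes>\<^sub>t 1 + 1 \<otimes>\<^sub>t inc x) = (inc x \<otimes>\<^sub>t 1 + 1 \<otimes>\<^sub>t inc x) * fps_nth Rhat k"
proof -
  let ?D = "inc x \<otimes>\<^sub>t 1 + 1 \<otimes>\<^sub>t inc x"
  have D: "\<Delta> (inc x) = ?D" using cop by (simp add: is_coproduct_def)
  have \<tau>: "calg_hom \<tau>" "\<tau> (inc x) = fls_const (inc x)" using shift by (auto simp: is_shift_def)
  have bil: "clinear (\<lambda>a. b \<otimes>\<^sub>t a)" "clinear (\<lambda>b. b \<otimes>\<^sub>t a)" for a b :: 'y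
    by (auto intro!: clinearI simp: tens_add_left tens_add_right tens_scale_left tens_scale_right)
  have "tensor_lift (\<lambda>a b. b \<otimes>\<^sub>t a) ?D = ?D"
    by (simp add: tensor_lift_add[OF bil] tensor_lift_tens[OF bil] add.commute)
  moreover have "fps_to_fls Rhat * id_tensor_shift \<tau> (tensor_lift (\<lambda>a b. b \<otimes>\<^sub>t a) (\<Delta> (inc x))) =
      id_tensor_shift \<tau> (\<Delta> (inc x)) * fps_to_fls Rhat"
    using R by (simp add: is_universal_R_def)
  ultimately have "fps_to_fls Rhat * fls_const ?D = fls_const ?D * fps_to_fls Rhat"
    by (simp only: D id_tensor_shift_primitive[OF \<tau>])
  \<comment> \<open>Multiplication by a constant series does not mix powers of u, so the identity
    splits into one commutation relation for each coefficient.\<close>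
  then have "fls_nth (fps_to_fls Rhat * fls_const ?D) (int k) = fls_nth (fls_const ?D * fps_to_fls Rhat) (int k)"
    by simp
  then show ?thesis by simp
qed

section \<open>Matrices of the tensor square of a representation\<close>

definition tensor_matrix ::
  "('y::complex_alg \<Rightarrow> complex ^ 'm ^ 'm::finite) \<Rightarrow> ('y, 'y) tensor \<Rightarrow> complex ^ ('m \<times> 'm) ^ ('m \<times> 'm)" where
  "tensor_matrix \<rho> s = (\<chi> p q. tensor_lift (\<lambda>x y. \<rho> x $ fst p $ fst q * \<rho> y $ snd p $ snd q) s)"

definition kron :: "complex ^ 'm ^ 'm \<Rightarrow> complex ^ 'm ^ 'm \<Rightarrow> complex ^ ('m \<times> 'm) ^ ('m \<times> 'm::finite)" where
  "kron A B = (\<chi> p q. A $ fst p $ fst q * B $ snd p $ snd q)"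

lemma kron_mult: "kron A B ** kron A' B' = kron (A ** A') (B ** B')"
  unfolding kron_def matrix_matrix_mult_def Finite_Cartesian_Product.vec_eq_iff
  by (simp add: sum_product sum.cartesian_product UNIV_Times_UNIV[symmetric] split_def algebra_simps
      del: UNIV_Times_UNIV)

lemma kron_one: "kron (mat 1) (mat 1) = mat 1"
  by (auto simp: kron_def Finite_Cartesian_Product.mat_def Finite_Cartesian_Product.vec_eq_iff prod_eq_iff)

lemma matrix_scale_mult: "(c *\<^sub>C A) ** (d *\<^sub>C B) = (c * d) *\<^sub>C (A ** B)"
  for A :: "complex ^ 'n ^ 'm" and B :: "complex ^ 'p ^ 'n"
  by (simp add: matrix_matrix_mult_def scaleC_vec_def scaleC_complex_def
      Finite_Cartesian_Product.vec_eq_iff sum_distrib_left algebra_simps)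

lemma matrix_add_rdistrib: "(A + B) ** C = A ** C + B ** C"
  by (simp add: matrix_matrix_mult_def Finite_Cartesian_Product.vec_eq_iff sum.distrib distrib_right)

context
  fixes \<rho> :: "'y::complex_alg \<Rightarrow> complex ^ 'm ^ 'm::finite"
  assumes rep: "is_matrix_rep \<rho>"
begin

lemma rep_bilinear:
  "clinear (\<lambda>x. \<rho> x $ a $ b * \<rho> y $ c $ d)" "clinear (\<lambda>y. \<rho> x $ a $ b * \<rho> y $ c $ d)"
proof -
  have lin: "clinear \<rho>" using rep by (simp add: is_matrix_rep_def)
  show "clinear (\<lambda>x. \<rho> x $ a $ b * \<rho> y $ c $ d)" "clinear (\<lambda>y. \<rho> x $ a $ b * \<rho> y $ c $ d)"
    by (rule clinearI; simp add: clinear_add[OF lin] clinear_scale[OF lin] scaleC_vec_def scaleC_complex_def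
        algebra_simps)+
qed

lemma tensor_matrix_add: "tensor_matrix \<rho> (s + s') = tensor_matrix \<rho> s + tensor_matrix \<rho> s'"
  by (simp add: tensor_matrix_def Finite_Cartesian_Product.vec_eq_iff tensor_lift_add[OF rep_bilinear])

lemma tensor_matrix_tens: "tensor_matrix \<rho> (x \<otimes>\<^sub>t y) = kron (\<rho> x) (\<rho> y)"
  by (simp add: tensor_matrix_def kron_def Finite_Cartesian_Product.vec_eq_iff tensor_lift_tens[OF rep_bilinear])

lemma tensor_matrix_one: "tensor_matrix \<rho> 1 = mat 1"
proof -
  have "(1 :: ('y, 'y) tensor) = 1 \<otimes>\<^sub>t 1"
    by transfer (simp add: zero_pure_def tensor_null_def cv.span_zero flip: single_one)
  moreover have "tensor_matrix \<rho> (1 \<otimes>\<^sub>t 1) = mat 1"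
    using rep unfolding tensor_matrix_tens is_matrix_rep_def by (simp add: kron_one)
  ultimately show ?thesis by simp
qed

lemma tensor_matrix_mult: "tensor_matrix \<rho> (s * s') = tensor_matrix \<rho> s ** tensor_matrix \<rho> s'"
proof -
  let ?T = "\<lambda>p. tensor_matrix \<rho> (abs_tensor p)"
  have T_add: "?T (p + q) = ?T p + ?T q" for p q
    by (simp add: plus_tensor.abs_eq[symmetric] tensor_matrix_add)
  have T_single: "?T (Poly_Mapping.single k c) = c *\<^sub>C kron (\<rho> (pure_fst k)) (\<rho> (pure_snd k))" for k c
    by (simp add: tensor_matrix_def tensor_lift_abs[OF rep_bilinear] lin_ext_single Finite_Cartesian_Product.vec_eq_iff kron_def scaleC_vec_def)
  have "?T (p * q) = ?T p ** ?T q" for p q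
  proof (induction p rule: poly_mapping_single_induct)
    case (single k a)
    show ?case
    proof (induction q rule: poly_mapping_single_induct)
      case (single l b)
      have "\<rho> (x * y) = \<rho> x ** \<rho> y" for x y using rep by (simp add: is_matrix_rep_def)
      then show ?case
        unfolding mult_single T_single matrix_scale_mult kron_mult by (simp add: plus_pure_def)
    next
      case (add q q')
      then show ?case by (simp add: distrib_left T_add matrix_add_ldistrib)
    qed
  next
    case (add p p')
    then show ?case by (simp add: distrib_right T_add matrix_add_rdistrib)
  qed
  moreover obtain p q where "s = abs_tensor p" "s' = abs_tensor q" by (metis abs_tensor_cases)
  ultimately show ?thesis by (simp add: times_tensor.abs_eq)
qed

end

section \<open>Exponentials\<close>

definition mpow :: "complex ^ 'k ^ 'k \<Rightarrow> nat \<Rightarrow> complex ^ 'k ^ 'k::finite" where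
  "mpow A n = ((\<lambda>B. A ** B) ^^ n) (mat 1)"

lemma mpow_0 [simp]: "mpow A 0 = mat 1" and mpow_Suc [simp]: "mpow A (Suc n) = A ** mpow A n"
  by (simp_all add: mpow_def)

lemma mpow_add: "mpow A (m + n) = mpow A m ** mpow A n"
  by (induction m) (simp_all add: matrix_mul_assoc)

lemma mpow_uminus: "mpow (- A) n = (\<chi> a b. (-1) ^ n * mpow A n $ a $ b)"
proof (induction n)
  case (Suc n)
  then show ?case
    by (simp add: matrix_matrix_mult_def Finite_Cartesian_Product.vec_eq_iff sum_distrib_left sum_negf algebra_simps)
qed (simp add: Finite_Cartesian_Product.vec_eq_iff)

text \<open>The exponential is handled entry by entry, so that convergence and Cauchy products are
  those of absolutely summable complex series.\<close>

definition exp_term :: "complex ^ 'k ^ 'k \<Rightarrow> 'k \<Rightarrow> 'k \<Rightarrow> nat \<Rightarrow> complex" where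
  "exp_term A a b n = mpow A n $ a $ b / fact n"

lemma exp_term_0: "exp_term A a b 0 = (if a = b then 1 else 0)"
  by (simp add: exp_term_def Finite_Cartesian_Product.mat_def)

text \<open>The coefficientwise form of the differential equation d/ds exp(sA) = A exp(sA).\<close>

lemma exp_term_Suc: "of_nat (Suc n) * exp_term A a b (Suc n) = (\<Sum>c\<in>UNIV. A $ a $ c * exp_term A c b n)"
proof -
  have "of_nat (Suc n) * exp_term A a b (Suc n) = mpow A (Suc n) $ a $ b / fact n"
    unfolding exp_term_def fact_Suc by (simp del: of_nat_Suc mpow_Suc)
  then show ?thesis
    by (simp add: exp_term_def matrix_matrix_mult_def sum_divide_distrib)
qed

text \<open>The sum of the norms of all entries bounds every row sum, so each multiplication by A
  costs at most this factor.\<close>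

lemma norm_mpow_le: "norm (mpow A n $ a $ b) \<le> (\<Sum>i\<in>UNIV. \<Sum>j\<in>UNIV. norm (A $ i $ j)) ^ n"
proof (induction n arbitrary: a)
  case 0
  show ?case by (simp add: Finite_Cartesian_Product.mat_def)
next
  case (Suc n)
  let ?s = "\<Sum>i\<in>UNIV. \<Sum>j\<in>UNIV. norm (A $ i $ j)"
  have "norm (mpow A (Suc n) $ a $ b) \<le> (\<Sum>c\<in>UNIV. norm (A $ a $ c) * norm (mpow A n $ c $ b))"
    by (simp add: matrix_matrix_mult_def norm_mult[symmetric] norm_sum)
  also have "\<dots> \<le> (\<Sum>c\<in>UNIV. norm (A $ a $ c)) * ?s ^ n"
    unfolding sum_distrib_right by (intro sum_mono mult_left_mono Suc.IH) simp
  also have "(\<Sum>c\<in>UNIV. norm (A $ a $ c)) \<le> ?s"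
    by (rule member_le_sum[of a UNIV "\<lambda>i. \<Sum>j\<in>UNIV. norm (A $ i $ j)"]) (auto intro: sum_nonneg)
  then have "(\<Sum>c\<in>UNIV. norm (A $ a $ c)) * ?s ^ n \<le> ?s * ?s ^ n"
    by (intro mult_right_mono zero_le_power sum_nonneg) auto
  finally show ?case by simp
qed

lemma summable_exp_term: "summable (\<lambda>n. norm (exp_term A a b n))"
proof (rule summable_comparison_test'[where N = 0])
  show "summable (\<lambda>n. (\<Sum>i\<in>UNIV. \<Sum>j\<in>UNIV. norm (A $ i $ j)) ^ n / fact n)"
    using summable_exp[of "\<Sum>i\<in>UNIV. \<Sum>j\<in>UNIV. norm (A $ i $ j)"] by (simp add: field_simps)
  show "norm (norm (exp_term A a b n)) \<le> (\<Sum>i\<in>UNIV. \<Sum>j\<in>UNIV. norm (A $ i $ j)) ^ n / fact n" for n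
    using norm_mpow_le[of A n a b] by (simp add: exp_term_def norm_divide divide_right_mono)
qed

lemma exp_term_sums: "exp_term A a b sums (mexp A $ a $ b)"
proof -
  have s: "exp_term A a b sums suminf (exp_term A a b)" for a b
    by (rule summable_sums[OF summable_norm_cancel[OF summable_exp_term]])
  have scaled: "(1 / fact n) *\<^sub>R c = c / fact n" for n and c :: complex
    by (simp add: scaleR_conv_of_real)
  have "(\<lambda>n. (1 / fact n) *\<^sub>R mpow A n) sums (\<chi> a b. suminf (exp_term A a b))"
    unfolding sums_def
  proof (intro vec_tendstoI)
    fix a b
    show "(\<lambda>n. (\<Sum>k<n. (1 / fact k) *\<^sub>R mpow A k) $ a $ b) \<longlonglongrightarrow> (\<chi> a b. suminf (exp_term A a b)) $ a $ b"
      using s[of a b] unfolding sums_def exp_term_def by (simp add: scaled)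
  qed
  then have "mexp A = (\<chi> a b. suminf (exp_term A a b))"
    unfolding mexp_def mpow_def by (rule sums_unique[symmetric])
  then show ?thesis using s by simp
qed

lemma exp_product_sums:
  "(\<lambda>n. \<Sum>i\<le>n. exp_term A a a' i * exp_term B b b' (n - i)) sums (mexp A $ a $ a' * mexp B $ b $ b')"
  using Cauchy_product_sums[OF summable_exp_term summable_exp_term, of A a a' B b b']
  by (simp add: sums_unique[OF exp_term_sums, symmetric])

text \<open>The n-th coefficient of the Cauchy product is A^n / n! times the binomial expansion of
  (1 - 1)^n, which is 0 except for n = 0.\<close>

lemma mexp_uminus: "mexp A ** mexp (- A) = mat 1"
proof -
  have "(mexp A ** mexp (- A)) $ a $ b = mat 1 $ a $ b" for a b
  proof -
    have "(\<Sum>c\<in>UNIV. \<Sum>i\<le>n. exp_term A a c i * exp_term (- A) c b (n - i)) = (if n = 0 then mat 1 $ a $ b else 0)" for n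
    proof -
      have "(\<Sum>c\<in>UNIV. \<Sum>i\<le>n. exp_term A a c i * exp_term (- A) c b (n - i)) =
          (\<Sum>i\<le>n. (\<Sum>c\<in>UNIV. mpow A i $ a $ c * mpow A (n - i) $ c $ b) * (-1) ^ (n - i) / (fact i * fact (n - i)))"
        unfolding exp_term_def mpow_uminus
        by (subst sum.swap) (simp add: sum_distrib_left sum_distrib_right sum_divide_distrib mult_ac)
      also have "\<dots> = (\<Sum>i\<le>n. mpow A n $ a $ b / fact n * (of_nat (n choose i) * 1 ^ i * (-1) ^ (n - i)))"
      proof (intro sum.cong refl)
        fix i assume "i \<in> {..n}"
        then have i: "i \<le> n" by simp
        have "(\<Sum>c\<in>UNIV. mpow A i $ a $ c * mpow A (n - i) $ c $ b) = mpow A n $ a $ b"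
          using mpow_add[of A i "n - i"] i by (simp add: matrix_matrix_mult_def)
        then show "(\<Sum>c\<in>UNIV. mpow A i $ a $ c * mpow A (n - i) $ c $ b) * (-1) ^ (n - i) / (fact i * fact (n - i)) =
            mpow A n $ a $ b / fact n * (of_nat (n choose i) * 1 ^ i * (-1) ^ (n - i))"
          using binomial_fact[OF i, where 'a = complex] by (simp add: field_simps)
      qed
      also have "\<dots> = mpow A n $ a $ b / fact n * (1 + (-1)) ^ n"
        unfolding binomial_ring sum_distrib_left ..
      finally show ?thesis by (simp add: power_0_left)
    qed
    moreover have "(\<lambda>n. \<Sum>c\<in>UNIV. \<Sum>i\<le>n. exp_term A a c i * exp_term (- A) c b (n - i)) sums
        (\<Sum>c\<in>UNIV. mexp A $ a $ c * mexp (- A) $ c $ b)"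
      by (intro sums_sum exp_product_sums)
    ultimately have "(\<lambda>n. if n = 0 then mat 1 $ a $ b else 0) sums (mexp A ** mexp (- A)) $ a $ b"
      by (simp add: matrix_matrix_mult_def)
    then show ?thesis using sums_single[of 0 "\<lambda>_. mat 1 $ a $ b"] sums_unique2 by blast
  qed
  then show ?thesis by (simp add: Finite_Cartesian_Product.vec_eq_iff)
qed

lemma invertible_mexp: "invertible (mexp A)"
  using mexp_uminus[of A] unfolding invertible_def using matrix_left_right_inverse by blast

lemma matrix_mult_sums:
  assumes "\<And>p q. (\<lambda>n. S n $ p $ q) sums (K $ p $ q :: complex)"
  shows "(\<lambda>n. (R ** S n) $ p $ q) sums (R ** K) $ p $ q" "(\<lambda>n. (S n ** R) $ p $ q) sums (K ** R) $ p $ q"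
  unfolding matrix_matrix_mult_def by (auto intro!: sums_sum sums_mult sums_mult2 assms)

lemma kron_left:
  "(kron A (mat 1) ** B) $ p $ q = (\<Sum>c\<in>UNIV. A $ fst p $ c * B $ (c, snd p) $ q)"
proof -
  have "(kron A (mat 1) ** B) $ p $ q =
      (\<Sum>r\<in>UNIV \<times> UNIV. A $ fst p $ fst r * (if snd p = snd r then 1 else 0) * B $ r $ q)"
    by (simp add: matrix_matrix_mult_def kron_def Finite_Cartesian_Product.mat_def)
  also have "\<dots> = (\<Sum>(c, d)\<in>UNIV \<times> UNIV. if snd p = d then A $ fst p $ c * B $ (c, d) $ q else 0)"
    by (intro sum.cong) auto
  finally show ?thesis by (simp add: sum.cartesian_product[symmetric] del: UNIV_Times_UNIV)
qed

lemma kron_right: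
  "(kron (mat 1) A ** B) $ p $ q = (\<Sum>c\<in>UNIV. A $ snd p $ c * B $ (fst p, c) $ q)"
proof -
  have "(kron (mat 1) A ** B) $ p $ q =
      (\<Sum>r\<in>UNIV \<times> UNIV. (if fst p = fst r then 1 else 0) * A $ snd p $ snd r * B $ r $ q)"
    by (simp add: matrix_matrix_mult_def kron_def Finite_Cartesian_Product.mat_def)
  also have "\<dots> = (\<Sum>(c, d)\<in>UNIV \<times> UNIV. if fst p = c then A $ snd p $ d * B $ (c, d) $ q else 0)"
    by (intro sum.cong) auto
  also have "\<dots> = (\<Sum>d\<in>UNIV. \<Sum>c\<in>UNIV. if fst p = c then A $ snd p $ d * B $ (c, d) $ q else 0)"
    unfolding sum.cartesian_product[symmetric] by (rule sum.swap)
  finally show ?thesis by simp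
qed

text \<open>Commutation with \<open>A \<otimes> 1 + 1 \<otimes> A\<close> passes to its divided powers \<open>S n\<close>, and hence to
  their sum \<open>exp A \<otimes> exp A\<close>.\<close>
lemma mexp_kron_commute:
  fixes R :: "complex ^ ('m \<times> 'm) ^ ('m \<times> 'm::finite)"
  assumes R: "R ** (kron A (mat 1) + kron (mat 1) A) = (kron A (mat 1) + kron (mat 1) A) ** R"
  shows "R ** kron (mexp A) (mexp A) = kron (mexp A) (mexp A) ** R"
proof -
  let ?D = "kron A (mat 1) + kron (mat 1) A"
  define S where "S n = (\<chi> p q. \<Sum>i\<le>n. exp_term A (fst p) (fst q) i * exp_term A (snd p) (snd q) (n - i))" for n
  have S_sums: "(\<lambda>n. S n $ p $ q) sums (kron (mexp A) (mexp A) $ p $ q)" for p q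
    by (simp add: S_def kron_def exp_product_sums)
  \<comment> \<open>The Leibniz rule for exp(sA) \<otimes> exp(sA) in coefficients: the factor n + 1
    is split as i + (n + 1 - i), and each part is absorbed by one of the two exponential
    terms.\<close>
  have S_Suc: "S (Suc n) = (1 / of_nat (Suc n)) *\<^sub>C (?D ** S n)" for n
  proof -
    have "of_nat (Suc n) * S (Suc n) $ p $ q = (?D ** S n) $ p $ q" for p q
    proof -
      let ?f = "exp_term A (fst p) (fst q)" and ?g = "exp_term A (snd p) (snd q)"
      have left: "(\<Sum>i\<le>Suc n. of_nat i * ?f i * ?g (Suc n - i)) = (kron A (mat 1) ** S n) $ p $ q"
      proof -
        have "(\<Sum>i\<le>Suc n. of_nat i * ?f i * ?g (Suc n - i)) =
            (\<Sum>i\<le>n. of_nat (Suc i) * ?f (Suc i) * ?g (n - i))"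
          by (subst sum.atMost_Suc_shift) simp
        also have "\<dots> = (\<Sum>i\<le>n. \<Sum>c\<in>UNIV. A $ fst p $ c * (exp_term A c (fst q) i * ?g (n - i)))"
          unfolding exp_term_Suc by (simp add: sum_distrib_right mult.assoc)
        also have "\<dots> = (\<Sum>c\<in>UNIV. A $ fst p $ c * S n $ (c, snd p) $ q)"
          by (subst sum.swap) (simp add: S_def sum_distrib_left)
        also have "\<dots> = (kron A (mat 1) ** S n) $ p $ q"
          by (rule kron_left[symmetric])
        finally show ?thesis .
      qed
      have right: "(\<Sum>i\<le>Suc n. ?f i * (of_nat (Suc n - i) * ?g (Suc n - i))) = (kron (mat 1) A ** S n) $ p $ q"
      proof -
        have "(\<Sum>i\<le>Suc n. ?f i * (of_nat (Suc n - i) * ?g (Suc n - i))) =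
            (\<Sum>i\<le>n. ?f i * (of_nat (Suc (n - i)) * ?g (Suc (n - i))))"
          unfolding sum.atMost_Suc by (simp add: Suc_diff_le del: of_nat_Suc of_nat_diff)
        also have "\<dots> = (\<Sum>i\<le>n. \<Sum>c\<in>UNIV. A $ snd p $ c * (?f i * exp_term A c (snd q) (n - i)))"
          unfolding exp_term_Suc by (simp add: sum_distrib_left mult_ac)
        also have "\<dots> = (\<Sum>c\<in>UNIV. A $ snd p $ c * S n $ (fst p, c) $ q)"
          by (subst sum.swap) (simp add: S_def sum_distrib_left)
        also have "\<dots> = (kron (mat 1) A ** S n) $ p $ q"
          by (rule kron_right[symmetric])
        finally show ?thesis .
      qed
      have "of_nat (Suc n) * S (Suc n) $ p $ q =
          (\<Sum>i\<le>Suc n. of_nat i * ?f i * ?g (Suc n - i) + ?f i * (of_nat (Suc n - i) * ?g (Suc n - i)))"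
        unfolding S_def vec_lambda_beta sum_distrib_left
      proof (intro sum.cong refl)
        fix i assume "i \<in> {..Suc n}"
        then have "of_nat (Suc n) = of_nat i + (of_nat (Suc n - i) :: complex)"
          by (simp flip: of_nat_add)
        then show "of_nat (Suc n) * (?f i * ?g (Suc n - i)) =
            of_nat i * ?f i * ?g (Suc n - i) + ?f i * (of_nat (Suc n - i) * ?g (Suc n - i))"
          by (simp only: distrib_left distrib_right mult_ac)
      qed
      also have "\<dots> = (\<Sum>i\<le>Suc n. of_nat i * ?f i * ?g (Suc n - i)) +
          (\<Sum>i\<le>Suc n. ?f i * (of_nat (Suc n - i) * ?g (Suc n - i)))"
        by (rule sum.distrib)
      also have "\<dots> = (kron A (mat 1) ** S n) $ p $ q + (kron (mat 1) A ** S n) $ p $ q"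
        unfolding left right ..
      finally show ?thesis by (simp add: matrix_add_rdistrib)
    qed
    then show ?thesis
      by (simp add: Finite_Cartesian_Product.vec_eq_iff scaleC_vec_def scaleC_complex_def field_simps del: of_nat_Suc)
  qed
  have scale: "R ** (c *\<^sub>C B) = c *\<^sub>C (R ** B)" "(c *\<^sub>C B) ** R = c *\<^sub>C (B ** R)"
    for c and B :: "complex ^ ('m \<times> 'm) ^ ('m \<times> 'm)"
    by (simp_all add: matrix_matrix_mult_def scaleC_vec_def scaleC_complex_def
        Finite_Cartesian_Product.vec_eq_iff sum_distrib_left algebra_simps)
  have "R ** S n = S n ** R" for n
  proof (induction n)
    case 0
    have "S 0 = mat 1"
      by (auto simp: S_def exp_term_0 Finite_Cartesian_Product.mat_def Finite_Cartesian_Product.vec_eq_iff prod_eq_iff)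
    then show ?case by simp
  next
    case (Suc n)
    have "R ** (?D ** S n) = (R ** ?D) ** S n" by (rule matrix_mul_assoc)
    also have "\<dots> = ?D ** (R ** S n)" by (simp only: R matrix_mul_assoc)
    also have "\<dots> = (?D ** S n) ** R" by (simp only: Suc.IH matrix_mul_assoc)
    finally have "R ** (?D ** S n) = (?D ** S n) ** R" .
    then show ?case by (simp only: S_Suc scale)
  qed
  then have "(R ** kron (mexp A) (mexp A)) $ p $ q = (kron (mexp A) (mexp A) ** R) $ p $ q" for p q
    using sums_unique2[OF matrix_mult_sums(1)[OF S_sums, of R p q]] matrix_mult_sums(2)[OF S_sums, of R p q]
    by simp
  then show ?thesis by (simp add: Finite_Cartesian_Product.vec_eq_iff)
qed

section \<open>Commutativity on the group\<close>

lemma GL_simps [simp]: "carrier GL = {A. invertible A}" "x \<otimes>\<^bsub>GL\<^esub> y = x ** y" "\<one>\<^bsub>GL\<^esub> = mat 1"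
  by (simp_all add: GL_def)

lemma group_GL: "group (GL :: (complex ^ 'k ^ 'k::finite) monoid)"
proof (rule groupI)
  fix A :: "complex ^ 'k ^ 'k" assume "A \<in> carrier GL"
  then obtain B where "A ** B = mat 1" "B ** A = mat 1" by (auto simp: invertible_def)
  then show "\<exists>B\<in>carrier GL. B \<otimes>\<^bsub>GL\<^esub> A = \<one>\<^bsub>GL\<^esub>" by (auto simp: invertible_def)
qed (auto simp: matrix_mul_assoc invertible_mult invertible_def[of "mat 1"])

lemma matrix_mult_swap_inverse:
  assumes "R ** K = K ** R" "K ** L = mat 1" "L ** K = mat 1"
  shows "R ** L = L ** (R :: complex ^ 'n ^ 'n::finite)"
proof -
  have "R ** L = (L ** K) ** (R ** L)" using assms by simp
  also have "\<dots> = L ** (K ** R) ** L" by (simp add: matrix_mul_assoc)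
  also have "\<dots> = L ** R ** (K ** L)" by (simp add: assms(1)[symmetric] matrix_mul_assoc)
  finally show ?thesis using assms by simp
qed

text \<open>The group is generated by exponentials, for which the commutation is known.
  \<open>\<rho>G\<close> is controlled on the group only, so multiplicativity and invertibility are
  restated for generated elements.\<close>

lemma lin_group_kron_commute:
  fixes \<sigma> :: "'g::complex_lie \<Rightarrow> complex ^ 'm ^ 'm::finite"
  assumes int: "integrates \<iota> \<sigma> \<rho>G"
    and R: "\<And>x. R ** (kron (\<sigma> x) (mat 1) + kron (mat 1) (\<sigma> x)) = (kron (\<sigma> x) (mat 1) + kron (mat 1) (\<sigma> x)) ** R"
    and C: "C \<in> carrier (lin_group \<iota>)"
  shows "R ** kron (\<rho>G C) (\<rho>G C) = kron (\<rho>G C) (\<rho>G C) ** R"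
proof -
  let ?H = "range (\<lambda>x. mexp (\<iota> x))"
  have hom: "\<rho>G (A ** B) = \<rho>G A ** \<rho>G B" "invertible (\<rho>G A)"
    if "A \<in> generate GL ?H" "B \<in> generate GL ?H" for A B
    using int that by (auto simp: integrates_def hom_def lin_group_def)
  \<comment> \<open>\<open>hom\<close> does not include preservation of the unit; the image of the
    unit is idempotent and invertible, hence the identity.\<close>
  have one: "\<rho>G (mat 1) = mat 1"
  proof -
    have 1: "mat 1 \<in> generate GL ?H" using generate.one[of GL ?H] by simp
    then have "\<rho>G (mat 1) ** \<rho>G (mat 1) = \<rho>G (mat 1)" using hom(1)[OF 1 1] by simp
    moreover obtain L where "L ** \<rho>G (mat 1) = mat 1" using hom(2)[OF 1 1] by (auto simp: invertible_def)
    ultimately show ?thesis by (metis matrix_mul_assoc matrix_mul_lid)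
  qed
  have exp: "R ** kron (\<rho>G h) (\<rho>G h) = kron (\<rho>G h) (\<rho>G h) ** R" if "h \<in> ?H" for h
    using that int mexp_kron_commute[OF R] by (auto simp: integrates_def)
  from C have "C \<in> generate GL ?H" by (simp add: lin_group_def)
  then show ?thesis
  proof (induction rule: generate.induct)
    case one
    then show ?case using \<open>\<rho>G (mat 1) = mat 1\<close> by (simp add: kron_one)
  next
    case (incl h)
    then show ?case by (rule exp)
  next
    case (inv h)
    interpret GL: group "GL :: (complex ^ 'b ^ 'b) monoid" by (rule group_GL)
    have "h \<in> carrier GL" using inv invertible_mexp by auto
    then have inv_h: "h ** inv\<^bsub>GL\<^esub> h = mat 1" "inv\<^bsub>GL\<^esub> h ** h = mat 1"
      using GL.r_inv[of h] GL.l_inv[of h] by simp_all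
    have gen: "h \<in> generate GL ?H" "inv\<^bsub>GL\<^esub> h \<in> generate GL ?H"
      using inv by (auto intro: generate.incl generate.inv)
    have "\<rho>G h ** \<rho>G (inv\<^bsub>GL\<^esub> h) = mat 1" "\<rho>G (inv\<^bsub>GL\<^esub> h) ** \<rho>G h = mat 1"
      using hom(1)[OF gen] hom(1)[OF gen(2,1)] one inv_h by simp_all
    then show ?case
      by (intro matrix_mult_swap_inverse[OF exp[OF inv]]) (simp_all add: kron_mult kron_one)
  next
    case (eng h1 h2)
    have "\<rho>G (h1 \<otimes>\<^bsub>GL\<^esub> h2) = \<rho>G h1 ** \<rho>G h2" using hom(1) eng by simp
    then have "kron (\<rho>G (h1 \<otimes>\<^bsub>GL\<^esub> h2)) (\<rho>G (h1 \<otimes>\<^bsub>GL\<^esub> h2)) = kron (\<rho>G h1) (\<rho>G h1) ** kron (\<rho>G h2) (\<rho>G h2)"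
      by (simp add: kron_mult)
    moreover have "R ** (kron (\<rho>G h1) (\<rho>G h1) ** kron (\<rho>G h2) (\<rho>G h2)) =
        kron (\<rho>G h1) (\<rho>G h1) ** kron (\<rho>G h2) (\<rho>G h2) ** R"
      by (metis eng.IH matrix_mul_assoc)
    ultimately show ?case by simp
  qed
qed

section \<open>Diagonal blocks of the sum of fundamental modules\<close>

lemma blk_part_eq: "blk_part blk i M = blk_part blk i (mat 1) ** M ** blk_part blk i (mat 1)"
proof -
  let ?P = "blk_part blk i (mat 1)"
  have left: "(?P ** N) $ a $ b = (if blk a = i then N $ a $ b else 0)" for N a b
  proof -
    have "(?P ** N) $ a $ b = (\<Sum>c\<in>UNIV. if a = c then if blk a = i then N $ a $ b else 0 else 0)"
      unfolding matrix_matrix_mult_def blk_part_def Finite_Cartesian_Product.mat_def vec_lambda_beta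
      by (intro sum.cong) auto
    then show ?thesis by simp
  qed
  have right: "(N ** ?P) $ a $ b = (if blk b = i then N $ a $ b else 0)" for N a b
  proof -
    have "(N ** ?P) $ a $ b = (\<Sum>c\<in>UNIV. if b = c then if blk b = i then N $ a $ b else 0 else 0)"
      unfolding matrix_matrix_mult_def blk_part_def Finite_Cartesian_Product.mat_def vec_lambda_beta
      by (intro sum.cong) auto
    then show ?thesis by simp
  qed
  show ?thesis by (simp add: Finite_Cartesian_Product.vec_eq_iff left right) (simp add: blk_part_def)
qed

text \<open>R preserves the blocks in both tensor factors, so it commutes with the projection onto
  block i tensor block j, and compressing C \<otimes> C by this projection leaves the two blocks.
  Thus traces over two different fundamental modules become traces over the whole tensor
  square.\<close>

lemma block_kron_commute:
  assumes R: "R ** kron C C = kron C C ** R"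
    and blk: "\<And>p q. R $ p $ q \<noteq> 0 \<Longrightarrow> blk (fst p) = blk (fst q) \<and> blk (snd p) = blk (snd q)"
  shows "R ** kron (blk_part blk i C) (blk_part blk j C) = kron (blk_part blk i C) (blk_part blk j C) ** R"
proof -
  let ?P = "kron (blk_part blk i (mat 1)) (blk_part blk j (mat 1))"
  have P: "?P $ p $ q = (if p = q \<and> blk (fst q) = i \<and> blk (snd q) = j then 1 else 0)" for p q
    by (auto simp: kron_def blk_part_def Finite_Cartesian_Product.mat_def prod_eq_iff)
  have "(R ** ?P) $ p $ q = (?P ** R) $ p $ q" for p q
  proof -
    have "(R ** ?P) $ p $ q = (\<Sum>r\<in>UNIV. if r = q then if blk (fst q) = i \<and> blk (snd q) = j then R $ p $ q else 0 else 0)"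
      unfolding matrix_matrix_mult_def vec_lambda_beta P by (intro sum.cong) auto
    moreover have "(?P ** R) $ p $ q = (\<Sum>r\<in>UNIV. if r = p then if blk (fst p) = i \<and> blk (snd p) = j then R $ p $ q else 0 else 0)"
      unfolding matrix_matrix_mult_def vec_lambda_beta P by (intro sum.cong) auto
    ultimately show ?thesis using blk[of p q] by (cases "R $ p $ q = 0") auto
  qed
  then have RP: "R ** ?P = ?P ** R" by (simp add: Finite_Cartesian_Product.vec_eq_iff)
  have K: "kron (blk_part blk i C) (blk_part blk j C) = ?P ** kron C C ** ?P"
    by (simp add: kron_mult blk_part_eq[symmetric])
  have "R ** (?P ** kron C C ** ?P) = (R ** ?P) ** kron C C ** ?P" by (simp only: matrix_mul_assoc)
  also have "\<dots> = ?P ** (R ** kron C C) ** ?P" by (simp only: RP matrix_mul_assoc)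
  also have "\<dots> = ?P ** kron C C ** (R ** ?P)" by (simp only: R matrix_mul_assoc)
  also have "\<dots> = ?P ** kron C C ** ?P ** R" by (simp only: RP matrix_mul_assoc)
  finally show ?thesis by (simp only: K)
qed

lemma rep_block_diagonal:
  assumes "is_sum_of_fundamentals \<rho> e h d blk" "\<rho> y $ a $ b \<noteq> 0"
  shows "blk a = blk b"
proof -
  have "axis b 1 \<in> blk_space blk (blk b)" by (auto simp: blk_space_def axis_def split: if_splits)
  then have "\<rho> y *v axis b 1 \<in> blk_space blk (blk b)"
    using assms(1) by (auto simp: is_sum_of_fundamentals_def is_fundamental_def)
  moreover have "(\<rho> y *v axis b 1) $ a = \<rho> y $ a $ b"
    by (simp add: matrix_vector_mult_def axis_def if_distrib[of "\<lambda>x. _ * x"] cong: if_cong)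
  ultimately show ?thesis using assms(2) by (auto simp: blk_space_def)
qed

lemma tensor_matrix_block_diagonal:
  assumes "is_sum_of_fundamentals \<rho> e h d blk" "tensor_matrix \<rho> s $ p $ q \<noteq> 0"
  shows "blk (fst p) = blk (fst q) \<and> blk (snd p) = blk (snd q)"
proof (rule ccontr)
  assume "\<not> ?thesis"
  then have zero: "\<rho> x $ fst p $ fst q * \<rho> y $ snd p $ snd q = 0" for x y
    using rep_block_diagonal[OF assms(1)] by auto
  then have "tensor_matrix \<rho> s $ p $ q = 0"
    by (simp only: tensor_matrix_def tensor_lift_def lin_ext_def vec_lambda_beta zero
        cv.scale_zero_right sum.neutral_const)
  then show False using assms(2) by simp
qed

lemma sum_UNIV_prod: "(\<Sum>x\<in>UNIV. f x) = (\<Sum>a\<in>UNIV. \<Sum>b\<in>UNIV. f (a, b))"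
  by (simp add: sum.cartesian_product)

text \<open>Scalars move freely, so the trace factors into two traces standing in the order of T_1
  and T_2; \<open>int s\<close> stays clear of the convention for negative exponents.\<close>

lemma trace_kron:
  "trace_T1_T2 t (kron A B) r (int s) =
    (\<Sum>a\<in>UNIV. \<Sum>b\<in>UNIV. A $ a $ b *\<^sub>C t r b a) * (\<Sum>a\<in>UNIV. \<Sum>b\<in>UNIV. B $ a $ b *\<^sub>C t s b a)"
  "trace_T2_T1 t (kron A B) r (int s) =
    (\<Sum>a\<in>UNIV. \<Sum>b\<in>UNIV. B $ a $ b *\<^sub>C t s b a) * (\<Sum>a\<in>UNIV. \<Sum>b\<in>UNIV. A $ a $ b *\<^sub>C t r b a)"
proof -
  note transposed = sum.swap[of "\<lambda>a b. A $ a $ b *\<^sub>C t r b a"] sum.swap[of "\<lambda>a b. B $ a $ b *\<^sub>C t s b a"]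
  note product = sum_product scaleC_mult_left scaleC_mult_right scaleC_scaleC
  show "trace_T1_T2 t (kron A B) r (int s) =
    (\<Sum>a\<in>UNIV. \<Sum>b\<in>UNIV. A $ a $ b *\<^sub>C t r b a) * (\<Sum>a\<in>UNIV. \<Sum>b\<in>UNIV. B $ a $ b *\<^sub>C t s b a)"
    unfolding transposed by (simp add: trace_T1_T2_def kron_def sum_UNIV_prod product mult.commute)
  have "trace_T2_T1 t (kron A B) r (int s) = (\<Sum>a\<in>UNIV. \<Sum>b\<in>UNIV. \<Sum>c\<in>UNIV. \<Sum>d\<in>UNIV.
      (A $ c $ a * B $ d $ b) *\<^sub>C (t s b d * t r a c))"
    by (simp add: trace_T2_T1_def kron_def sum_UNIV_prod)
  also have "\<dots> = (\<Sum>b\<in>UNIV. \<Sum>a\<in>UNIV. \<Sum>c\<in>UNIV. \<Sum>d\<in>UNIV.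
      (A $ c $ a * B $ d $ b) *\<^sub>C (t s b d * t r a c))"
    by (rule sum.swap)
  also have "\<dots> = (\<Sum>b\<in>UNIV. \<Sum>a\<in>UNIV. \<Sum>d\<in>UNIV. \<Sum>c\<in>UNIV.
      (A $ c $ a * B $ d $ b) *\<^sub>C (t s b d * t r a c))"
    by (rule sum.cong[OF refl], rule sum.cong[OF refl], rule sum.swap)
  finally show "trace_T2_T1 t (kron A B) r (int s) =
    (\<Sum>a\<in>UNIV. \<Sum>b\<in>UNIV. B $ a $ b *\<^sub>C t s b a) * (\<Sum>a\<in>UNIV. \<Sum>b\<in>UNIV. A $ a $ b *\<^sub>C t r b a)"
    unfolding transposed by (simp add: product mult.commute)
qed

lemma bethe_tau_blk_sum:
  "bethe_tau t blk i M r = (\<Sum>a\<in>UNIV. \<Sum>b\<in>UNIV. blk_part blk i M $ a $ b *\<^sub>C t r b a)"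
proof -
  have "bethe_tau t blk i M r = (\<Sum>a | blk a = i. \<Sum>b | blk b = i. blk_part blk i M $ a $ b *\<^sub>C t r b a)"
    unfolding bethe_tau_def blk_part_def by (intro sum.cong refl) simp
  also have "\<dots> = (\<Sum>a | blk a = i. \<Sum>b\<in>UNIV. blk_part blk i M $ a $ b *\<^sub>C t r b a)"
    by (intro sum.cong refl sum.mono_neutral_left) (auto simp: blk_part_def)
  also have "\<dots> = (\<Sum>a\<in>UNIV. \<Sum>b\<in>UNIV. blk_part blk i M $ a $ b *\<^sub>C t r b a)"
    by (intro sum.mono_neutral_left) (auto simp: blk_part_def)
  finally show ?thesis .
qed

lemma bethe_tau_commute:
  fixes inc :: "'g::complex_lie \<Rightarrow> 'y::complex_alg" and \<rho> :: "'y \<Rightarrow> complex ^ 'm ^ 'm::finite"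
    and t :: "nat \<Rightarrow> 'm \<Rightarrow> 'm \<Rightarrow> 'v::complex_alg"
  assumes cop: "is_coproduct form inc J \<Delta>" and shift: "is_shift inc J \<tau>" and UR: "is_universal_R \<Delta> \<tau> Rhat"
    and sum: "is_sum_of_fundamentals \<rho> e h d blk"
    and rtt: "is_RTT_yangian (R_coeff \<rho> Rhat) cg t"
    and int: "integrates \<iota> (\<lambda>x. \<rho> (inc x)) \<rho>G" and C: "C \<in> carrier (lin_group \<iota>)"
  shows "bethe_tau t blk i (\<rho>G C) r * bethe_tau t blk j (\<rho>G C) s =
    bethe_tau t blk j (\<rho>G C) s * bethe_tau t blk i (\<rho>G C) r"
proof -
  have rep: "is_matrix_rep \<rho>" using sum by (simp add: is_sum_of_fundamentals_def)
  let ?T = "tensor_matrix \<rho>"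
  \<comment> \<open>The sign comes from evaluating the universal R-matrix at -u, as in
    \<open>R_coeff\<close>. Giving the inverse series the same sign keeps the convolutions
    intact.\<close>
  define R where "R k = (-1) ^ k *\<^sub>C ?T (fps_nth Rhat k)" for k
  define inverse_R where "inverse_R = fps_left_inverse Rhat 1"
  define S where "S k = (-1) ^ k *\<^sub>C ?T (fps_nth inverse_R k)" for k
  have R0: "fps_nth Rhat 0 = 1" using UR by (simp add: is_universal_R_def)
  have left: "inverse_R * Rhat = 1"
    unfolding inverse_R_def by (rule fps_left_inverse) (simp add: R0)
  \<comment> \<open>The coefficients do not commute, so a left inverse has to be identified with a
    right inverse; the constant term 1 makes both available.\<close>
  have right: "Rhat * inverse_R = 1"
    unfolding inverse_R_def using fps_left_inverse_eq_fps_right_inverse[of 1 Rhat 1]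
    by (simp add: R0 fps_right_inverse)
  have T_zero: "?T 0 = 0" using tensor_matrix_add[OF rep, of 0 0] by simp
  have T_sum: "?T (\<Sum>i\<in>A. x i) = (\<Sum>i\<in>A. ?T (x i))" for A :: "nat set" and x
    by (induction A rule: infinite_finite_induct) (simp_all add: T_zero tensor_matrix_add[OF rep])
  have conv: "(\<Sum>j\<le>n. ((-1) ^ j *\<^sub>C ?T (fps_nth f j)) ** ((-1) ^ (n - j) *\<^sub>C ?T (fps_nth g (n - j)))) =
      (if n = 0 then mat 1 else 0)" if "f * g = 1" for f g n
  proof -
    have "(\<Sum>j\<le>n. ((-1) ^ j *\<^sub>C ?T (fps_nth f j)) ** ((-1) ^ (n - j) *\<^sub>C ?T (fps_nth g (n - j)))) =
        (\<Sum>j\<le>n. (-1) ^ n *\<^sub>C ?T (fps_nth f j * fps_nth g (n - j)))"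
      by (intro sum.cong) (auto simp: matrix_scale_mult tensor_matrix_mult[OF rep] power_add[symmetric])
    also have "\<dots> = (-1) ^ n *\<^sub>C ?T (fps_nth (f * g) n)"
      by (simp add: fps_mult_nth T_sum cv.scale_sum_right atMost_atLeast0)
    finally show ?thesis by (simp add: that T_zero tensor_matrix_one[OF rep])
  qed
  have SR: "(\<Sum>j\<le>n. S j ** R (n - j)) = (if n = 0 then mat 1 else 0)" for n
    unfolding S_def R_def by (rule conv[OF left])
  have RS: "(\<Sum>j\<le>n. R (n - j) ** S j) = (if n = 0 then mat 1 else 0)" for n
  proof -
    have "(\<Sum>j\<le>n. R (n - j) ** S j) = (\<Sum>j\<le>n. R j ** S (n - j))"
      by (rule sum.reindex_bij_witness[where i = "\<lambda>j. n - j" and j = "\<lambda>j. n - j"]) auto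
    then show ?thesis unfolding S_def R_def using conv[OF right] by simp
  qed
  let ?K = "kron (blk_part blk i (\<rho>G C)) (blk_part blk j (\<rho>G C))"
  have K: "R k ** ?K = ?K ** R k" for k
  proof (rule block_kron_commute)
    have "?T (inc x \<otimes>\<^sub>t 1 + 1 \<otimes>\<^sub>t inc x) = kron (\<rho> (inc x)) (mat 1) + kron (mat 1) (\<rho> (inc x))" for x
      using rep by (simp add: tensor_matrix_add tensor_matrix_tens is_matrix_rep_def)
    then have T: "?T (fps_nth Rhat k) ** (kron (\<rho> (inc x)) (mat 1) + kron (mat 1) (\<rho> (inc x))) =
        (kron (\<rho> (inc x)) (mat 1) + kron (mat 1) (\<rho> (inc x))) ** ?T (fps_nth Rhat k)" for x
      using universal_R_primitive[OF cop shift UR, of k x] tensor_matrix_mult[OF rep] by metis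
    show "R k ** kron (\<rho>G C) (\<rho>G C) = kron (\<rho>G C) (\<rho>G C) ** R k"
      using lin_group_kron_commute[OF int T C]
        matrix_scale_mult[of "(-1) ^ k" "?T (fps_nth Rhat k)" 1 "kron (\<rho>G C) (\<rho>G C)"]
        matrix_scale_mult[of 1 "kron (\<rho>G C) (\<rho>G C)" "(-1) ^ k" "?T (fps_nth Rhat k)"]
      by (simp add: R_def scaleC_one)
    fix p q assume "R k $ p $ q \<noteq> 0"
    then have "?T (fps_nth Rhat k) $ p $ q \<noteq> 0" by (auto simp: R_def scaleC_vec_def scaleC_complex_def)
    then show "blk (fst p) = blk (fst q) \<and> blk (snd p) = blk (snd q)"
      by (rule tensor_matrix_block_diagonal[OF sum])
  qed
  have "(\<lambda>k x y. R k $ x $ y) = R_coeff \<rho> Rhat"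
    by (simp add: fun_eq_iff R_def R_coeff_def tensor_matrix_def scaleC_vec_def scaleC_complex_def)
  then have "is_RTT_yangian (\<lambda>k x y. R k $ x $ y) cg t" using rtt by simp
  from trace_T1_T2_commute[OF this K SR RS, of r "int s"] show ?thesis
    by (simp add: trace_kron bethe_tau_blk_sum)
qed

theorem proposition5p6:
  fixes form :: "'g::complex_lie \<Rightarrow> 'g \<Rightarrow> complex"
    and H :: "'g set"
    and \<alpha> :: "'i::finite \<Rightarrow> 'g"
    and xp xm :: "'g \<Rightarrow> 'g"
    and inc J :: "'g \<Rightarrow> 'y::complex_alg"
    and \<Delta> :: "'y \<Rightarrow> ('y, 'y) tensor"
    and \<tau> :: "'y \<Rightarrow> 'y fls"
    and Rhat :: "('y, 'y) tensor fps"
    and e f h :: "'i \<Rightarrow> nat \<Rightarrow> 'n::complex_alg"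
    and \<phi> :: "'n \<Rightarrow> 'y"
    and blk :: "'m::finite \<Rightarrow> 'i"
    and \<rho> :: "'y \<Rightarrow> complex ^ 'm ^ 'm"
    and t :: "nat \<Rightarrow> 'm \<Rightarrow> 'm \<Rightarrow> 'v::complex_alg"
    and \<iota> :: "'g \<Rightarrow> complex ^ 'k ^ 'k::finite"
    and \<rho>G :: "complex ^ 'k ^ 'k \<Rightarrow> complex ^ 'm ^ 'm"
  defines "G \<equiv> carrier (lin_group \<iota>)"
    and "Reg \<equiv> regular_lifts \<iota> CARD('i)"
  assumes "simple_lie_algebra TYPE('g)"
    and "root_data form H \<alpha>"
    and "root_vectors form H \<alpha> xp xm"
    and "is_yangian form inc J"
    and "is_coproduct form inc J \<Delta>"
    and "is_shift inc J \<tau>"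
    and "is_universal_R \<Delta> \<tau> Rhat"
    and "is_new_yangian (\<lambda>i j. form (\<alpha> i) (\<alpha> j)) e f h"
    and "is_identification form H \<alpha> xp xm inc J e f h \<phi>"
    and "is_sum_of_fundamentals \<rho> (\<lambda>j r. \<phi> (e j r)) (\<lambda>j r. \<phi> (h j r))
           (\<lambda>j. form (\<alpha> j) (\<alpha> j) / 2) blk"
    and "is_RTT_yangian (R_coeff \<rho> Rhat) (casimir_adjoint form) t"
    and "is_simply_connected_realization \<iota>"
    and "integrates \<iota> (\<lambda>x. \<rho> (inc x)) \<rho>G"
  shows "(\<forall>(z, X) \<in> Z_tilde t blk \<rho>G G Reg. bethe_bar t blk X \<subseteq> limit_subalgebra z)
    \<and> (\<forall>X \<in> wonderful_compactification blk \<rho>G G.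
         \<forall>x \<in> bethe_bar t blk X. \<forall>y \<in> bethe_bar t blk X. x * y = y * x)"
proof (intro conjI ballI)
  note rtt = \<open>is_RTT_yangian (R_coeff \<rho> Rhat) (casimir_adjoint form) t\<close>
  have t0: "t 0 a b = (if a = b then 1 else 0)" for a b
    using rtt by (simp add: is_RTT_yangian_def)
  fix p assume "p \<in> Z_tilde t blk \<rho>G G Reg"
  then show "case p of (z, X) \<Rightarrow> bethe_bar t blk X \<subseteq> limit_subalgebra z"
    by (cases p) (simp add: limit_subalgebra_contains[where t = t, OF t0])
next
  fix X x y
  assume X: "X \<in> wonderful_compactification blk \<rho>G G"
    and xy: "x \<in> bethe_bar t blk X" "y \<in> bethe_bar t blk X"
  show "x * y = y * x"
  \<comment> \<open>X is a limit of points of the whole group, so commutation is checked for every C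
    in G and not just for regular elements.\<close>
  proof (rule bethe_bar_commute[OF X _ xy])
    fix C i j r s assume "C \<in> G"
    then have C: "C \<in> carrier (lin_group \<iota>)" by (simp add: G_def)
    show "bethe_tau t blk i (\<rho>G C) r * bethe_tau t blk j (\<rho>G C) s =
        bethe_tau t blk j (\<rho>G C) s * bethe_tau t blk i (\<rho>G C) r"
      by (rule bethe_tau_commute[OF \<open>is_coproduct form inc J \<Delta>\<close> \<open>is_shift inc J \<tau>\<close>
            \<open>is_universal_R \<Delta> \<tau> Rhat\<close> _ \<open>is_RTT_yangian (R_coeff \<rho> Rhat) (casimir_adjoint form) t\<close>
            \<open>integrates \<iota> (\<lambda>x. \<rho> (inc x)) \<rho>G\<close> C])
        fact
  qed
qed

end
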